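(* There are precisely two $G$-orbits in $X_n$: $$X_n=G\cdot x_0\sqcup G\cdot x_1,\qquad x_0=1_{2n},\quad x_1=\mathrm{Diag}(\pi,1,\ldots,1,\pi^{-1}).$$ If $q$ is odd, then $$G\cdot x_0=\bigsqcup_{\lambda\in\Lambda_n^+,\ |\lambda|\text{ even}}K\cdot x_\lambda,\qquad G\cdot x_1=\bigsqcup_{\lambda\in\Lambda_n^+,\ |\lambda|\text{ odd}}K\cdot x_\lambda.$$ If $q$ is even, then (for $0\le r\le n$, $\lambda\in\Lambda_r^+$, $\mu\in\Lambda_{n-r}^{(2)}$) $x_{\lambda,\mu}$ is $G$-equivalent to $x_0$ if and only if $|\lambda|+|\mu|$ is even.
   Context: $k$ is a non-archimedean local field of characteristic $0$ with ring of integers $\mathcal{O}_k$, fixed prime element $\pi$, additive valuation $v_\pi$, and residue field of cardinality $q$; $k'/k$ is an unramified quadratic extension with ring of integers $\mathcal{O}_{k'}$, written $k'=k(\sqrt{\epsilon})$ with a fixed unit $\epsilon\in\mathcal{O}_k^\times$ such that $\epsilon-1\in4\mathcal{O}_k^\times$. $A^*$ is the conjugate transpose of a matrix $A$ over $k'$, $j_m$ is the $m\times m$ matrix with $1$'s on the anti-diagonal and $0$ elsewhere, $\Phi_y(t)$ is the characteristic polynomial of $y$. Let $n\ge1$. $G=\{g\in GL_{2n}(k')\mid g^*j_{2n}g=j_{2n}\}$, $X_n=\{x\in G\mid x^*=x,\ \Phi_{xj_{2n}}(t)=(t^2-1)^n\}$, $K=G\cap M_{2n}(\mathcal{O}_{k'})$;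 $G$ acts on $X_n$ by $g\cdot x=gxg^*$. $\Lambda_r^+=\{\lambda\in\mathbb{Z}^r\mid\lambda_1\ge\cdots\ge\lambda_r\ge0\}$, $\Lambda_m^{(2)}=\{\mu\in\mathbb{Z}^m\mid v_\pi(2)\ge\mu_1\ge\cdots\ge\mu_m\ge1\}$, $|\lambda|=\sum_i\lambda_i$, $|\mu|=\sum_i\mu_i$. $x_\lambda=\mathrm{Diag}(\pi^{\lambda_1},\ldots,\pi^{\lambda_n},\pi^{-\lambda_n},\ldots,\pi^{-\lambda_1})$ for $\lambda\in\Lambda_n^+$. For $\lambda\in\Lambda_r^+$ and $\mu\in\Lambda_{n-r}^{(2)}$, $x_{\lambda,\mu}$ is the block diagonal matrix with diagonal blocks $\mathrm{Diag}(\pi^{\lambda_1},\ldots,\pi^{\lambda_r})$, $E_{n-r}(\mu)$, $\mathrm{Diag}(\pi^{-\lambda_r},\ldots,\pi^{-\lambda_1})$ (empty blocks omitted), where $E_m(\mu)$ is the $2m\times2m$ matrix whose only nonzero entries are, for $1\le i\le m$: $\pi^{-\mu_i}(1-\epsilon)$ at $(m+1-i,m+1-i)$, $\pi^{\mu_i}$ at $(m+i,m+i)$, $-\sqrt{\epsilon}$ at $(m+1-i,m+i)$, and $\sqrt{\epsilon}$ at $(m+i,m+1-i)$. *)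

theory Defs
  imports "HOL-Library.Disjoint_Sets" "Jordan_Normal_Form.Char_Poly"
begin

text \<open>
  The field k' is a type, and k is a subset of it. A discrete valuation on a subfield K is an
  integer-valued function that is only meaningful on the nonzero elements of K; the value at 0
  (mathematically infinite) is arbitrary, so 0 is always treated separately.
\<close>

definition is_subfield :: "'a::field set \<Rightarrow> bool" where
  "is_subfield K \<longleftrightarrow> 0 \<in> K \<and> 1 \<in> K \<and>
     (\<forall>x\<in>K. \<forall>y\<in>K. x + y \<in> K \<and> x * y \<in> K) \<and> (\<forall>x\<in>K. - x \<in> K \<and> inverse x \<in> K)"

definition discrete_valuation :: "'a::field set \<Rightarrow> ('a \<Rightarrow> int) \<Rightarrow> bool" where
  "discrete_valuation K v \<longleftrightarrow>
     (\<forall>x\<in>K - {0}. \<forall>y\<in>K - {0}. v (x * y) = v x + v y) \<and>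
     (\<forall>x\<in>K - {0}. \<forall>y\<in>K - {0}. x + y \<noteq> 0 \<longrightarrow> min (v x) (v y) \<le> v (x + y)) \<and>
     v ` (K - {0}) = UNIV"

definition val_ideal :: "'a::field set \<Rightarrow> ('a \<Rightarrow> int) \<Rightarrow> int \<Rightarrow> 'a set" where
  "val_ideal K v m = {x \<in> K. x = 0 \<or> m \<le> v x}"

definition integer_ring :: "'a::field set \<Rightarrow> ('a \<Rightarrow> int) \<Rightarrow> 'a set" where
  "integer_ring K v = val_ideal K v 0"

definition units_in :: "'a::field set \<Rightarrow> 'a set" where
  "units_in R = {x \<in> R. \<exists>y\<in>R. x * y = 1}"

definition residue_field :: "'a::field set \<Rightarrow> ('a \<Rightarrow> int) \<Rightarrow> 'a set set" where
  "residue_field K v = integer_ring K v //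
     {(x, y). x \<in> integer_ring K v \<and> y \<in> integer_ring K v \<and> x - y \<in> val_ideal K v 1}"

definition val_complete :: "'a::field set \<Rightarrow> ('a \<Rightarrow> int) \<Rightarrow> bool" where
  "val_complete K v \<longleftrightarrow>
     (\<forall>X::nat \<Rightarrow> 'a. (\<forall>i. X i \<in> K) \<and> (\<forall>m. \<exists>N. \<forall>i\<ge>N. \<forall>j\<ge>N. X i - X j \<in> val_ideal K v m) \<longrightarrow>
        (\<exists>L\<in>K. \<forall>m. \<exists>N. \<forall>i\<ge>N. X i - L \<in> val_ideal K v m))"

definition nonarch_local_field :: "'a::field set \<Rightarrow> ('a \<Rightarrow> int) \<Rightarrow> bool" where
  "nonarch_local_field K v \<longleftrightarrow> is_subfield K \<and> discrete_valuation K v \<and> val_complete K v \<and>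
     finite (residue_field K v)"

text \<open>
  The whole type is the quadratic extension k(s) of k, where s is a square root of an element of k,
  and w is the normalized valuation of k'. Unramified means ramification index 1, i.e. the normalized
  valuation w restricts to the normalized valuation v of k; separability of the residue field
  extension is automatic, because finite fields are perfect.
\<close>

definition unramified_quadratic_extension ::
    "'a::field set \<Rightarrow> ('a \<Rightarrow> int) \<Rightarrow> ('a \<Rightarrow> int) \<Rightarrow> 'a \<Rightarrow> bool" where
  "unramified_quadratic_extension k v w s \<longleftrightarrow>
     s\<^sup>2 \<in> k \<and> s \<notin> k \<and> (\<forall>x. \<exists>a\<in>k. \<exists>b\<in>k. x = a + b * s) \<and>
     discrete_valuation UNIV w \<and> (\<forall>x\<in>k - {0}. w x = v x)"

definition qconj :: "'a::field set \<Rightarrow> 'a \<Rightarrow> 'a \<Rightarrow> 'a" where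
  "qconj k s x = (THE y. \<exists>a\<in>k. \<exists>b\<in>k. x = a + b * s \<and> y = a - b * s)"

definition conj_transpose :: "'a::field set \<Rightarrow> 'a \<Rightarrow> 'a mat \<Rightarrow> 'a mat" where
  "conj_transpose k s A = map_mat (qconj k s) (transpose_mat A)"

definition antidiag_mat :: "nat \<Rightarrow> 'a::field mat" where
  "antidiag_mat m = mat m m (\<lambda>(a, b). if a + b + 1 = m then 1 else 0)"

definition unitary_grp :: "'a::field set \<Rightarrow> 'a \<Rightarrow> nat \<Rightarrow> 'a mat set" where
  "unitary_grp k s n = {g \<in> carrier_mat (2 * n) (2 * n). invertible_mat g \<and>
     conj_transpose k s g * antidiag_mat (2 * n) * g = antidiag_mat (2 * n)}"

definition herm_space :: "'a::field set \<Rightarrow> 'a \<Rightarrow> nat \<Rightarrow> 'a mat set" where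
  "herm_space k s n = {x \<in> unitary_grp k s n. conj_transpose k s x = x \<and>
     char_poly (x * antidiag_mat (2 * n)) = ([:0, 1:]\<^sup>2 - 1) ^ n}"

definition integral_unitary_grp :: "'a::field set \<Rightarrow> ('a \<Rightarrow> int) \<Rightarrow> 'a \<Rightarrow> nat \<Rightarrow> 'a mat set" where
  "integral_unitary_grp k w s n =
     {g \<in> unitary_grp k s n. elements_mat g \<subseteq> integer_ring UNIV w}"

definition herm_orbit :: "'a::field set \<Rightarrow> 'a \<Rightarrow> 'a mat set \<Rightarrow> 'a mat \<Rightarrow> 'a mat set" where
  "herm_orbit k s H x = {g * x * conj_transpose k s g | g. g \<in> H}"

text \<open>Integer vectors are lists of integers, so the sum of the entries is \<^const>\<open>sum_list\<close>.\<close>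

definition Lambda_plus :: "nat \<Rightarrow> int list set" where
  "Lambda_plus r = {l. length l = r \<and> sorted_wrt (\<ge>) l \<and> (\<forall>i\<in>set l. 0 \<le> i)}"

definition Lambda2 :: "('a::field \<Rightarrow> int) \<Rightarrow> nat \<Rightarrow> int list set" where
  "Lambda2 v m = {l. length l = m \<and> sorted_wrt (\<ge>) l \<and> (\<forall>i\<in>set l. 1 \<le> i \<and> i \<le> v 2)}"

definition Diag :: "'a::zero list \<Rightarrow> 'a mat" where
  "Diag l = mat_diag (length l) (\<lambda>i. l ! i)"

definition x_diag :: "'a::field \<Rightarrow> int list \<Rightarrow> 'a mat" where
  "x_diag p l = Diag (map (\<lambda>i. p powi i) l @ rev (map (\<lambda>i. p powi (- i)) l))"

text \<open>
  Rows and columns are numbered from 0 here: with 1-based i, the positions m + 1 - i and m + i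
  become a = m - i < m and m + i - 1 = 2 m - 1 - a, and the i-th entry of mu is
  \<open>mu ! (i - 1)\<close>. Moreover epsilon is the square of s.
\<close>

definition E_mat :: "'a::field \<Rightarrow> 'a \<Rightarrow> int list \<Rightarrow> 'a mat" where
  "E_mat p s mu = (let m = length mu in mat (2 * m) (2 * m) (\<lambda>(a, b).
     if a = b then
       (if a < m then p powi (- (mu ! (m - 1 - a))) * (1 - s\<^sup>2) else p powi (mu ! (a - m)))
     else if a + b + 1 = 2 * m then (if a < m then - s else s)
     else 0))"

definition x_block :: "'a::field \<Rightarrow> 'a \<Rightarrow> int list \<Rightarrow> int list \<Rightarrow> 'a mat" where
  "x_block p s l mu = diag_block_mat
     [Diag (map (\<lambda>i. p powi i) l), E_mat p s mu, Diag (rev (map (\<lambda>i. p powi (- i)) l))]"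

end

theory Submission
  imports Defs
begin

text \<open>
  For \<open>x\<close> in the space the matrix \<open>y = x J\<close> is an involution, unitary for the form \<open>J\<close>, on which
  the group acts by conjugation; its two eigenspaces are orthogonal hermitian spaces of dimension \<open>n\<close>.
  To diagonalise \<open>x\<close>, choose an isotropic vector \<open>u\<close> whose value \<open>u* x u\<close> generates the ideal of all
  entries of \<open>x\<close>. Then \<open>u\<close> and \<open>y u / (u* x u)\<close> span a hyperbolic plane stable under \<open>y\<close>, which
  splits off. Such a \<open>u\<close> exists over every valuation ring containing 1/2: otherwise \<open>y\<close> would be
  congruent to, and then equal to, 1 or -1, against its characteristic polynomial. The ring of integers
  (for \<open>q\<close> odd) gives the \<open>K\<close>-orbits and the whole field, with its trivial valuation, the \<open>G\<close>-orbits.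
  Units of \<open>k\<close> being norms, the diagonal entries can be made powers of the prime. The discriminant of
  an eigenspace shows that the parity of the exponent sum is invariant, and an isometry of hermitian planes
  moves the whole sum into one exponent. A minor of non-units in the transition matrix separates the \<open>K\<close>-orbits.
\<close>

text \<open>The prime 2 shapes the proof. The reduction divides by 2, so over the integers it serves
  odd \<open>q\<close> only; over the whole field it just needs characteristic other than 2, and
  residue characteristic 2 is then felt only in the arithmetic of norms. There the assumption that
  \<open>s * s - 1\<close> is 4 times a unit is what counts: it makes
  \<open>omega = (1 + s) / 2\<close> integral, with trace 1 and unit norm \<open>c0\<close>. From
  the integral basis 1, \<open>omega\<close> it follows that conjugation preserves the valuation,
  and the trace 1 makes norms of elements near 1 accessible to successive approximation.

  The value \<open>u* x u\<close> has to divide all entries, and not merely be nonzero, because the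
  second vector of the plane is obtained by division and must remain integral; the same divisibility
  later puts the exponents in order. For two diagonal matrices the equivalence by \<open>g\<close>
  can be rewritten as an equation linear in \<open>g\<close>. It yields the fixed vectors behind the
  discriminant, and it also forces the non-unit entries of the transition matrix.\<close>

lemma det_mat_diag: "det (mat_diag m f) = (\<Prod>i = 0..<m. f i)"
proof -
  have "det (mat_diag m f) = prod_list (diag_mat (mat_diag m f))"
    by (intro det_upper_triangular[of _ m]) (auto simp: mat_diag_def)
  also have "diag_mat (mat_diag m f) = map f [0..<m]"
    by (auto simp: diag_mat_def mat_diag_def)
  also have "prod_list (map f [0..<m]) = (\<Prod>i = 0..<m. f i)" by (induction m) auto
  finally show ?thesis .
qed

text \<open>Exchanging two pairs of the involution \<tau> as blocks commutes with \<tau>. The pairs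
  may coincide, so the order of the tests in \<sigma> matters. With \<tau> the reversal of indices,
  \<sigma> brings a chosen coordinate to a chosen place by a unitary permutation matrix.\<close>

lemma pair_swap:
  fixes \<tau> :: "nat \<Rightarrow> nat"
  assumes "\<tau> t = r" "\<tau> r = t" "\<tau> i = k" "\<tau> k = i" "r \<noteq> t" "i \<noteq> k"
  defines "\<sigma> \<equiv> \<lambda>j. if j = t then i else if j = r then k else if j = i then t else if j = k then r else j"
  shows "\<sigma> (\<sigma> j) = j"
    and "(\<tau> j = r \<longleftrightarrow> j = t) \<Longrightarrow> (\<tau> j = t \<longleftrightarrow> j = r) \<Longrightarrow> (\<tau> j = i \<longleftrightarrow> j = k) \<Longrightarrow> (\<tau> j = k \<longleftrightarrow> j = i)
      \<Longrightarrow> \<sigma> (\<tau> j) = \<tau> (\<sigma> j)"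
proof -
  have t: "\<sigma> t = i" and r: "\<sigma> r = k" using assms(5) by (simp_all add: \<sigma>_def)
  have i: "\<sigma> i = t"
  proof (cases "i = r")
    case True
    then have "k = t" using assms(2,3) by simp
    then show ?thesis using r True by simp
  qed (simp add: \<sigma>_def)
  have k: "\<sigma> k = r"
  proof (cases "k = t")
    case True
    then have "i = r" using assms(1,4) by simp
    then show ?thesis using t True by simp
  qed (use assms(6) in \<open>simp add: \<sigma>_def\<close>)
  have other: "\<sigma> j = j" if "j \<noteq> t" "j \<noteq> r" "j \<noteq> i" "j \<noteq> k" for j
    using that by (simp add: \<sigma>_def)
  consider "j = t" | "j = r" | "j = i" | "j = k" | "j \<noteq> t" "j \<noteq> r" "j \<noteq> i" "j \<noteq> k" by blast
  then show "\<sigma> (\<sigma> j) = j"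
    using t r i k other[of j] by cases (simp_all only: not_False_eq_True simp_thms)
  assume "\<tau> j = r \<longleftrightarrow> j = t" "\<tau> j = t \<longleftrightarrow> j = r" "\<tau> j = i \<longleftrightarrow> j = k" "\<tau> j = k \<longleftrightarrow> j = i"
  then have other': "\<sigma> (\<tau> j) = \<tau> j" if "j \<noteq> t" "j \<noteq> r" "j \<noteq> i" "j \<noteq> k"
    using that by (intro other) simp_all
  consider "j = t" | "j = r" | "j = i" | "j = k" | "j \<noteq> t" "j \<noteq> r" "j \<noteq> i" "j \<noteq> k" by blast
  then show "\<sigma> (\<tau> j) = \<tau> (\<sigma> j)"
  proof cases
    case 5
    then show ?thesis using other[of j] other' by simp
  next
    case 1 show ?thesis unfolding 1 assms(1) t r assms(3) ..
  next
    case 2 show ?thesis unfolding 2 assms(2) t r assms(4) ..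
  next
    case 3 show ?thesis unfolding 3 assms(3) i k assms(1) ..
  next
    case 4 show ?thesis unfolding 4 assms(4) i k assms(2) ..
  qed
qed
lemma sum_list_update_int:
  "i < length l \<Longrightarrow> sum_list (l[i := x]) = sum_list l + x - (l ! i :: int)"
  by (induction l arbitrary: i) (auto split: nat.split)

text \<open>Removing a pair {x, f x} lowers the cardinality by 2. The use is for x -> x + 1 on a
  residue field of characteristic 2.\<close>

lemma even_card_involution:
  assumes "finite A" "\<And>x. x \<in> A \<Longrightarrow> f x \<in> A" "\<And>x. x \<in> A \<Longrightarrow> f (f x) = x" "\<And>x. x \<in> A \<Longrightarrow> f x \<noteq> x"
  shows "even (card A)"
  using assms
proof (induction "card A" arbitrary: A rule: less_induct)
  case less
  show ?case
  proof (cases "A = {}")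
    case False
    then obtain x where x: "x \<in> A" by blast
    let ?B = "A - {x, f x}"
    have card: "card A = card ?B + 2"
    proof -
      have "card ?B = card A - card {x, f x}"
        using less.prems x by (intro card_Diff_subset) auto
      moreover have "card {x, f x} = 2" using less.prems(4)[OF x] by auto
      moreover have "card {x, f x} \<le> card A" using less.prems x by (intro card_mono) auto
      ultimately show ?thesis by linarith
    qed
    have "even (card ?B)"
    proof (rule less.hyps)
      show "card ?B < card A" using card by simp
      show "finite ?B" using less.prems by simp
      show "f y \<in> ?B" if "y \<in> ?B" for y
      proof -
        have y: "y \<in> A" "y \<noteq> x" "y \<noteq> f x" using that by auto
        have "f y \<noteq> x" using less.prems(3)[OF y(1)] y by metis
        moreover have "f y \<noteq> f x" using less.prems(3)[OF y(1)] less.prems(3)[OF x] y by metis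
        ultimately show ?thesis using less.prems(2)[OF y(1)] by auto
      qed
    qed (use less.prems in auto)
    then show ?thesis using card by simp
  qed simp
qed

section \<open>Conjugation and valuation on the quadratic extension\<close>

locale unramified_setting =
  fixes k :: "'a::field_char_0 set" and v w :: "'a \<Rightarrow> int" and p s :: 'a
  assumes local_field: "nonarch_local_field k v"
    and unramified: "unramified_quadratic_extension k v w s"
    and p: "p \<in> k" "p \<noteq> 0" "v p = 1"
    and s2_unit: "s\<^sup>2 \<in> units_in (integer_ring k v)"
    and s2_minus_1: "s\<^sup>2 - 1 \<in> (\<lambda>u. 4 * u) ` units_in (integer_ring k v)"
begin

abbreviation cj :: "'a \<Rightarrow> 'a" where "cj \<equiv> qconj k s"

definition vge :: "int \<Rightarrow> 'a \<Rightarrow> bool" where "vge m x \<longleftrightarrow> x = 0 \<or> m \<le> w x"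

lemma k_0 [simp]: "0 \<in> k" and k_1 [simp]: "1 \<in> k"
  and k_add [intro]: "x \<in> k \<Longrightarrow> y \<in> k \<Longrightarrow> x + y \<in> k"
  and k_mult [intro]: "x \<in> k \<Longrightarrow> y \<in> k \<Longrightarrow> x * y \<in> k"
  and k_minus [intro]: "x \<in> k \<Longrightarrow> - x \<in> k"
  and k_inverse [intro]: "x \<in> k \<Longrightarrow> inverse x \<in> k"
  using local_field unfolding nonarch_local_field_def is_subfield_def by auto

lemma k_diff [intro]: "x \<in> k \<Longrightarrow> y \<in> k \<Longrightarrow> x - y \<in> k"
  using k_add[of x "- y"] by auto

lemma k_divide [intro]: "x \<in> k \<Longrightarrow> y \<in> k \<Longrightarrow> x / y \<in> k"
  using k_mult[of x "inverse y"] by (auto simp: divide_inverse)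

lemma k_power [intro]: "x \<in> k \<Longrightarrow> x ^ m \<in> k"
  by (induction m) auto

lemma k_powi [intro]: "x \<in> k \<Longrightarrow> x powi m \<in> k"
  by (auto simp: power_int_def)

lemma k_of_nat [simp]: "of_nat m \<in> k"
  by (induction m) auto

lemma k_numeral [simp]: "numeral m \<in> k"
  using k_of_nat[of "numeral m"] by simp

lemma s2_k [simp]: "s\<^sup>2 \<in> k" and s_notin_k: "s \<notin> k"
  and k_basis: "\<exists>a\<in>k. \<exists>b\<in>k. x = a + b * s"
  using unramified unfolding unramified_quadratic_extension_def by auto

lemma s_nonzero [simp]: "s \<noteq> 0"
  using s_notin_k by auto

lemma coords_unique:
  assumes "a \<in> k" "b \<in> k" "c \<in> k" "d \<in> k" "a + b * s = c + d * s"
  shows "a = c" "b = d"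
proof -
  have "b = d"
  proof (rule ccontr)
    assume "b \<noteq> d"
    then have "s = (c - a) / (b - d)" using assms by (simp add: field_simps)
    moreover have "(c - a) / (b - d) \<in> k" using assms by blast
    ultimately show False using s_notin_k by simp
  qed
  then show "a = c" "b = d" using assms by auto
qed

lemma cj_coords:
  assumes "a \<in> k" "b \<in> k"
  shows "cj (a + b * s) = a - b * s"
  unfolding qconj_def
proof (rule the_equality)
  fix y assume "\<exists>c\<in>k. \<exists>d\<in>k. a + b * s = c + d * s \<and> y = c - d * s"
  then show "y = a - b * s" using coords_unique assms by metis
qed (use assms in blast)

lemma cj_k: "x \<in> k \<Longrightarrow> cj x = x"
  using cj_coords[of x 0] by simp

lemma cj_s [simp]: "cj s = - s"
  using cj_coords[of 0 1] by simp

lemma cj_simps [simp]: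
  "cj 0 = 0" "cj 1 = 1" "cj (numeral m) = numeral m" "cj p = p"
  by (simp_all add: cj_k p)

lemma cj_add [simp]: "cj (x + y) = cj x + cj y"
proof -
  obtain a b c d where 1: "a \<in> k" "b \<in> k" "x = a + b * s" "c \<in> k" "d \<in> k" "y = c + d * s"
    using k_basis by metis
  have "x + y = (a + c) + (b + d) * s" using 1 by (simp add: algebra_simps)
  then have "cj (x + y) = (a + c) - (b + d) * s" using cj_coords 1 by (metis k_add)
  also have "\<dots> = (a - b * s) + (c - d * s)" by (simp add: algebra_simps)
  also have "\<dots> = cj x + cj y" using 1 cj_coords by auto
  finally show ?thesis .
qed

lemma cj_mult [simp]: "cj (x * y) = cj x * cj y"
proof -
  obtain a b c d where 1: "a \<in> k" "b \<in> k" "x = a + b * s" "c \<in> k" "d \<in> k" "y = c + d * s"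
    using k_basis by metis
  have "x * y = (a * c + b * d * s\<^sup>2) + (a * d + b * c) * s"
    using 1 by (simp add: algebra_simps power2_eq_square)
  moreover have "a * c + b * d * s\<^sup>2 \<in> k" "a * d + b * c \<in> k"
    using 1 by (intro k_add k_mult; simp)+
  ultimately have "cj (x * y) = (a * c + b * d * s\<^sup>2) - (a * d + b * c) * s"
    using cj_coords by metis
  also have "\<dots> = (a - b * s) * (c - d * s)" by (simp add: algebra_simps power2_eq_square)
  also have "\<dots> = cj x * cj y" using 1 cj_coords by auto
  finally show ?thesis .
qed

lemma cj_cj [simp]: "cj (cj x) = x"
proof -
  obtain a b where 1: "a \<in> k" "b \<in> k" "x = a + b * s"
    using k_basis by metis
  then show ?thesis using cj_coords[of a b] cj_coords[of a "- b"] by auto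
qed

lemma cj_minus [simp]: "cj (- x) = - cj x"
  using cj_add[of x "- x"] by (metis add.inverse_unique add.right_inverse cj_simps(1))

lemma cj_diff [simp]: "cj (x - y) = cj x - cj y"
  using cj_add[of x "- y"] by simp

lemma cj_eq_0 [simp]: "cj x = 0 \<longleftrightarrow> x = 0"
  by (metis cj_cj cj_simps(1))

lemma cj_inverse [simp]: "cj (inverse x) = inverse (cj x)"
  by (metis cj_eq_0 cj_mult cj_simps(2) inverse_unique inverse_zero right_inverse)

lemma cj_divide [simp]: "cj (x / y) = cj x / cj y"
  by (simp add: divide_inverse)

lemma cj_sum [simp]: "cj (sum f A) = (\<Sum>i\<in>A. cj (f i))"
  by (induction A rule: infinite_finite_induct) auto

lemma cj_fixed_iff: "cj x = x \<longleftrightarrow> x \<in> k"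
proof
  assume x: "cj x = x"
  obtain a b where 1: "a \<in> k" "b \<in> k" "x = a + b * s" using k_basis by metis
  with x cj_coords[of a b] have "b * s = 0" by (simp add: eq_neg_iff_add_eq_0)
  then show "x \<in> k" using 1 by simp
qed (rule cj_k)

lemma norm_k: "x * cj x \<in> k"
  by (simp add: mult.commute flip: cj_fixed_iff)

lemma w_mult: "x \<noteq> 0 \<Longrightarrow> y \<noteq> 0 \<Longrightarrow> w (x * y) = w x + w y"
  and w_add: "x \<noteq> 0 \<Longrightarrow> y \<noteq> 0 \<Longrightarrow> x + y \<noteq> 0 \<Longrightarrow> min (w x) (w y) \<le> w (x + y)"
  and w_eq_v: "x \<in> k \<Longrightarrow> x \<noteq> 0 \<Longrightarrow> w x = v x"
  using unramified unfolding unramified_quadratic_extension_def discrete_valuation_def by auto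

lemma w_1 [simp]: "w 1 = 0"
  using w_mult[of 1 1] by simp

lemma w_minus [simp]: "w (- x) = w x"
proof -
  have "w (- 1) = 0" using w_mult[of "- 1" "- 1"] by simp
  then show ?thesis using w_mult[of "- 1" x] by (cases "x = 0") auto
qed

lemma w_inverse: "x \<noteq> 0 \<Longrightarrow> w (inverse x) = - w x"
  using w_mult[of x "inverse x"] by simp

lemma w_divide: "x \<noteq> 0 \<Longrightarrow> y \<noteq> 0 \<Longrightarrow> w (x / y) = w x - w y"
  by (simp add: divide_inverse w_mult w_inverse)

lemma w_power: "x \<noteq> 0 \<Longrightarrow> w (x ^ m) = int m * w x"
  by (induction m) (auto simp: w_mult algebra_simps)

lemma w_p [simp]: "w p = 1"
  using p w_eq_v by simp

lemma w_p_powi [simp]: "w (p powi m) = m"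
  using p by (auto simp: power_int_def w_power w_inverse)

lemma w_prod: "finite A \<Longrightarrow> (\<And>i. i \<in> A \<Longrightarrow> f i \<noteq> 0) \<Longrightarrow> w (prod f A) = (\<Sum>i\<in>A. w (f i))"
  by (induction A rule: finite_induct) (auto simp: w_mult)

lemma p_powi_nonzero [simp]: "p powi m \<noteq> 0"
  using p by simp

lemma vge_0 [simp]: "vge m 0"
  by (simp add: vge_def)

lemma vge_add: "vge m x \<Longrightarrow> vge m y \<Longrightarrow> vge m (x + y)"
  using w_add[of x y] unfolding vge_def by fastforce

lemma vge_minus_iff [simp]: "vge m (- x) \<longleftrightarrow> vge m x"
  unfolding vge_def by simp

lemma vge_diff: "vge m x \<Longrightarrow> vge m y \<Longrightarrow> vge m (x - y)"
  using vge_add[of m x "- y"] by simp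

lemma vge_mult: "vge l x \<Longrightarrow> vge m y \<Longrightarrow> vge (l + m) (x * y)"
  unfolding vge_def using w_mult[of x y] by fastforce

lemma vge_mult0: "vge m x \<Longrightarrow> vge 0 y \<Longrightarrow> vge m (x * y)"
  "vge 0 x \<Longrightarrow> vge m y \<Longrightarrow> vge m (x * y)"
  using vge_mult[of m x 0 y] vge_mult[of 0 x m y] by simp_all

lemma vge_mono: "vge m x \<Longrightarrow> l \<le> m \<Longrightarrow> vge l x"
  unfolding vge_def by auto

lemma vge_0_1 [simp]: "vge 0 1"
  by (simp add: vge_def)

lemma not_vge_1_1 [simp]: "\<not> vge 1 1"
  by (simp add: vge_def)

lemma vge_0_of_nat [simp]: "vge 0 (of_nat m)"
  by (induction m) (auto intro!: vge_add)

lemma vge_0_numeral [simp]: "vge 0 (numeral m)"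
  using vge_0_of_nat[of "numeral m"] by simp

lemma vge_all_imp_0: "(\<And>m. vge m x) \<Longrightarrow> x = 0"
  unfolding vge_def by (metis add_le_same_cancel1 not_one_le_zero)

lemma vge_prime: "vge 1 (x * y) \<Longrightarrow> vge 0 x \<Longrightarrow> vge 0 y \<Longrightarrow> vge 1 x \<or> vge 1 y"
  unfolding vge_def using w_mult[of x y] by (cases "x = 0"; cases "y = 0") auto

lemma w_unit_add:
  assumes "x \<noteq> 0" "w x = 0" "vge 1 y"
  shows "x + y \<noteq> 0" "w (x + y) = 0"
proof -
  have "\<not> vge 1 (x + y)"
  proof
    assume "vge 1 (x + y)"
    then have "vge 1 ((x + y) - y)" using assms by (intro vge_diff)
    then show False using assms by (simp add: vge_def)
  qed
  moreover have "vge 0 (x + y)" using assms by (intro vge_add) (auto simp: vge_def)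
  ultimately show "x + y \<noteq> 0" "w (x + y) = 0" by (auto simp: vge_def)
qed

lemma val_ideal_iff: "val_ideal k v m = {x \<in> k. vge m x}"
  unfolding val_ideal_def vge_def using w_eq_v by (metis (no_types, lifting))

lemma units_iff: "x \<in> units_in (integer_ring k v) \<longleftrightarrow> x \<in> k \<and> x \<noteq> 0 \<and> w x = 0"
proof
  assume "x \<in> units_in (integer_ring k v)"
  then obtain y where "x \<in> k" "vge 0 x" "y \<in> k" "vge 0 y" "x * y = 1"
    unfolding units_in_def integer_ring_def val_ideal_iff by auto
  moreover from this have "x \<noteq> 0" "y \<noteq> 0" by auto
  moreover from this have "w x + w y = 0" using w_mult[of x y] \<open>x * y = 1\<close> by simp
  ultimately show "x \<in> k \<and> x \<noteq> 0 \<and> w x = 0" by (auto simp: vge_def)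
next
  assume "x \<in> k \<and> x \<noteq> 0 \<and> w x = 0"
  then show "x \<in> units_in (integer_ring k v)"
    unfolding units_in_def integer_ring_def val_ideal_iff
    by (auto simp: vge_def w_inverse intro!: bexI[of _ "inverse x"])
qed

lemma w_s [simp]: "w s = 0"
  using s2_unit w_power[of s 2] unfolding units_iff by simp

section \<open>Completeness, Hensel's lemma and the integral basis\<close>

lemma complete_limit:
  assumes X: "\<And>i. X i \<in> k" and step: "\<And>i. vge (int i) (X (Suc i) - X i)"
  obtains L where "L \<in> k" "\<And>m. \<exists>N. \<forall>i\<ge>N. vge m (X i - L)"
proof -
  have diff: "vge (int i) (X (i + j) - X i)" for i j
  proof (induction j)
    case (Suc j)
    have "vge (int i) (X (Suc (i + j)) - X (i + j))"
      using step[of "i + j"] vge_mono by fastforce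
    from vge_add[OF this Suc] show ?case by simp
  qed simp
  have "\<exists>N. \<forall>i\<ge>N. \<forall>j\<ge>N. X i - X j \<in> val_ideal k v m" for m
  proof (intro exI allI impI)
    fix i j assume ij: "nat m \<le> i" "nat m \<le> j"
    have "vge m (X i - X (nat m))" "vge m (X j - X (nat m))"
      using diff[of "nat m" "i - nat m"] diff[of "nat m" "j - nat m"] ij
      by (auto intro: vge_mono)
    from vge_diff[OF this] show "X i - X j \<in> val_ideal k v m"
      using X by (auto simp: val_ideal_iff)
  qed
  then have "\<exists>L\<in>k. \<forall>m. \<exists>N. \<forall>i\<ge>N. X i - L \<in> val_ideal k v m"
    using local_field X unfolding nonarch_local_field_def val_complete_def by blast
  then show thesis using that unfolding val_ideal_iff mem_Collect_eq by metis
qed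

text \<open>The map h -> d + e h^2 contracts the maximal ideal: its values at h and h' differ by e
  (h - h') (h + h'), and h + h' has positive valuation. The iteration from 0 stays inside
  \<open>k\<close>, the field whose completeness is given.\<close>

lemma hensel_quadratic:
  assumes d: "d \<in> k" "vge 1 d" and e: "e \<in> k" "vge 0 e"
  obtains h where "h \<in> k" "vge 1 h" "h = d + e * h\<^sup>2"
proof -
  define X where "X = rec_nat 0 (\<lambda>_ h. d + e * h\<^sup>2)"
  have X_0: "X 0 = 0" and X_Suc: "X (Suc i) = d + e * (X i)\<^sup>2" for i
    by (simp_all add: X_def)
  have X: "X i \<in> k \<and> vge 1 (X i)" for i
  proof (induction i)
    case (Suc i)
    have "vge 1 (X i * X i)" using Suc vge_mult0(1)[of 1 "X i" "X i"] vge_mono[of 1 _ 0] by simp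
    then show ?case using Suc d e unfolding X_Suc power2_eq_square
      by (auto intro!: vge_add vge_mult0)
  qed (simp add: X_0)
  have step: "vge (int i) (X (Suc i) - X i)" for i
  proof (induction i)
    case 0
    then show ?case using X[of "Suc 0"] X_0 vge_mono[of 1 _ 0] by simp
  next
    case (Suc i)
    have "X (Suc (Suc i)) - X (Suc i) = e * ((X (Suc i) - X i) * (X (Suc i) + X i))"
      unfolding X_Suc[of "Suc i"] X_Suc[of i]
      by (simp add: algebra_simps power2_eq_square)
    moreover have "vge (int i + 1) ((X (Suc i) - X i) * (X (Suc i) + X i))"
      using Suc X by (intro vge_mult vge_add) auto
    ultimately show ?case using vge_mult0(2)[OF e(2)] by (simp add: add.commute)
  qed
  obtain L where L: "L \<in> k" "\<And>m. \<exists>N. \<forall>i\<ge>N. vge m (X i - L)"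
    using complete_limit X step by metis
  have L1: "vge 1 L"
  proof -
    obtain i where "vge 1 (X i - L)" using L(2)[of 1] by blast
    from vge_diff[OF conjunct2[OF X[of i]] this] show ?thesis by simp
  qed
  have "vge m (L - (d + e * L\<^sup>2))" for m
  proof -
    obtain N where N: "\<forall>i\<ge>N. vge m (X i - L)" using L(2) by blast
    then have "vge m (X (Suc N) - L)" "vge m (X N - L)" by auto
    moreover have "vge 0 (X N + L)" using X[of N] L1 vge_mono[of 1 _ 0] by (auto intro: vge_add)
    ultimately have "vge m (e * ((X N - L) * (X N + L)) - (X (Suc N) - L))"
      using e by (intro vge_diff[OF vge_mult0(2)[OF _ vge_mult0(1)]])
    then show ?thesis unfolding X_Suc by (simp add: algebra_simps power2_eq_square)
  qed
  then have "L - (d + e * L\<^sup>2) = 0" by (rule vge_all_imp_0)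
  then show thesis using that L L1 by simp
qed

text \<open>A root of t^2 - t + c0, with \<open>c0\<close> as its norm. It is integral even when 2
  is not a unit, whereas integral elements may have coordinates with denominator 2 with respect to 1
  and \<open>s\<close>.\<close>

definition omega :: 'a where "omega = (1 + s) / 2"
definition c0 :: 'a where "c0 = (1 - s\<^sup>2) / 4"

lemma c0: "c0 \<in> k" "c0 \<noteq> 0" "w c0 = 0"
proof -
  obtain u where "u \<in> k" "u \<noteq> 0" "w u = 0" "s\<^sup>2 - 1 = 4 * u"
    using s2_minus_1 unfolding image_iff Bex_def units_iff by auto
  moreover from this have "c0 = - u" unfolding c0_def by (simp add: field_simps)
  ultimately show "c0 \<in> k" "c0 \<noteq> 0" "w c0 = 0" by auto
qed

lemma omega_square: "omega * omega = omega - c0"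
  by (simp add: omega_def c0_def field_simps power2_eq_square)

lemma cj_omega: "cj omega = 1 - omega"
  by (simp add: omega_def field_simps)

text \<open>A negative valuation would be doubled on the left of \<open>omega_square\<close> but not
  on the right.\<close>

lemma vge_omega: "vge 0 omega"
proof (rule ccontr)
  assume "\<not> vge 0 omega"
  then have 1: "omega \<noteq> 0" "w omega < 0" by (auto simp: vge_def)
  have "vge (w omega) (omega - c0)"
    using 1 c0 by (intro vge_diff) (auto simp: vge_def)
  then have "vge (w omega) (omega * omega)" by (simp add: omega_square)
  then show False using 1 by (simp add: vge_def w_mult)
qed

lemma basis_omega: obtains a b where "a \<in> k" "b \<in> k" "x = a + b * omega"
proof -
  obtain a b where 1: "a \<in> k" "b \<in> k" "x = a + b * s" using k_basis by metis
  show thesis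
    by (rule that[of "a - b" "2 * b"]) (use 1 in \<open>auto simp: omega_def field_simps\<close>)
qed

text \<open>Otherwise Hensel's lemma would lift \<open>- a\<close> to a root in \<open>k\<close> of the minimal polynomial of omega.\<close>

lemma omega_not_congruent:
  assumes a: "a \<in> k" "vge 0 a"
  shows "\<not> vge 1 (omega + a)"
proof
  assume *: "vge 1 (omega + a)"
  define r where "r = - a"
  define f where "f = r\<^sup>2 - r + c0"
  have r: "r \<in> k" "vge 0 r" using a by (auto simp: r_def)
  have f_eq: "f = - (omega + a) * (r - 1 + omega)"
    using omega_square by (simp add: f_def r_def algebra_simps power2_eq_square)
  have f: "f \<in> k" "vge 1 f"
  proof -
    show "f \<in> k" using r c0 unfolding f_def by auto
    show "vge 1 f" unfolding f_eq using * r vge_omega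
      by (intro vge_mult0(1) vge_add[of 0] vge_diff) (simp_all only: vge_minus_iff vge_0_1)
  qed
  \<comment> \<open>\<open>2 * r - 1\<close> is the derivative of the minimal polynomial at
    \<open>r\<close>. Its square is the discriminant \<open>s * s\<close> plus 4 f, hence a unit in
    every residue characteristic, and the correction \<open>h\<close> of the approximate root
    exists.\<close>
  have "(2 * r - 1) * (2 * r - 1) = s * s + 4 * f"
    by (simp add: f_def c0_def field_simps power2_eq_square)
  moreover have "vge 1 (4 * f)" using f by (intro vge_mult0(2)) auto
  ultimately have "(2 * r - 1) * (2 * r - 1) \<noteq> 0 \<and> w ((2 * r - 1) * (2 * r - 1)) = 0"
    using w_unit_add[of "s * s" "4 * f"] by (simp add: w_mult)
  then have D: "2 * r - 1 \<noteq> 0" "w (2 * r - 1) = 0" by (auto simp: w_mult)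
  have Dk: "2 * r - 1 \<in> k" using r by (intro k_diff k_mult) auto
  have "vge 0 (inverse (2 * r - 1))" using D by (simp add: vge_def w_inverse)
  then obtain h where h: "h \<in> k" "h = - f * inverse (2 * r - 1) + (- inverse (2 * r - 1)) * h\<^sup>2"
    using hensel_quadratic[of "- f * inverse (2 * r - 1)" "- inverse (2 * r - 1)"] f Dk
    by (metis k_inverse k_minus k_mult vge_minus_iff vge_mult0(1))
  have "h * (2 * r - 1) = - f - h\<^sup>2"
  proof -
    have "h * (2 * r - 1)
        = (- f * inverse (2 * r - 1) + (- inverse (2 * r - 1)) * h\<^sup>2) * (2 * r - 1)"
      using h(2) by simp
    also have "\<dots> = (- f - h\<^sup>2) * (inverse (2 * r - 1) * (2 * r - 1))"
      by (simp add: ring_distribs mult.assoc)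
    also have "\<dots> = - f - h\<^sup>2" using D(1) by simp
    finally show ?thesis .
  qed
  then have "f + (h * (2 * r - 1) + h\<^sup>2) = 0" by simp
  moreover have "(r + h - omega) * (r + h - (1 - omega)) = f + (h * (2 * r - 1) + h\<^sup>2)"
    using omega_square by (simp add: f_def algebra_simps power2_eq_square)
  ultimately have "(r + h - omega) * (r + h - (1 - omega)) = 0" by simp
  then have "omega = r + h \<or> omega = 1 - (r + h)" by auto
  then have "omega \<in> k" using k_add[OF r(1) h(1)] k_diff[OF k_1 k_add[OF r(1) h(1)]] by auto
  moreover have "s = 2 * omega - 1" by (simp add: omega_def field_simps)
  ultimately show False using s_notin_k k_diff[OF k_mult[OF k_numeral] k_1] by metis
qed

text \<open>Together with \<open>basis_omega\<close> this makes 1, \<open>omega\<close> an integral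
  basis. If the valuation of \<open>b\<close> were too small, division by \<open>b\<close> would
  make \<open>omega\<close> congruent to an element of \<open>k\<close> modulo the maximal
  ideal.\<close>

lemma vge_coord:
  assumes "a \<in> k" "b \<in> k" "vge m (a + b * omega)"
  shows "vge m b"
proof (rule ccontr)
  assume "\<not> vge m b"
  then have b: "b \<noteq> 0" "w b < m" by (auto simp: vge_def)
  have "vge (m + (- w b)) ((a + b * omega) * inverse b)"
    using assms b by (intro vge_mult) (auto simp: vge_def w_inverse)
  moreover have "(a + b * omega) * inverse b = omega + a / b" using b by (simp add: field_simps)
  ultimately have 1: "vge 1 (omega + a / b)" using b vge_mono by fastforce
  then have "vge 0 ((omega + a / b) - omega)" using vge_omega vge_mono[of 1 _ 0] by (intro vge_diff) auto
  then show False using omega_not_congruent[of "a / b"] assms 1 by auto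
qed

text \<open>Instead of the uniqueness of extensions of valuations, the integral basis is used:
  \<open>x\<close> and its conjugate differ by b (1 - 2 omega), where \<open>b\<close> is the second
  coordinate of \<open>x\<close>.\<close>

lemma vge_cj: assumes "vge m x" shows "vge m (cj x)"
proof -
  obtain a b where x: "a \<in> k" "b \<in> k" "x = a + b * omega" by (rule basis_omega)
  have b: "vge m b" using vge_coord x assms by blast
  have "cj x = x + b * (1 - 2 * omega)" using x by (simp add: cj_k cj_omega algebra_simps)
  moreover have "vge 0 (1 - 2 * omega)" using vge_omega by (intro vge_diff vge_mult0(1)) auto
  ultimately show ?thesis using assms b by (auto intro!: vge_add vge_mult0(1))
qed

lemma w_cj [simp]: "w (cj x) = w x"
proof (cases "x = 0")
  case False
  have "w y \<le> w (cj y)" if "y \<noteq> 0" for y using vge_cj[of "w y" y] that by (simp add: vge_def)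
  from this[of x] this[of "cj x"] False show ?thesis by simp
qed simp

section \<open>The residue field and norms of units\<close>

definition Ok :: "'a set" where "Ok = {x \<in> k. vge 0 x}"
definition cls :: "'a \<Rightarrow> 'a set" where "cls x = {y \<in> Ok. vge 1 (x - y)}"

lemma cls_eq_iff: "x \<in> Ok \<Longrightarrow> y \<in> Ok \<Longrightarrow> cls x = cls y \<longleftrightarrow> vge 1 (x - y)"
proof
  assume "x \<in> Ok" "y \<in> Ok" "cls x = cls y"
  then have "y \<in> cls x" by (auto simp: cls_def)
  then show "vge 1 (x - y)" by (simp add: cls_def)
next
  assume xy: "vge 1 (x - y)"
  have "vge 1 (x - z) \<longleftrightarrow> vge 1 (y - z)" for z
    using vge_add[OF xy, of "y - z"] vge_diff[OF _ xy, of "x - z"] by auto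
  then show "cls x = cls y" by (auto simp: cls_def)
qed

lemma residue_field_eq: "residue_field k v = cls ` Ok"
  unfolding residue_field_def quotient_def integer_ring_def val_ideal_iff
  by (auto simp: cls_def Ok_def)

lemma finite_residue: "finite (cls ` Ok)"
  using local_field unfolding nonarch_local_field_def residue_field_eq by simp

lemma Ok_closed [intro]: "x \<in> Ok \<Longrightarrow> y \<in> Ok \<Longrightarrow> x + y \<in> Ok"
  "x \<in> Ok \<Longrightarrow> y \<in> Ok \<Longrightarrow> x * y \<in> Ok" "x \<in> Ok \<Longrightarrow> - x \<in> Ok" "1 \<in> Ok" "0 \<in> Ok" "s\<^sup>2 \<in> Ok"
  unfolding Ok_def by (auto intro: vge_mult0 vge_add simp: vge_def[of _ "s\<^sup>2"] w_power)

lemma Ok_power2 [intro]: "x \<in> Ok \<Longrightarrow> x\<^sup>2 \<in> Ok"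
  by (auto simp: power2_eq_square)

text \<open>If 2 were not a unit, x -> x + 1 would be an involution without fixed points on the
  residue field.\<close>

lemma odd_residue_unit_2: assumes "odd (card (residue_field k v))" shows "w 2 = 0"
proof (rule ccontr)
  assume "w 2 \<noteq> 0"
  then have 2: "vge 1 2" using vge_0_numeral[of "num.Bit0 num.One"] by (auto simp: vge_def)
  define rep where "rep C = (SOME x. x \<in> Ok \<and> cls x = C)" for C
  have rep: "rep C \<in> Ok \<and> cls (rep C) = C" if "C \<in> cls ` Ok" for C
    unfolding rep_def by (rule someI_ex) (use that in auto)
  define f where "f C = cls (rep C + 1)" for C
  have f: "f (cls x) = cls (x + 1)" if "x \<in> Ok" for x
  proof -
    have "vge 1 (rep (cls x) - x)" using rep[of "cls x"] that cls_eq_iff by blast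
    then show ?thesis unfolding f_def using rep[of "cls x"] that by (subst cls_eq_iff) auto
  qed
  have "even (card (cls ` Ok))"
  proof (rule even_card_involution[where f = f])
    fix C assume "C \<in> cls ` Ok"
    then obtain x where x: "x \<in> Ok" "C = cls x" by blast
    have x1: "x + 1 \<in> Ok" using x by blast
    have x11: "x + 1 + 1 \<in> Ok" using x1 by blast
    have ff: "f C = cls (x + 1)" "f (f C) = cls (x + 1 + 1)" using f x x1 by auto
    show "f C \<in> cls ` Ok" using ff x1 by auto
    show "f (f C) = C" using 2 x x11 cls_eq_iff[OF x11 x(1)] unfolding ff(2) unfolding x(2) by simp
    show "f C \<noteq> C" using x x1 cls_eq_iff[OF x1 x(1)] unfolding ff(1) unfolding x(2) by simp
  qed (rule finite_residue)
  then show False using assms residue_field_eq by simp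
qed

text \<open>The form in \<open>a\<close> and \<open>b\<close> is the norm of a + b s. In residue
  characteristic 2 squaring is injective on the finite residue field, so \<open>u\<close> is already
  congruent to a square. Otherwise more than half of the classes are squares, and the classes of the
  form a^2 must meet those of the form u + s^2 b^2.\<close>

lemma norm_solvable_mod:
  assumes u: "u \<in> Ok" "\<not> vge 1 u"
  shows "\<exists>a\<in>Ok. \<exists>b\<in>Ok. vge 1 (a\<^sup>2 - s\<^sup>2 * b\<^sup>2 - u)"
proof -
  have sq_factor: "x\<^sup>2 - y\<^sup>2 = (x - y) * (x + y)" for x y :: 'a
    by (simp add: algebra_simps power2_eq_square)
  define S where "S = (\<lambda>x. cls (x\<^sup>2)) ` Ok"
  have S: "S \<subseteq> cls ` Ok" unfolding S_def by auto
  then have finS: "finite S" using finite_residue finite_subset by blast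
  show ?thesis
  proof (cases "vge 1 2")
    case True
    define rep where "rep C = (SOME x. x \<in> Ok \<and> cls x = C)" for C
    have rep: "rep C \<in> Ok \<and> cls (rep C) = C" if "C \<in> cls ` Ok" for C
      unfolding rep_def by (rule someI_ex) (use that in auto)
    define f where "f C = cls ((rep C)\<^sup>2)" for C
    have "inj_on f (cls ` Ok)"
    proof (rule inj_onI)
      fix C D assume CD: "C \<in> cls ` Ok" "D \<in> cls ` Ok" "f C = f D"
      define x y where "x = rep C" and "y = rep D"
      have xy: "x \<in> Ok" "y \<in> Ok" "C = cls x" "D = cls y" using rep CD by (auto simp: x_def y_def)
      have "cls (x\<^sup>2) = cls (y\<^sup>2)" using CD(3) unfolding f_def x_def y_def .
      then have "vge 1 (x\<^sup>2 - y\<^sup>2)" using cls_eq_iff[OF Ok_power2 Ok_power2] xy by blast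
      moreover have "vge 1 (2 * (y * (x - y)))"
        using True xy by (intro vge_mult0(1) vge_mult0(1)[of 0] vge_diff) (auto simp: Ok_def)
      ultimately have "vge 1 ((x\<^sup>2 - y\<^sup>2) - 2 * (y * (x - y)))" by (rule vge_diff)
      moreover have "(x\<^sup>2 - y\<^sup>2) - 2 * (y * (x - y)) = (x - y) * (x - y)"
        by (simp add: algebra_simps power2_eq_square)
      ultimately have "vge 1 (x - y)"
        using vge_prime[of "x - y" "x - y"] vge_diff[of 0 x y] xy by (auto simp: Ok_def)
      then show "C = D" using xy cls_eq_iff by blast
    qed
    moreover have "f ` (cls ` Ok) \<subseteq> cls ` Ok"
      unfolding f_def using rep Ok_power2 by (meson image_subsetI imageI)
    ultimately have "f ` (cls ` Ok) = cls ` Ok" by (intro endo_inj_surj finite_residue)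
    then obtain C where C: "C \<in> cls ` Ok" "f C = cls u" using u by (metis imageE imageI)
    then have "vge 1 ((rep C)\<^sup>2 - u)"
      using rep[OF C(1)] u(1) cls_eq_iff[OF Ok_power2 u(1)] unfolding f_def by blast
    then show ?thesis using rep[OF C(1)] by (intro bexI[of _ "rep C"] bexI[of _ 0]) auto
  next
    case False
    define r where "r t = (SOME x. x \<in> Ok \<and> cls (x\<^sup>2) = t)" for t
    have r: "r t \<in> Ok \<and> cls ((r t)\<^sup>2) = t" if "t \<in> S" for t
      unfolding r_def by (rule someI_ex) (use that in \<open>auto simp: S_def\<close>)
    have z0: "cls 0 \<in> S" unfolding S_def by (rule image_eqI[of _ _ 0]) auto
    \<comment> \<open>Every class is one of two opposite roots of its square, and 0 has a single
      root. Hence there are fewer than twice as many classes as squares.\<close>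
    have cover: "cls ` Ok \<subseteq> (\<lambda>t. cls (r t)) ` S \<union> (\<lambda>t. cls (- r t)) ` (S - {cls 0})"
    proof
      fix C assume "C \<in> cls ` Ok"
      then obtain x where x: "x \<in> Ok" "C = cls x" by blast
      define t where "t = cls (x\<^sup>2)"
      have t: "t \<in> S" using x by (auto simp: t_def S_def)
      have "vge 1 (x\<^sup>2 - (r t)\<^sup>2)"
        using r[OF t] x(1) cls_eq_iff[OF Ok_power2 Ok_power2] t_def by metis
      then have "vge 1 (x - r t) \<or> vge 1 (x + r t)"
        unfolding sq_factor using vge_prime[of "x - r t" "x + r t"] x(1) r[OF t]
        by (simp add: Ok_def vge_add vge_diff)
      then have alt: "C = cls (r t) \<or> C = cls (- r t)"
        using x(1) r[OF t] cls_eq_iff[of x "r t"] cls_eq_iff[of x "- r t"] unfolding x(2) by auto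
      show "C \<in> (\<lambda>t. cls (r t)) ` S \<union> (\<lambda>t. cls (- r t)) ` (S - {cls 0})"
      proof (cases "t = cls 0")
        case True
        have "vge 1 (r t * r t)"
          using cls_eq_iff[OF Ok_power2 Ok_closed(5)] r[OF t] True by (metis diff_zero power2_eq_square)
        then have "vge 1 (r t)" using vge_prime[of "r t" "r t"] r[OF t] by (simp add: Ok_def)
        then have "vge 1 (- r t - r t)" by (intro vge_diff) auto
        then have "cls (- r t) = cls (r t)" using r[OF t] cls_eq_iff[OF Ok_closed(3)] by blast
        then show ?thesis using alt t by auto
      next
        case False
        then show ?thesis using alt t by auto
      qed
    qed
    have "card (cls ` Ok) \<le> card ((\<lambda>t. cls (r t)) ` S \<union> (\<lambda>t. cls (- r t)) ` (S - {cls 0}))"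
      by (intro card_mono cover) (use finS in auto)
    also have "\<dots> \<le> card ((\<lambda>t. cls (r t)) ` S) + card ((\<lambda>t. cls (- r t)) ` (S - {cls 0}))"
      by (rule card_Un_le)
    also have "\<dots> \<le> card S + card (S - {cls 0})"
      by (intro add_mono card_image_le) (use finS in auto)
    also have "\<dots> < card S + card S"
      using card_Diff1_less[OF finS z0] by linarith
    finally have big: "card (cls ` Ok) < 2 * card S" by simp
    define g where "g t = cls (u + s\<^sup>2 * (r t)\<^sup>2)" for t
    have gOk: "u + s\<^sup>2 * (r t)\<^sup>2 \<in> Ok" if "t \<in> S" for t
      using r[OF that] u by auto
    have "inj_on g S"
    proof (rule inj_onI)
      fix t t' assume t: "t \<in> S" "t' \<in> S" "g t = g t'"
      then have "vge 1 (s\<^sup>2 * ((r t)\<^sup>2 - (r t')\<^sup>2))"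
        using cls_eq_iff[OF gOk[OF t(1)] gOk[OF t(2)]] by (simp add: g_def right_diff_distrib)
      moreover have "vge 0 ((r t)\<^sup>2 - (r t')\<^sup>2)"
        using Ok_power2 r[OF t(1)] r[OF t(2)] by (intro vge_diff) (auto simp: Ok_def)
      ultimately have "vge 1 ((r t)\<^sup>2 - (r t')\<^sup>2)"
        using vge_prime[of "s\<^sup>2"] by (auto simp: vge_def[of _ "s\<^sup>2"] w_power)
      then have "cls ((r t)\<^sup>2) = cls ((r t')\<^sup>2)"
        using r[OF t(1)] r[OF t(2)] cls_eq_iff[OF Ok_power2 Ok_power2] by blast
      then show "t = t'" using r[OF t(1)] r[OF t(2)] by metis
    qed
    then have cg: "card (g ` S) = card S" by (rule card_image)
    have "g ` S \<inter> S \<noteq> {}"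
    proof
      assume "g ` S \<inter> S = {}"
      then have "card (g ` S \<union> S) = card S + card S" using cg finS by (subst card_Un_disjoint) auto
      moreover have "g ` S \<union> S \<subseteq> cls ` Ok" using S gOk by (auto simp: g_def)
      ultimately show False using big card_mono[OF finite_residue, of "g ` S \<union> S"] by linarith
    qed
    then obtain t t' where t: "t \<in> S" "t' \<in> S" "g t = t'" by auto
    then have "cls ((r t')\<^sup>2) = cls (u + s\<^sup>2 * (r t)\<^sup>2)" using r[OF t(2)] by (simp add: g_def)
    then have "vge 1 ((r t')\<^sup>2 - (u + s\<^sup>2 * (r t)\<^sup>2))"
      using cls_eq_iff[OF Ok_power2 gOk[OF t(1)]] r[OF t(2)] by blast
    then have "vge 1 ((r t')\<^sup>2 - s\<^sup>2 * (r t)\<^sup>2 - u)" by (simp add: algebra_simps)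
    then show ?thesis using r[OF t(1)] r[OF t(2)] by blast
  qed
qed

text \<open>The norm of 1 + b omega is 1 + b + c0 b^2, so \<open>b\<close> has to be a fixed point
  of h -> d - c0 h^2.\<close>

lemma one_unit_norm:
  assumes d: "d \<in> k" "vge 1 d"
  obtains z where "z * cj z = 1 + d"
proof -
  obtain b where b: "b \<in> k" "b = d + (- c0) * b\<^sup>2"
    using hensel_quadratic[OF d, of "- c0"] c0 by (auto simp: vge_def)
  have "(1 + b * omega) * cj (1 + b * omega) = 1 + b + b * b * (omega - omega * omega)"
    using b by (simp add: cj_k cj_omega algebra_simps)
  also have "\<dots> = 1 + d + (b - (d + (- c0) * b\<^sup>2))"
    by (simp add: omega_square algebra_simps power2_eq_square)
  also have "b - (d + (- c0) * b\<^sup>2) = 0" using b(2) by (simp only: right_minus_eq)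
  also have "1 + d + 0 = 1 + d" by simp
  finally show thesis by (rule that)
qed

text \<open>The quotient of \<open>u\<close> by an approximate norm is 1 plus an element of the
  maximal ideal, hence itself a norm.\<close>

lemma unit_norm:
  assumes u: "u \<in> k" "u \<noteq> 0" "w u = 0"
  obtains z where "z * cj z = u"
proof -
  have "u \<in> Ok" "\<not> vge 1 u" using u by (auto simp: Ok_def vge_def)
  then obtain a b where ab: "a \<in> Ok" "b \<in> Ok" "vge 1 (a\<^sup>2 - s\<^sup>2 * b\<^sup>2 - u)"
    using norm_solvable_mod by blast
  define z where "z = a + b * s"
  have abk: "a \<in> k" "b \<in> k" using ab by (auto simp: Ok_def)
  have Nz: "z * cj z = a\<^sup>2 - s\<^sup>2 * b\<^sup>2"
    using abk by (simp add: z_def cj_k algebra_simps power2_eq_square)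
  define e where "e = u - z * cj z"
  have e: "e \<in> k" "vge 1 e"
  proof -
    show "e \<in> k" using u norm_k by (auto simp: e_def)
    have "e = - (a\<^sup>2 - s\<^sup>2 * b\<^sup>2 - u)" by (simp add: e_def Nz)
    then show "vge 1 e" using ab(3) by (simp only: vge_minus_iff)
  qed
  have nz: "z * cj z \<noteq> 0" "w (z * cj z) = 0"
    using w_unit_add[OF u(2,3), of "- e"] e(2) unfolding vge_minus_iff by (simp_all add: e_def)
  have "e / (z * cj z) \<in> k" using e norm_k by blast
  moreover have "vge 1 (e / (z * cj z))"
    using e(2) nz w_divide[of e "z * cj z"] unfolding vge_def by (cases "e = 0") simp_all
  ultimately obtain y where y: "y * cj y = 1 + e / (z * cj z)"
    using one_unit_norm by blast
  have "(y * z) * cj (y * z) = (y * cj y) * (z * cj z)" by simp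
  also have "\<dots> = u" unfolding y using nz(1) by (simp add: e_def field_simps)
  finally show thesis by (rule that)
qed

lemma scale_to_power:
  assumes "d \<in> k" "d \<noteq> 0"
  obtains c where "c \<noteq> 0" "w c = 0" "c * cj c * d = p powi (w d)"
proof -
  have "p powi (w d) / d \<in> k" "p powi (w d) / d \<noteq> 0" "w (p powi (w d) / d) = 0"
    using assms p by (auto simp: w_divide)
  then obtain c where c: "c * cj c = p powi (w d) / d" using unit_norm by blast
  then have "c \<noteq> 0" using \<open>p powi (w d) / d \<noteq> 0\<close> by auto
  moreover have "w c = 0"
    using arg_cong[OF c, of w] \<open>c \<noteq> 0\<close> \<open>w (p powi (w d) / d) = 0\<close> by (simp add: w_mult)
  moreover have "c * cj c * d = p powi (w d)" using c assms by simp
  ultimately show thesis using that by blast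
qed

lemma cj_p_powi [simp]: "cj (p powi m) = p powi m"
  using p by (auto intro!: cj_k)

lemma norm_p_powi: "p powi m * cj (p powi m) = p powi (2 * m)"
  unfolding cj_p_powi mult_2 power_int_add[OF disjI1[OF p(2)]] ..

lemma p_powi_add: "p powi a * p powi b = p powi (a + b)"
  using p by (simp add: power_int_add)

text \<open>One even exponent suffices on its own, the other coefficient being 0. If both are odd,
  the unit p - 1 is a norm, and the two terms are arranged to be (p - 1) / p and 1 / p.\<close>

lemma merge_solvable:
  obtains \<alpha> \<beta> where "\<alpha> * cj \<alpha> * p powi a + \<beta> * cj \<beta> * p powi b = 1"
proof -
  consider "even a" | "even b" | "odd a" "odd b" by blast
  then show thesis
  proof cases
    case 1
    then obtain m where "a = 2 * m" by blast
    then have "p powi (-m) * cj (p powi (-m)) * p powi a + 0 * cj 0 * p powi b = 1"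
      unfolding norm_p_powi p_powi_add by simp
    then show thesis by (rule that)
  next
    case 2
    then obtain m where "b = 2 * m" by blast
    then have "0 * cj 0 * p powi a + p powi (-m) * cj (p powi (-m)) * p powi b = 1"
      unfolding norm_p_powi p_powi_add by simp
    then show thesis by (rule that)
  next
    case 3
    then obtain m l where ml: "a = 2 * m + 1" "b = 2 * l + 1" by (meson oddE)
    have "vge 1 p" by (simp add: vge_def)
    then have "- 1 + p \<noteq> 0" "w (- 1 + p) = 0" "- 1 + p \<in> k"
      using w_unit_add[of "- 1" p] k_add[OF k_minus[OF k_1] p(1)] by simp_all
    then obtain y where y: "y * cj y = - 1 + p" using unit_norm by blast
    let ?A = "y * p powi (- m - 1)" and ?B = "p powi (- l - 1)"
    have A: "?A * cj ?A * p powi a = (- 1 + p) * inverse p"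
    proof -
      have "?A * cj ?A * p powi a
          = (y * cj y) * ((p powi (- m - 1) * cj (p powi (- m - 1))) * p powi a)"
        unfolding cj_mult by (simp only: ac_simps)
      also have "\<dots> = (- 1 + p) * p powi (- 1)"
        unfolding y norm_p_powi p_powi_add by (simp add: ml)
      finally show ?thesis by (simp add: power_int_minus)
    qed
    have B: "?B * cj ?B * p powi b = inverse p"
      unfolding norm_p_powi p_powi_add by (simp add: ml power_int_minus)
    have "?A * cj ?A * p powi a + ?B * cj ?B * p powi b = 1"
      unfolding A B using p by (simp add: field_simps)
    then show thesis by (rule that)
  qed
qed

end

section \<open>Hermitian forms and unitary matrices\<close>

locale unitary_setting = unramified_setting k v w p s
  for k :: "'a::field_char_0 set" and v w :: "'a \<Rightarrow> int" and p s :: 'a +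
  fixes n :: nat
begin

abbreviation N :: nat where "N \<equiv> 2 * n"
abbreviation ct :: "'a mat \<Rightarrow> 'a mat" where "ct \<equiv> conj_transpose k s"
abbreviation J :: "'a mat" where "J \<equiv> antidiag_mat N"
abbreviation opp :: "nat \<Rightarrow> nat" where "opp i \<equiv> N - Suc i"

lemma opp_lt [simp]: "i < N \<Longrightarrow> opp i < N"
  and opp_opp [simp]: "i < N \<Longrightarrow> opp (opp i) = i"
  and opp_neq [simp]: "i < N \<Longrightarrow> opp i \<noteq> i" "i < N \<Longrightarrow> i \<noteq> opp i"
  by presburger+

lemmas mat_assoc = assoc_mult_mat[of _ N N _ N _ N] mult_carrier_mat[of _ N N _ N]

lemma ct_carrier [simp]: "A \<in> carrier_mat a b \<Longrightarrow> ct A \<in> carrier_mat b a"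
  by (simp add: conj_transpose_def)

lemma ct_dim [simp]: "dim_row (ct A) = dim_col A" "dim_col (ct A) = dim_row A"
  by (simp_all add: conj_transpose_def)

lemma ct_index [simp]: "i < dim_col A \<Longrightarrow> j < dim_row A \<Longrightarrow> ct A $$ (i, j) = cj (A $$ (j, i))"
  by (simp add: conj_transpose_def)

lemma ct_ct [simp]: "ct (ct A) = A"
  by (rule eq_matI) auto

lemma ct_one [simp]: "ct (1\<^sub>m m) = 1\<^sub>m m"
  by (rule eq_matI) auto

lemma ct_mult: "A \<in> carrier_mat a b \<Longrightarrow> B \<in> carrier_mat b c \<Longrightarrow> ct (A * B) = ct B * ct A"
  by (rule eq_matI) (auto simp: scalar_prod_def mult.commute)

lemma J_carrier [simp]: "J \<in> carrier_mat N N"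
  and J_dim [simp]: "dim_row J = N" "dim_col J = N"
  by (auto simp: antidiag_mat_def)

lemma J_index [simp]: "i < N \<Longrightarrow> j < N \<Longrightarrow> J $$ (i, j) = (if i + j + 1 = N then 1 else 0)"
  by (simp add: antidiag_mat_def)

lemma ct_J [simp]: "ct J = J"
  by (rule eq_matI) (auto simp: add.commute)

lemma sum_opp_right:
  assumes "j < N" shows "(\<Sum>l = 0..<N. f l * (if l + j + 1 = N then 1 else 0)) = (f (opp j) :: 'a)"
proof -
  have "(\<Sum>l = 0..<N. f l * (if l + j + 1 = N then 1 else 0))
      = (\<Sum>l = 0..<N. if l = opp j then f l else 0)"
    using assms by (intro sum.cong) auto
  then show ?thesis using assms by simp
qed

lemma mult_J_right: "A \<in> carrier_mat a N \<Longrightarrow> i < a \<Longrightarrow> j < N \<Longrightarrow> (A * J) $$ (i, j) = A $$ (i, opp j)"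
  using sum_opp_right[of j "\<lambda>l. A $$ (i, l)"] by (simp add: scalar_prod_def)

lemma mult_J_left:
  assumes "A \<in> carrier_mat N b" "i < N" "j < b" shows "(J * A) $$ (i, j) = A $$ (opp i, j)"
proof -
  have "(J * A) $$ (i, j) = (\<Sum>l = 0..<N. A $$ (l, j) * (if l + i + 1 = N then 1 else 0))"
    using assms by (auto simp: scalar_prod_def antidiag_mat_def add.commute intro!: sum.cong)
  then show ?thesis using sum_opp_right[OF assms(2)] by simp
qed

lemma J_J [simp]: "J * J = 1\<^sub>m N"
  by (rule eq_matI) (auto simp: mult_J_right[of _ N] simp del: index_mult_mat(1))

lemma J_eq_0: "i < N \<Longrightarrow> j < N \<Longrightarrow> j \<noteq> opp i \<Longrightarrow> J $$ (i, j) = 0"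
  and J_eq_1: "i < N \<Longrightarrow> j < N \<Longrightarrow> j = opp i \<Longrightarrow> J $$ (i, j) = 1"
  by auto

text \<open>The group \<open>G\<close> when \<open>R\<close> is the whole field, and
  \<open>K\<close> when \<open>R\<close> is the ring of integers. The inverse of \<open>g\<close> is
  \<open>J * ct g * J\<close>.\<close>

definition GR :: "'a set \<Rightarrow> 'a mat set" where
  "GR R = {g \<in> carrier_mat N N. ct g * J * g = J \<and> (\<forall>i<N. \<forall>j<N. g $$ (i, j) \<in> R)}"

text \<open>For hermitian \<open>A\<close> the last equation says at once that \<open>A\<close> is
  unitary and that \<open>A * J\<close> is an involution. The condition on the characteristic
  polynomial is carried separately.\<close>

definition isX :: "'a mat \<Rightarrow> bool" where
  "isX A \<longleftrightarrow> A \<in> carrier_mat N N \<and> ct A = A \<and> A * J * A = J"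

text \<open>The hermitian pairing of \<open>x\<close> and \<open>y\<close> with matrix
  \<open>A\<close>, conjugate linear in \<open>x\<close>. Vectors are functions on all naturals, of
  which only the entries below \<open>N\<close> count.\<close>

definition form :: "'a mat \<Rightarrow> (nat \<Rightarrow> 'a) \<Rightarrow> (nat \<Rightarrow> 'a) \<Rightarrow> 'a" where
  "form A x y = (\<Sum>i = 0..<N. cj (x i) * (\<Sum>j = 0..<N. A $$ (i, j) * y j))"

abbreviation H where "H \<equiv> form J"

definition axpy :: "(nat \<Rightarrow> 'a) \<Rightarrow> 'a \<Rightarrow> (nat \<Rightarrow> 'a) \<Rightarrow> nat \<Rightarrow> 'a" where
  "axpy x t y = (\<lambda>i. x i + t * y i)"

definition single :: "nat \<Rightarrow> 'a \<Rightarrow> nat \<Rightarrow> 'a" where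
  "single j t = (\<lambda>i. if i = j then t else 0)"

definition gmat :: "(nat \<Rightarrow> nat \<Rightarrow> 'a) \<Rightarrow> 'a mat" where
  "gmat b = mat N N (\<lambda>(i, j). b j i)"

lemma form_axpy_left: "form A (axpy x t y) z = form A x z + cj t * form A y z"
  by (simp add: form_def axpy_def algebra_simps sum.distrib sum_distrib_left)

lemma form_axpy_right: "form A z (axpy x t y) = form A z x + t * form A z y"
  by (simp add: form_def axpy_def algebra_simps sum.distrib sum_distrib_left)

lemmas form_axpy = form_axpy_left form_axpy_right

lemma sum_single: "l < N \<Longrightarrow> (\<Sum>j = 0..<N. f j * single l t j) = f l * t"
  "l < N \<Longrightarrow> (\<Sum>j = 0..<N. cj (single l t j) * f j) = cj t * f l"
proof -
  assume l: "l < N"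
  have "(\<Sum>j = 0..<N. f j * single l t j) = (\<Sum>j = 0..<N. if j = l then f l * t else 0)"
    by (intro sum.cong) (auto simp: single_def)
  then show "(\<Sum>j = 0..<N. f j * single l t j) = f l * t" using l by simp
  have "(\<Sum>j = 0..<N. cj (single l t j) * f j) = (\<Sum>j = 0..<N. if j = l then cj t * f l else 0)"
    by (intro sum.cong) (auto simp: single_def)
  then show "(\<Sum>j = 0..<N. cj (single l t j) * f j) = cj t * f l" using l by simp
qed

lemma form_single_left: "i < N \<Longrightarrow> form A (single i t) y = cj t * (\<Sum>j = 0..<N. A $$ (i, j) * y j)"
  by (simp add: form_def sum_single)

lemma form_single: "i < N \<Longrightarrow> j < N \<Longrightarrow> form A (single i t) (single j u) = cj t * A $$ (i, j) * u"
  by (simp add: form_single_left sum_single)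

lemma H_alt: "H x y = (\<Sum>i = 0..<N. cj (x i) * y (opp i))"
  unfolding form_def
proof (intro sum.cong refl arg_cong2[where f = times])
  fix i assume "i \<in> {0..<N}"
  then have i: "i < N" by simp
  have "(\<Sum>j = 0..<N. J $$ (i, j) * y j) = (\<Sum>l = 0..<N. y l * (if l + i + 1 = N then 1 else 0))"
    using i by (intro sum.cong) (auto simp: add.commute)
  then show "(\<Sum>j = 0..<N. J $$ (i, j) * y j) = y (opp i)" using sum_opp_right[OF i] by simp
qed

lemma H_single_right: "j < N \<Longrightarrow> H x (single j t) = cj (x (opp j)) * t"
proof -
  assume j: "j < N"
  have "H x (single j t) = (\<Sum>i = 0..<N. if i = opp j then cj (x (opp j)) * t else 0)"
    unfolding H_alt using j by (intro sum.cong) (auto simp: single_def)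
  then show ?thesis using j by simp
qed

lemma form_herm:
  assumes "A \<in> carrier_mat N N" "ct A = A" shows "cj (form A x y) = form A y x"
proof -
  have A: "cj (A $$ (i, j)) = A $$ (j, i)" if "i < N" "j < N" for i j
    using ct_index[of j A i] assms that by auto
  have "cj (form A x y) = (\<Sum>i = 0..<N. \<Sum>j = 0..<N. x i * (cj (A $$ (i, j)) * cj (y j)))"
    by (simp add: form_def sum_distrib_left)
  also have "\<dots> = (\<Sum>i = 0..<N. \<Sum>j = 0..<N. cj (y j) * (A $$ (j, i) * x i))"
    by (intro sum.cong refl) (simp add: A)
  also have "\<dots> = form A y x"
    by (subst sum.swap) (simp add: form_def sum_distrib_left)
  finally show ?thesis .
qed

lemma H_herm: "cj (H x y) = H y x"
  by (rule form_herm) auto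

lemma gmat_carrier [simp]: "gmat b \<in> carrier_mat N N"
  and gmat_dim [simp]: "dim_row (gmat b) = N" "dim_col (gmat b) = N"
  and gmat_index [simp]: "i < N \<Longrightarrow> j < N \<Longrightarrow> gmat b $$ (i, j) = b j i"
  by (auto simp: gmat_def)

lemma ct_mult_mult_index:
  assumes "g \<in> carrier_mat N N" "A \<in> carrier_mat N N" "h \<in> carrier_mat N N" "i < N" "j < N"
  shows "(ct g * A * h) $$ (i, j) = form A (\<lambda>l. g $$ (l, i)) (\<lambda>l. h $$ (l, j))"
proof -
  have "ct g * A * h = ct g * (A * h)" using assms by (intro assoc_mult_mat) auto
  then show ?thesis using assms by (auto simp: form_def scalar_prod_def intro!: sum.cong)
qed

lemma form_cong: "(\<And>i. i < N \<Longrightarrow> x i = x' i) \<Longrightarrow> (\<And>i. i < N \<Longrightarrow> y i = y' i) \<Longrightarrow> form A x y = form A x' y'"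
  unfolding form_def by (intro sum.cong refl arg_cong2[where f = times]) auto

lemma gmat_gram:
  assumes "A \<in> carrier_mat N N" "i < N" "j < N"
  shows "(ct (gmat b) * A * gmat b) $$ (i, j) = form A (b i) (b j)"
  using assms by (subst ct_mult_mult_index) (auto intro!: form_cong)

text \<open>A basis of hyperbolic pairs \<open>b i\<close>, \<open>b (opp i)\<close>; equivalently,
  the columns of a unitary matrix.\<close>

definition frame :: "(nat \<Rightarrow> nat \<Rightarrow> 'a) \<Rightarrow> bool" where
  "frame b \<longleftrightarrow> (\<forall>i<N. \<forall>j<N. H (b i) (b j) = (if i + j + 1 = N then 1 else 0))"

lemma frameD: "frame b \<Longrightarrow> i < N \<Longrightarrow> j < N \<Longrightarrow> H (b i) (b j) = (if i + j + 1 = N then 1 else 0)"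
  by (simp add: frame_def)

lemma gmat_GR: "frame b \<Longrightarrow> (\<And>i j. i < N \<Longrightarrow> j < N \<Longrightarrow> b j i \<in> R) \<Longrightarrow> gmat b \<in> GR R"
  unfolding GR_def
  by (auto simp: gmat_gram frameD simp del: index_mult_mat(1) intro!: eq_matI)

text \<open>These frames are the columns of the monomial unitary matrices.\<close>

lemma frame_single:
  assumes "\<And>j. j < N \<Longrightarrow> \<sigma> j < N" "inj_on \<sigma> {..<N}" "\<And>j. j < N \<Longrightarrow> \<sigma> (opp j) = opp (\<sigma> j)"
    "\<And>j. j < N \<Longrightarrow> cj (\<gamma> j) * \<gamma> (opp j) = 1"
  shows "frame (\<lambda>j. single (\<sigma> j) (\<gamma> j))"
  unfolding frame_def
proof (intro allI impI)
  fix i j assume ij: "i < N" "j < N"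
  have "\<sigma> i + \<sigma> j + 1 = N \<longleftrightarrow> \<sigma> j = opp (\<sigma> i)" using assms(1)[of i] assms(1)[of j] ij by auto
  also have "\<dots> \<longleftrightarrow> \<sigma> j = \<sigma> (opp i)" using assms(3) ij by simp
  also have "\<dots> \<longleftrightarrow> j = opp i" using ij assms(2) by (intro inj_on_eq_iff) auto
  also have "\<dots> \<longleftrightarrow> i + j + 1 = N" using ij by auto
  finally have "\<sigma> i + \<sigma> j + 1 = N \<longleftrightarrow> i + j + 1 = N" .
  moreover have "i + j + 1 = N \<Longrightarrow> j = opp i" by auto
  ultimately show "H (single (\<sigma> i) (\<gamma> i)) (single (\<sigma> j) (\<gamma> j)) = (if i + j + 1 = N then 1 else 0)"
    using assms(1)[of i] assms(1)[of j] assms(4)[of i] ij by (auto simp: form_single)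
qed

text \<open>An Eichler transformation: \<open>b (opp t)\<close> stays, \<open>u\<close> replaces
  \<open>b t\<close>, and every other vector is moved along \<open>b (opp t)\<close> until it is
  orthogonal to \<open>u\<close>. The pairings among the moved vectors survive because
  \<open>b (opp t)\<close> is isotropic and orthogonal to all of them.\<close>

lemma frame_transvection:
  assumes b: "frame b" and t: "t < N" and u: "H u u = 0" "H u (b (opp t)) = 1"
  shows "frame (\<lambda>j. if j = t then u else if j = opp t then b (opp t)
    else axpy (b j) (- H u (b j)) (b (opp t)))"
proof -
  have opp: "opp t < N" "opp t \<noteq> t" using t by auto
  have u': "H (b (opp t)) u = 1" using H_herm[of u "b (opp t)"] u by simp
  have "opp t + opp t + 1 \<noteq> N" by presburger
  then have tt: "H (b (opp t)) (b (opp t)) = 0" using frameD[OF b opp(1) opp(1)] by simp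
  have bt: "H (b j) (b (opp t)) = 0" "H (b (opp t)) (b j) = 0" if "j < N" "j \<noteq> t" for j
    using frameD[OF b that(1) opp(1)] frameD[OF b opp(1) that(1)] that t by auto
  have swap: "cj (H u (b j)) = H (b j) u" for j by (rule H_herm)
  show ?thesis unfolding frame_def
  proof (intro allI impI)
    fix i j assume ij: "i < N" "j < N"
    have 1: "i + j + 1 = N \<longleftrightarrow> j = opp i" using ij by auto
    have 2: "j = opp i \<longleftrightarrow> i = opp j" "opp (opp t) = t" using ij t by auto
    show "H (if i = t then u else if i = opp t then b (opp t) else axpy (b i) (- H u (b i)) (b (opp t)))
        (if j = t then u else if j = opp t then b (opp t) else axpy (b j) (- H u (b j)) (b (opp t)))
       = (if i + j + 1 = N then 1 else 0)"
      using u u' tt bt[OF ij(1)] bt[OF ij(2)] opp frameD[OF b ij] 2 unfolding 1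
      by (auto simp: form_axpy swap)
  qed
qed

lemma GR_J:
  assumes "g \<in> GR R" shows "g * J * ct g = J"
proof -
  have g: "g \<in> carrier_mat N N" "ct g * J * g = J" using assms by (auto simp: GR_def)
  have "(J * ct g * J) * g = J * (ct g * J * g)"
    using g(1) by (simp add: mat_assoc)
  then have "(J * ct g * J) * g = 1\<^sub>m N" using g by simp
  then have "g * (J * ct g * J) = 1\<^sub>m N"
    using g(1) mat_mult_left_right_inverse[of "J * ct g * J" N g] by (simp add: mat_assoc)
  then have "g * (J * ct g * J) * J = J" by simp
  moreover have "g * (J * ct g * J) * J = g * J * ct g * (J * J)"
    using g(1) by (simp add: mat_assoc del: J_J)
  ultimately show ?thesis using g(1) by simp
qed

lemma GR_carrier: "g \<in> GR R \<Longrightarrow> g \<in> carrier_mat N N"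
  by (simp add: GR_def)

lemma GR_mono: "g \<in> GR R \<Longrightarrow> R \<subseteq> S \<Longrightarrow> g \<in> GR S"
  by (auto simp: GR_def)

end

section \<open>Groups and orbits over a subring stable under conjugation\<close>

text \<open>Both the ring of integers and the whole field are instances of the rings considered here.\<close>

locale conj_subring = unitary_setting k v w p s n
  for k :: "'a::field_char_0 set" and v w :: "'a \<Rightarrow> int" and p s :: 'a and n +
  fixes R :: "'a set"
  assumes R_0 [simp]: "0 \<in> R" and R_1 [simp]: "1 \<in> R"
    and R_add: "x \<in> R \<Longrightarrow> y \<in> R \<Longrightarrow> x + y \<in> R"
    and R_mult: "x \<in> R \<Longrightarrow> y \<in> R \<Longrightarrow> x * y \<in> R"
    and R_minus: "x \<in> R \<Longrightarrow> - x \<in> R"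
    and R_cj: "x \<in> R \<Longrightarrow> cj x \<in> R"
begin

lemma R_sum: "(\<And>i. i \<in> A \<Longrightarrow> f i \<in> R) \<Longrightarrow> sum f A \<in> R"
  by (induction A rule: infinite_finite_induct) (auto intro: R_add)

lemma R_diff: "x \<in> R \<Longrightarrow> y \<in> R \<Longrightarrow> x - y \<in> R"
  using R_add[of x "- y"] R_minus by simp

lemma GR_one: "1\<^sub>m N \<in> GR R"
  by (auto simp: GR_def)

lemma GR_ct: assumes "g \<in> GR R" shows "ct g \<in> GR R"
  using assms GR_J[OF assms] by (auto simp: GR_def R_cj)

lemma GR_mult: assumes "g \<in> GR R" "h \<in> GR R" shows "g * h \<in> GR R"
proof -
  have g: "g \<in> carrier_mat N N" "ct g * J * g = J" and h: "h \<in> carrier_mat N N" "ct h * J * h = J"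
    using assms by (auto simp: GR_def)
  have "ct (g * h) * J * (g * h) = ct h * (ct g * J * g) * h"
    unfolding ct_mult[OF g(1) h(1)] using g(1) h(1) by (simp add: mat_assoc)
  then have "ct (g * h) * J * (g * h) = J" using g h by simp
  moreover have "(g * h) $$ (i, j) \<in> R" if "i < N" "j < N" for i j
    using assms g(1) h(1) that by (auto simp: scalar_prod_def GR_def intro!: R_sum R_mult)
  ultimately show ?thesis using g(1) h(1) unfolding GR_def by auto
qed

lemma GR_inverse:
  assumes "g \<in> GR R"
  obtains h where "h \<in> GR R" "g * h = 1\<^sub>m N" "h * g = 1\<^sub>m N"
proof -
  have g: "g \<in> carrier_mat N N" "ct g * J * g = J" using assms by (auto simp: GR_def)
  have JR: "J \<in> GR R" by (auto simp: GR_def)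
  have "J * ct g * J \<in> GR R" using assms JR by (intro GR_mult GR_ct)
  moreover have "(J * ct g * J) * g = J * (ct g * J * g)"
    using g(1) by (simp add: mat_assoc)
  then have 1: "(J * ct g * J) * g = 1\<^sub>m N" using g by simp
  moreover have "g * (J * ct g * J) = 1\<^sub>m N"
    using g(1) 1 mat_mult_left_right_inverse[of "J * ct g * J" N g] by (simp add: mat_assoc)
  ultimately show thesis by (intro that)
qed

abbreviation orb :: "'a mat \<Rightarrow> 'a mat set" where "orb \<equiv> herm_orbit k s (GR R)"

lemma orb_ct: "orb x = {ct g * x * g | g. g \<in> GR R}"
  unfolding herm_orbit_def using GR_ct by (metis (no_types, opaque_lifting) ct_ct)

lemma mem_orb_iff: "y \<in> orb x \<longleftrightarrow> (\<exists>g\<in>GR R. ct g * x * g = y)"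
  unfolding orb_ct by blast

lemma orb_refl: "x \<in> carrier_mat N N \<Longrightarrow> x \<in> orb x"
  unfolding herm_orbit_def using GR_one by (intro CollectI exI[of _ "1\<^sub>m N"]) simp

lemma orb_trans:
  assumes "x \<in> carrier_mat N N" "y \<in> orb x" "z \<in> orb y" shows "z \<in> orb x"
proof -
  obtain g h where g: "g \<in> GR R" "y = g * x * ct g" and h: "h \<in> GR R" "z = h * y * ct h"
    using assms unfolding herm_orbit_def by auto
  note c = GR_carrier[OF g(1)] GR_carrier[OF h(1)] assms(1)
  have "z = (h * g) * x * ct (h * g)"
    unfolding g(2) h(2) ct_mult[OF c(2,1)] using c by (simp add: mat_assoc)
  then show ?thesis unfolding herm_orbit_def using GR_mult[OF h(1) g(1)] by auto
qed

lemma orb_sym: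
  assumes "x \<in> carrier_mat N N" "y \<in> orb x" shows "x \<in> orb y"
proof -
  obtain g where g: "g \<in> GR R" "y = g * x * ct g"
    using assms unfolding herm_orbit_def by auto
  obtain h where h: "h \<in> GR R" "g * h = 1\<^sub>m N" "h * g = 1\<^sub>m N" using GR_inverse[OF g(1)] .
  note c = GR_carrier[OF g(1)] GR_carrier[OF h(1)] assms(1)
  have "h * y * ct h = (h * g) * x * ct (h * g)"
    unfolding g(2) ct_mult[OF c(2,1)] using c by (simp add: mat_assoc)
  also have "\<dots> = x" using c h by simp
  finally show ?thesis unfolding herm_orbit_def using h(1) by force
qed

lemma orb_carrier: "x \<in> carrier_mat N N \<Longrightarrow> y \<in> orb x \<Longrightarrow> y \<in> carrier_mat N N"
  unfolding herm_orbit_def using GR_carrier by fastforce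

lemma orb_eq: "x \<in> carrier_mat N N \<Longrightarrow> y \<in> orb x \<Longrightarrow> orb y = orb x"
  using orb_trans orb_sym orb_carrier by blast

lemma isX_orb:
  assumes "isX x" "y \<in> orb x" shows "isX y"
proof -
  have x: "x \<in> carrier_mat N N" "ct x = x" "x * J * x = J" using assms by (auto simp: isX_def)
  obtain g where g: "g \<in> GR R" "y = g * x * ct g"
    using assms unfolding herm_orbit_def by auto
  note gc = GR_carrier[OF g(1)]
  have gJ: "ct g * J * g = J" using g by (simp add: GR_def)
  have "ct y = g * x * ct g" unfolding g(2) using gc x
    by (subst ct_mult[of _ N N _ N], simp, simp, subst ct_mult[of _ N N _ N])
       (simp_all add: mat_assoc)
  then have "ct y = y" unfolding g(2) .
  moreover have "y * J * y = g * (x * (ct g * J * g) * x) * ct g"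
    unfolding g(2) using gc x(1) by (simp add: mat_assoc)
  then have "y * J * y = J" unfolding gJ x(3) GR_J[OF g(1)] .
  moreover have "y \<in> carrier_mat N N" using x(1) assms(2) by (rule orb_carrier)
  ultimately show ?thesis by (simp add: isX_def)
qed

text \<open>Since \<open>ct g * J\<close> is \<open>J\<close> times the inverse of \<open>g\<close>,
  the matrix \<open>y * J\<close> is the conjugate of \<open>x * J\<close> by
  \<open>g\<close>.\<close>

lemma char_poly_orb:
  assumes "x \<in> carrier_mat N N" "y \<in> orb x" shows "char_poly (y * J) = char_poly (x * J)"
proof -
  obtain g where g: "g \<in> GR R" "y = g * x * ct g"
    using assms unfolding herm_orbit_def by auto
  obtain h where h: "h \<in> GR R" "g * h = 1\<^sub>m N" "h * g = 1\<^sub>m N" using GR_inverse[OF g(1)] .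
  note c = GR_carrier[OF g(1)] GR_carrier[OF h(1)] assms(1)
  have "ct g * J = ct g * J * (g * h)" using h c by simp
  also have "\<dots> = (ct g * J * g) * h" using c by (simp add: mat_assoc)
  finally have gJ: "ct g * J = J * h" using g(1) by (simp add: GR_def)
  have "y * J = g * x * (ct g * J)" unfolding g(2) using c by (simp add: mat_assoc)
  also have "\<dots> = g * (x * J) * h" unfolding gJ using c by (simp add: mat_assoc)
  finally have "similar_mat_wit (y * J) (x * J) g h"
    using similar_mat_witI[OF h(2,3), of "y * J" "x * J"] c orb_carrier[OF assms] by simp
  then show ?thesis by (intro char_poly_similar) (auto simp: similar_mat_def)
qed

end

section \<open>Valuation rings and their maximal ideals\<close>

locale conj_valuation_ring = conj_subring k v w p s n R
  for k :: "'a::field_char_0 set" and v w :: "'a \<Rightarrow> int" and p s :: 'a and n and R :: "'a set" +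
  assumes R_valuation: "x \<in> R \<or> inverse x \<in> R"
    and R_half: "inverse 2 \<in> R" and R_s: "s \<in> R" "inverse s \<in> R"
begin

text \<open>The maximal ideal of \<open>R\<close>. It is zero when \<open>R\<close> is the whole
  field, where congruences therefore become equalities.\<close>

definition maxi :: "'a set" where "maxi = {x \<in> R. x = 0 \<or> inverse x \<notin> R}"

lemma maxi_R: "x \<in> maxi \<Longrightarrow> x \<in> R"
  and maxi_0 [simp]: "0 \<in> maxi" and not_maxi_1 [simp]: "1 \<notin> maxi"
  by (auto simp: maxi_def)

lemma not_maxi: "x \<in> R \<Longrightarrow> x \<notin> maxi \<Longrightarrow> x \<noteq> 0 \<and> inverse x \<in> R"
  by (auto simp: maxi_def)

lemma maxi_mult: assumes "x \<in> maxi" "y \<in> R" shows "x * y \<in> maxi" "y * x \<in> maxi"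
proof -
  show "x * y \<in> maxi"
  proof (rule ccontr)
    assume "x * y \<notin> maxi"
    then have 1: "x * y \<noteq> 0" "inverse (x * y) \<in> R" using assms R_mult maxi_R not_maxi by blast+
    then have "y * inverse (x * y) \<in> R" using assms R_mult by blast
    then have "inverse x \<in> R" using 1 by (simp add: field_simps)
    then show False using assms 1 by (auto simp: maxi_def)
  qed
  then show "y * x \<in> maxi" by (simp add: mult.commute)
qed

lemma maxi_add: assumes "x \<in> maxi" "y \<in> maxi" shows "x + y \<in> maxi"
proof -
  have *: "x + y \<in> maxi" if "x \<in> maxi" "y \<in> maxi" "x \<noteq> 0" "y \<noteq> 0" "x * inverse y \<in> R" for x y
  proof -
    have "y * (x * inverse y + 1) \<in> maxi" using that by (intro maxi_mult R_add) auto
    then show ?thesis using that by (simp add: algebra_simps)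
  qed
  show ?thesis
  proof (cases "x = 0 \<or> y = 0")
    case False
    have "x * inverse y \<in> R \<or> y * inverse x \<in> R"
      using R_valuation[of "x * inverse y"] False by (simp add: mult.commute)
    then show ?thesis using *[of x y] *[of y x] False assms by (auto simp: add.commute)
  qed (use assms in auto)
qed

lemma maxi_minus: "x \<in> maxi \<Longrightarrow> - x \<in> maxi"
  using maxi_mult(2)[of x "- 1"] R_minus by simp

lemma maxi_diff: "x \<in> maxi \<Longrightarrow> y \<in> maxi \<Longrightarrow> x - y \<in> maxi"
  using maxi_add[of x "- y"] maxi_minus by simp

lemma maxi_sum: "(\<And>i. i \<in> A \<Longrightarrow> f i \<in> maxi) \<Longrightarrow> sum f A \<in> maxi"
  by (induction A rule: infinite_finite_induct) (auto intro: maxi_add)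

lemma maxi_prime: "x * y \<in> maxi \<Longrightarrow> x \<in> R \<Longrightarrow> y \<in> R \<Longrightarrow> x \<in> maxi \<or> y \<in> maxi"
proof (rule ccontr)
  assume *: "x * y \<in> maxi" "x \<in> R" "y \<in> R" "\<not> (x \<in> maxi \<or> y \<in> maxi)"
  then have "x \<noteq> 0" "y \<noteq> 0" "inverse x * inverse y \<in> R" using not_maxi R_mult by blast+
  then show False using * by (auto simp: maxi_def)
qed

text \<open>Divisibility in a valuation ring is total: by induction, either the dominating element
  of the smaller set divides \<open>z\<close>, or \<open>z\<close> divides it and with it everything
  else.\<close>

lemma dominant_exists:
  assumes "finite S" "z \<in> S" "z \<noteq> 0"
  shows "\<exists>c\<in>S. c \<noteq> 0 \<and> (\<forall>x\<in>S. x / c \<in> R)"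
  using assms
proof (induction "card S" arbitrary: S z rule: less_induct)
  case less
  show ?case
  proof (cases "\<exists>y\<in>S - {z}. y \<noteq> 0")
    case False
    then have "x / z \<in> R" if "x \<in> S" for x
    proof (cases "x = z")
      case ne: False
      then have "x = 0" using False that by blast
      then show ?thesis by simp
    qed (use less.prems in simp)
    then show ?thesis using less.prems by blast
  next
    case True
    then obtain y where y: "y \<in> S - {z}" "y \<noteq> 0" by blast
    have "card (S - {z}) < card S" using less.prems by (intro psubset_card_mono) auto
    then obtain c where c: "c \<in> S - {z}" "c \<noteq> 0" "\<forall>x\<in>S - {z}. x / c \<in> R"
      using less.hyps[OF _ _ y] less.prems by blast
    show ?thesis
    proof (cases "z / c \<in> R")
      case True
      then show ?thesis using c by (intro bexI[of _ c]) auto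
    next
      case False
      then have cz: "c / z \<in> R" using R_valuation[of "z / c"] by simp
      have "x / z \<in> R" if "x \<in> S" for x
      proof (cases "x = z")
        case False
        then have "(x / c) * (c / z) \<in> R" using c cz that by (intro R_mult) auto
        then show ?thesis using c by simp
      qed (use less.prems in simp)
      then show ?thesis using less.prems by blast
    qed
  qed
qed

section \<open>Isotropic vectors whose value divides all entries\<close>

definition inI :: "nat \<Rightarrow> nat \<Rightarrow> bool" where "inI r i \<longleftrightarrow> r \<le> i \<and> i < N - r"

lemma inI_lt: "inI r i \<Longrightarrow> i < N" and inI_opp: "inI r i \<Longrightarrow> inI r (opp i)"
  by (auto simp: inI_def)

lemma inI_opp_iff: "i < N \<Longrightarrow> inI r (opp i) \<longleftrightarrow> inI r i"
  using inI_opp[of r i] inI_opp[of r "opp i"] by auto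

lemma dominant_index:
  assumes "inI r i" "inI r j" "f i j \<noteq> 0"
  shows "\<exists>a b. inI r a \<and> inI r b \<and> f a b \<noteq> 0 \<and> (\<forall>i j. inI r i \<longrightarrow> inI r j \<longrightarrow> f i j / f a b \<in> R)"
proof -
  define S where "S = {f i j |i j. inI r i \<and> inI r j}"
  have "S = (\<lambda>(i, j). f i j) ` ({i. inI r i} \<times> {j. inI r j})" by (auto simp: S_def)
  moreover have "finite {i. inI r i}" by (rule finite_subset[of _ "{..<N}"]) (auto simp: inI_def)
  ultimately have "finite S" by simp
  moreover have "f i j \<in> S" using assms by (auto simp: S_def)
  ultimately obtain c where c: "c \<in> S" "c \<noteq> 0" "\<forall>x\<in>S. x / c \<in> R"
    using dominant_exists assms(3) by blast
  then obtain a b where ab: "c = f a b" "inI r a" "inI r b" by (auto simp: S_def)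
  moreover have "f i j / c \<in> R" if "inI r i" "inI r j" for i j
    using c(3) that unfolding S_def by blast
  ultimately show ?thesis using c(2) by blast
qed

text \<open>After \<open>r\<close> steps of the reduction the first and the last \<open>r\<close>
  indices have been treated; \<open>inI r\<close> marks the block between them, the only part that
  may still be far from diagonal.\<close>

definition outer_diag :: "nat \<Rightarrow> 'a mat \<Rightarrow> bool" where
  "outer_diag r A \<longleftrightarrow> (\<forall>i<N. \<forall>j<N. i \<noteq> j \<longrightarrow> \<not> (inI r i \<and> inI r j) \<longrightarrow> A $$ (i, j) = 0)"

definition admissible :: "nat \<Rightarrow> (nat \<Rightarrow> 'a) \<Rightarrow> bool" where
  "admissible r x \<longleftrightarrow> (\<forall>i. x i \<in> R) \<and> (\<forall>i. \<not> inI r i \<longrightarrow> x i = 0)"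

lemma Suc_double_neq [simp]: "Suc (i + i) \<noteq> N"
  by presburger

lemma admissible_single: "inI r j \<Longrightarrow> t \<in> R \<Longrightarrow> admissible r (single j t)"
  and admissible_axpy: "admissible r x \<Longrightarrow> t \<in> R \<Longrightarrow> admissible r y \<Longrightarrow> admissible r (axpy x t y)"
  by (auto simp: admissible_def single_def axpy_def intro!: R_add R_mult)

lemma isX_sym: "isX A \<Longrightarrow> i < N \<Longrightarrow> j < N \<Longrightarrow> cj (A $$ (i, j)) = A $$ (j, i)"
  using ct_index[of j A i] by (auto simp: isX_def)

lemma isX_prod:
  assumes "isX A" "i < N" "j < N"
  shows "(\<Sum>l = 0..<N. A $$ (i, l) * A $$ (opp l, j)) = (if i + j + 1 = N then 1 else 0)"
proof -
  have A: "A \<in> carrier_mat N N" "A * J * A = J" using assms by (auto simp: isX_def)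
  have "(\<Sum>l = 0..<N. A $$ (i, l) * A $$ (opp l, j)) = (A * (J * A)) $$ (i, j)"
    using A(1) assms mult_J_left[OF A(1)]
    by (auto simp: scalar_prod_def simp del: index_mult_mat(1) simp add: index_mult_mat(1)[of i A j "J * A"] intro!: sum.cong)
  also have "A * (J * A) = J" using A by (simp add: mat_assoc)
  finally show ?thesis using assms by simp
qed

lemma J_opp_left:
  assumes "l < N" "j < N" shows "J $$ (opp l, j) = (if l = j then 1 else 0)"
proof (cases "l = j")
  case True
  have "J $$ (opp l, l) = 1" using assms by (intro J_eq_1) simp_all
  then show ?thesis using True by (simp only: if_True refl)
next
  case False
  have "J $$ (opp l, j) = 0" using assms False by (intro J_eq_0) simp_all
  then show ?thesis using False by (simp only: if_False)
qed

text \<open>The vector couples two hyperbolic pairs. For h = 1/2 and opposite indices i, i' and j,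
  j' the contributions of the two pairs to \<open>H u u\<close> cancel, while the value under
  \<open>A\<close> compares the antidiagonal entries of the two pairs.\<close>

lemma form_four:
  assumes "i < N" "i' < N" "j < N" "j' < N" "cj h = h"
  defines "u \<equiv> axpy (axpy (axpy (single i 1) h (single i' 1)) 1 (single j 1)) (- h) (single j' 1)"
  shows "form A u u = A $$ (i, i) + h * h * A $$ (i', i') + A $$ (j, j) + h * h * A $$ (j', j')
    + (A $$ (i, j) + A $$ (j, i)) + h * (A $$ (i', j) + A $$ (j, i'))
    - h * (A $$ (i, j') + A $$ (j', i)) - h * h * (A $$ (i', j') + A $$ (j', i'))
    + h * (A $$ (i, i') + A $$ (i', i)) - h * (A $$ (j, j') + A $$ (j', j))"
  using assms(1-5) unfolding u_def by (simp add: form_axpy form_single algebra_simps)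

text \<open>Vectors with one, two and four nonzero entries are enough as tests. Should the value at
  each of them be small against a dominating entry \<open>c\<close>, then \<open>A\<close> is
  congruent to \<open>c * J\<close> on the inner block, and \<open>A * J * A = J\<close> forces
  \<open>c\<close> to be congruent to 1 or -1. The assumption \<open>not_bad\<close> excludes the
  equality that results.\<close>

lemma isotropic_dominant:
  assumes A: "isX A" and r: "r < n" and outer: "outer_diag r A"
    and not_bad: "\<And>\<delta>. \<delta> * \<delta> = 1 \<Longrightarrow> \<exists>i j. inI r i \<and> inI r j \<and> A $$ (i, j) \<noteq> \<delta> * J $$ (i, j)"
  shows "\<exists>u. admissible r u \<and> H u u = 0 \<and> form A u u \<noteq> 0
    \<and> (\<forall>i j. inI r i \<longrightarrow> inI r j \<longrightarrow> A $$ (i, j) / form A u u \<in> R)"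
proof (rule ccontr)
  assume contra: "\<not> ?thesis"
  let ?a = "\<lambda>i j. A $$ (i, j)"
  have sym: "cj (?a i j) = ?a j i" if "inI r i" "inI r j" for i j
    using isX_sym[OF A] inI_lt that by blast
  have inI_r: "inI r r" using r by (auto simp: inI_def)
  note lt = inI_lt
  have prodI: "(\<Sum>l\<in>{l. inI r l}. ?a i l * ?a (opp l) j) = (if i + j + 1 = N then 1 else 0)"
    if "inI r i" "inI r j" for i j
  proof -
    have "(\<Sum>l\<in>{l. inI r l}. ?a i l * ?a (opp l) j) = (\<Sum>l = 0..<N. ?a i l * ?a (opp l) j)"
    proof (intro sum.mono_neutral_left ballI)
      fix l assume "l \<in> {0..<N} - {l. inI r l}"
      then show "?a i l * ?a (opp l) j = 0" using outer that(1) lt by (auto simp: outer_diag_def)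
    qed (auto dest: lt)
    then show ?thesis using isX_prod[OF A] lt that by simp
  qed
  have nonzero: "\<exists>i j. inI r i \<and> inI r j \<and> ?a i j \<noteq> 0"
  proof (rule ccontr)
    assume "\<not> ?thesis"
    then have "(\<Sum>l\<in>{l. inI r l}. ?a r l * ?a (opp l) (opp r)) = 0"
      using inI_r by (intro sum.neutral) auto
    then show False using prodI[OF inI_r inI_opp[OF inI_r]] r by simp
  qed
  obtain i0 j0 where ij0: "inI r i0" "inI r j0" and c0: "?a i0 j0 \<noteq> 0"
    and dom0: "\<And>i j. inI r i \<Longrightarrow> inI r j \<Longrightarrow> ?a i j / ?a i0 j0 \<in> R"
    using dominant_index[where f = "?a"] nonzero by blast
  define c where "c = ?a i0 j0"
  have c: "c \<noteq> 0" using c0 by (simp add: c_def)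
  have dom: "?a i j / c \<in> R" if "inI r i" "inI r j" for i j
    using dom0 that by (simp add: c_def)
  \<comment> \<open>Small against \<open>c\<close>. By the assumption to be refuted, this holds for
    the values at all integral isotropic vectors of the inner block.\<close>
  define sm where "sm x \<longleftrightarrow> x / c \<in> maxi" for x
  have c_not: "\<not> sm c" using c by (simp add: sm_def)
  have sm_add: "sm x \<Longrightarrow> sm y \<Longrightarrow> sm (x + y)" for x y
    using maxi_add[of "x / c" "y / c"] by (simp add: sm_def add_divide_distrib)
  have sm_mult: "x \<in> R \<Longrightarrow> sm y \<Longrightarrow> sm (x * y)" for x y
    using maxi_mult(2)[of "y / c" x] by (simp add: sm_def)
  have sm_minus: "sm (- x) \<longleftrightarrow> sm x" for x
    using maxi_minus[of "x / c"] maxi_minus[of "- (x / c)"] by (auto simp: sm_def)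
  have sm_diff: "sm x \<Longrightarrow> sm y \<Longrightarrow> sm (x - y)" for x y
    using sm_add[of x "- y"] sm_minus by simp
  have isotropic: "sm (form A u u)" if u: "admissible r u" "H u u = 0" for u
  proof -
    have "form A u u / c = (\<Sum>i = 0..<N. cj (u i) * (\<Sum>j = 0..<N. (?a i j / c) * u j))"
      by (simp add: form_def sum_divide_distrib[symmetric])
    also have "\<dots> \<in> R"
    proof (intro R_sum)
      fix i assume "i \<in> {0..<N}"
      show "cj (u i) * (\<Sum>j = 0..<N. (?a i j / c) * u j) \<in> R"
      proof (cases "inI r i")
        case True
        have "(?a i j / c) * u j \<in> R" for j
          using u R_mult[OF dom[OF True, of j], of "u j"] by (cases "inI r j") (auto simp: admissible_def)
        then have "(\<Sum>j = 0..<N. (?a i j / c) * u j) \<in> R" by (intro R_sum)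
        moreover have "cj (u i) \<in> R" using u by (simp add: admissible_def R_cj)
        ultimately show ?thesis using R_mult by blast
      qed (use u in \<open>auto simp: admissible_def\<close>)
    qed
    finally have R: "form A u u / c \<in> R" .
    show ?thesis
    proof (rule ccontr)
      assume "\<not> sm (form A u u)"
      then have 1: "form A u u \<noteq> 0" "c / form A u u \<in> R"
        using not_maxi[OF R] by (auto simp: sm_def)
      have "?a i j / form A u u \<in> R" if "inI r i" "inI r j" for i j
        using R_mult[OF dom[OF that] 1(2)] c by simp
      then show False using contra u 1 by blast
    qed
  qed
  have diag: "sm (?a i i)" if i: "inI r i" for i
  proof -
    have "H (single i 1) (single i 1) = 0" using lt[OF i] by (auto simp: form_single)
    then have "sm (form A (single i 1) (single i 1))"
      using i by (intro isotropic admissible_single) auto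
    then show ?thesis using lt[OF i] by (simp add: form_single)
  qed
  \<comment> \<open>A vector with two nonzero entries is isotropic for every \<open>t\<close>,
    unless the two indices are opposite; then \<open>t\<close> must have trace 0.\<close>
  have twist: "sm (t * ?a i j + cj t * ?a j i)"
    if ij: "inI r i" "inI r j" "i \<noteq> j" and t: "t \<in> R" "j = opp i \<Longrightarrow> t + cj t = 0" for i j t
  proof -
    let ?u = "axpy (single i 1) t (single j 1)"
    have ii: "i + i + 1 \<noteq> N" "j + j + 1 \<noteq> N" by presburger+
    have "H ?u ?u = (t + cj t) * J $$ (i, j)"
      using lt[OF ij(1)] lt[OF ij(2)] ij(3) ii by (auto simp: form_axpy form_single)
    also have "\<dots> = 0" using t(2) lt[OF ij(1)] lt[OF ij(2)] by auto
    finally have "sm (form A ?u ?u)"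
      using ij t by (intro isotropic admissible_axpy admissible_single) auto
    moreover have "form A ?u ?u = (t * ?a i j + cj t * ?a j i) + (?a i i + cj t * t * ?a j j)"
      using lt[OF ij(1)] lt[OF ij(2)] by (simp add: form_axpy form_single algebra_simps)
    moreover have "sm (?a i i + cj t * t * ?a j j)"
      using diag ij t by (intro sm_add sm_mult R_mult R_cj) auto
    ultimately show ?thesis using sm_diff by fastforce
  qed
  \<comment> \<open>\<open>s\<close> is a unit of trace 0, so opposite indices are allowed here. The
    choice t = 1, which gives the sum of the two entries, is restricted to the other
    positions.\<close>
  have minus: "sm (?a i j - ?a j i)" if ij: "inI r i" "inI r j" "i \<noteq> j" for i j
  proof -
    have "sm (s * ?a i j + cj s * ?a j i)" using ij R_s by (intro twist) auto
    then have "sm (inverse s * (s * ?a i j + cj s * ?a j i))" using R_s by (intro sm_mult)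
    moreover have "inverse s * (s * ?a i j + cj s * ?a j i) = inverse s * s * (?a i j - ?a j i)"
      by (simp add: field_simps)
    ultimately show ?thesis by simp
  qed
  have off: "sm (?a i j)" if ij: "inI r i" "inI r j" "i \<noteq> j" "j \<noteq> opp i" for i j
  proof -
    have "sm (1 * ?a i j + cj 1 * ?a j i)" using ij by (intro twist) auto
    then have "sm (inverse 2 * ((1 * ?a i j + cj 1 * ?a j i) + (?a i j - ?a j i)))"
      using minus[OF ij(1-3)] by (intro sm_mult[OF R_half sm_add])
    moreover have "inverse 2 * ((1 * ?a i j + cj 1 * ?a j i) + (?a i j - ?a j i)) = ?a i j"
      by (simp add: field_simps)
    ultimately show ?thesis by simp
  qed
  \<comment> \<open>For one hyperbolic pair the sum of the two opposite entries is out of reach; the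
    vector of \<open>form_four\<close> compares it with the sum for another pair.\<close>
  have anti: "sm (?a i (opp i) - ?a j (opp j))" if ij: "inI r i" "inI r j" for i j
  proof -
    have N: "i < N" "j < N" "opp i < N" "opp j < N" using ij lt by auto
    consider "j = i" | "j = opp i" | "j \<noteq> i" "j \<noteq> opp i" by blast
    then show ?thesis
    proof cases
      case 1
      then show ?thesis by (simp add: sm_def)
    next
      case 2
      then show ?thesis using minus[OF ij(1) inI_opp[OF ij(1)]] N by simp
    next
      case 3
      define i' j' where "i' = opp i" and "j' = opp j"
      let ?h = "inverse 2 :: 'a"
      let ?u = "axpy (axpy (axpy (single i 1) ?h (single i' 1)) 1 (single j 1)) (- ?h) (single j' 1)"
      have ne: "i \<noteq> j" "j \<noteq> i" "i' \<noteq> j" "j \<noteq> i'" "i \<noteq> j'" "j' \<noteq> i" "i' \<noteq> j'" "j' \<noteq> i'"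
        "j \<noteq> opp i" "i \<noteq> opp j" "j \<noteq> opp i'" "i' \<noteq> opp j" "j' \<noteq> opp i" "i \<noteq> opp j'"
        "j' \<noteq> opp i'" "i' \<noteq> opp j'"
        unfolding i'_def j'_def using 3 N by presburger+
      have I: "inI r i'" "inI r j'" "i' < N" "j' < N"
        unfolding i'_def j'_def using ij N inI_opp by blast+
      have dn: "i \<noteq> opp i" "j \<noteq> opp j" "i' \<noteq> opp i'" "j' \<noteq> opp j'"
        using N I by simp_all
      have J0: "J $$ (i, i) = 0" "J $$ (j, j) = 0" "J $$ (i', i') = 0" "J $$ (j', j') = 0"
        "J $$ (i, j) = 0" "J $$ (j, i) = 0" "J $$ (i', j) = 0" "J $$ (j, i') = 0"
        "J $$ (i, j') = 0" "J $$ (j', i) = 0" "J $$ (i', j') = 0" "J $$ (j', i') = 0"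
        by (rule J_eq_0; fact)+
      have J1: "J $$ (i, i') = 1" "J $$ (i', i) = 1" "J $$ (j, j') = 1" "J $$ (j', j) = 1"
        unfolding i'_def j'_def using N by (intro J_eq_1; simp)+
      have h: "cj ?h = ?h" "?h \<in> R" "- ?h \<in> R" using R_half R_minus by auto
      define rest where "rest = (?a i i + ?h * ?h * ?a i' i' + ?a j j + ?h * ?h * ?a j' j')
        + ((?a i j + ?a j i) + ?h * (?a i' j + ?a j i') + (- ?h) * (?a i j' + ?a j' i)
          + (- (?h * ?h)) * (?a i' j' + ?a j' i'))"
      have "H ?u ?u = 0"
        unfolding form_four[OF N(1) I(3) N(2) I(4) h(1)] J0 J1 by simp
      then have 4: "sm (form A ?u ?u)"
        using ij I h by (intro isotropic admissible_axpy admissible_single) auto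
      have hh: "?h * ?h \<in> R" "- (?h * ?h) \<in> R" using h R_mult R_minus by blast+
      have "sm (?a i i)" "sm (?a j j)" "sm (?h * ?h * ?a i' i')" "sm (?h * ?h * ?a j' j')"
        using diag ij I sm_mult[OF hh(1)] by blast+
      moreover have "sm (?a i j)" "sm (?a j i)" "sm (?a i' j)" "sm (?a j i')"
        "sm (?a i j')" "sm (?a j' i)" "sm (?a i' j')" "sm (?a j' i')"
        by (rule off; fact)+
      ultimately have rest: "sm rest"
        unfolding rest_def using h hh by (intro sm_add sm_mult[of "?h"] sm_mult[of "- ?h"] sm_mult[of "- (?h * ?h)"])
      have "form A ?u ?u = rest + (?h * (?a i i' + ?a i' i) - ?h * (?a j j' + ?a j' j))"
        unfolding form_four[OF N(1) I(3) N(2) I(4) h(1)] rest_def by (simp add: algebra_simps)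
      then have "sm (?h * (?a i i' + ?a i' i) - ?h * (?a j j' + ?a j' j))"
        using sm_diff[OF 4 rest] by simp
      moreover have "sm (?h * (?a i i' - ?a i' i))" "sm (?h * (?a j j' - ?a j' j))"
        using sm_mult[OF h(2) minus[OF ij(1) I(1)]] sm_mult[OF h(2) minus[OF ij(2) I(2)]]
          dn(1,2) unfolding i'_def j'_def by blast+
      ultimately have "sm ((?h * (?a i i' + ?a i' i) - ?h * (?a j j' + ?a j' j))
          + ?h * (?a i i' - ?a i' i) - ?h * (?a j j' - ?a j' j))"
        by (intro sm_diff[OF sm_add])
      moreover have "(?h * (?a i i' + ?a i' i) - ?h * (?a j j' + ?a j' j))
          + ?h * (?a i i' - ?a i' i) - ?h * (?a j j' - ?a j' j)
        = ?a i i' - ?a j j'"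
        by (simp add: field_simps)
      ultimately show ?thesis by (simp add: i'_def j'_def)
    qed
  qed
  \<comment> \<open>All entries off the antidiagonal are small, and \<open>c\<close> itself is
    not.\<close>
  have j0: "j0 = opp i0"
    using diag[OF ij0(1)] off[OF ij0] c_not by (auto simp: c_def)
  have cong: "sm (?a i j - c * J $$ (i, j))" if ij: "inI r i" "inI r j" for i j
  proof (cases "j = opp i")
    case True
    then show ?thesis using anti[OF ij(1) ij0(1)] lt[OF ij(1)] by (simp add: c_def j0)
  next
    case False
    then have "Suc (i + j) \<noteq> N" by auto
    then show ?thesis using False lt ij diag[OF ij(1)] off[OF ij] by (cases "i = j") auto
  qed
  \<comment> \<open>The entry at \<open>i0\<close>, \<open>j0\<close> of
    \<open>A * J * A = J\<close>: the term with l = j0 equals \<open>c * c\<close>, and the others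
    are \<open>c * c\<close> times elements of the maximal ideal.\<close>
  have square: "c * c * (1 + (\<Sum>l\<in>{l. inI r l} - {j0}. (?a i0 l / c) * (?a (opp l) j0 / c))) = 1"
    "(\<Sum>l\<in>{l. inI r l} - {j0}. (?a i0 l / c) * (?a (opp l) j0 / c)) \<in> maxi"
  proof -
    have "finite {l. inI r l}" by (rule finite_subset[of _ "{..<N}"]) (auto simp: inI_def)
    then have "1 = ?a i0 j0 * ?a (opp j0) j0 + (\<Sum>l\<in>{l. inI r l} - {j0}. ?a i0 l * ?a (opp l) j0)"
      using prodI[OF ij0] ij0 lt[OF ij0(1)] j0 by (subst (asm) sum.remove[of _ j0]) auto
    moreover have "opp j0 = i0" using j0 lt[OF ij0(1)] by simp
    ultimately show "c * c * (1 + (\<Sum>l\<in>{l. inI r l} - {j0}. (?a i0 l / c) * (?a (opp l) j0 / c))) = 1"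
      using c by (simp add: c_def algebra_simps sum_distrib_left sum_distrib_right)
    show "(\<Sum>l\<in>{l. inI r l} - {j0}. (?a i0 l / c) * (?a (opp l) j0 / c)) \<in> maxi"
    proof (intro maxi_sum maxi_mult(1))
      fix l assume l: "l \<in> {l. inI r l} - {j0}"
      have "sm (?a i0 l - c * J $$ (i0, l))" using l ij0 by (intro cong) auto
      moreover have "J $$ (i0, l) = 0" using l ij0 lt j0 by auto
      ultimately show "?a i0 l / c \<in> maxi" by (simp add: sm_def)
      show "?a (opp l) j0 / c \<in> R" using l ij0 inI_opp by (intro dom) auto
    qed
  qed
  define e where "e = (\<Sum>l\<in>{l. inI r l} - {j0}. (?a i0 l / c) * (?a (opp l) j0 / c))"
  have e: "e \<in> maxi" "c * c * (1 + e) = 1" using square by (auto simp: e_def)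
  have e1: "1 + e \<in> R" "1 + e \<notin> maxi"
  proof -
    show "1 + e \<in> R" using e maxi_R R_add by auto
    show "1 + e \<notin> maxi"
    proof
      assume "1 + e \<in> maxi"
      from maxi_diff[OF this e(1)] show False by simp
    qed
  qed
  have cc: "c * c \<in> R" using e(2) not_maxi[OF e1] by (metis inverse_unique mult.commute)
  have cR: "c \<in> R"
  proof (rule ccontr)
    assume "c \<notin> R"
    then have "inverse c \<in> R" using R_valuation by blast
    then have "(c * c) * inverse c \<in> R" using cc R_mult by blast
    moreover have "(c * c) * inverse c = c" using c by (simp add: field_simps)
    ultimately show False using \<open>c \<notin> R\<close> by simp
  qed
  have cu: "inverse c \<in> R"
  proof -
    have "c * (1 + e) \<in> R" using cR e1 R_mult by blast
    moreover have "inverse c = c * (1 + e)" using e(2) by (intro inverse_unique) (simp add: mult.assoc)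
    ultimately show ?thesis by simp
  qed
  have sm_maxi: "x \<in> maxi" if "sm x" for x
    using maxi_mult(1)[OF that[unfolded sm_def] cR] c by simp
  have "(c - 1) * (c + 1) \<in> maxi"
  proof -
    have "(c - 1) * (c + 1) = - (c * c * e)" using e(2) by (simp add: algebra_simps)
    then show ?thesis using maxi_minus maxi_mult(2)[OF e(1) cc] by simp
  qed
  then have "c - 1 \<in> maxi \<or> c + 1 \<in> maxi"
    by (rule maxi_prime[OF _ R_diff[OF cR R_1] R_add[OF cR R_1]])
  then have "\<exists>\<delta>. \<delta> * \<delta> = 1 \<and> c - \<delta> \<in> maxi \<and> \<delta> \<in> R"
  proof
    assume "c - 1 \<in> maxi"
    then show ?thesis by (intro exI[of _ 1]) simp
  next
    assume "c + 1 \<in> maxi"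
    then show ?thesis using R_minus[OF R_1] by (intro exI[of _ "- 1"]) simp
  qed
  then obtain \<delta> where \<delta>: "\<delta> * \<delta> = 1" "c - \<delta> \<in> maxi" "\<delta> \<in> R" by blast
  \<comment> \<open>Substituting A = z + \<delta> J into \<open>A * J * A = J\<close> gives z J z =
    -2 \<delta> z, with 2 \<delta> a unit. As the entries of \<open>z\<close> lie in the maximal
    ideal, a dominating nonzero entry of \<open>z\<close> would be a multiple of itself by an
    element of that ideal, as in Nakayama's lemma.\<close>
  define z where "z i j = ?a i j - \<delta> * J $$ (i, j)" for i j
  have z_maxi: "z i j \<in> maxi" if "inI r i" "inI r j" for i j
  proof -
    have "(?a i j - c * J $$ (i, j)) + (c - \<delta>) * J $$ (i, j) \<in> maxi"
      using sm_maxi[OF cong[OF that]] \<delta> lt that by (intro maxi_add maxi_mult(1)) auto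
    then show ?thesis by (simp add: z_def algebra_simps)
  qed
  have z_square: "z i j = - (\<delta> * inverse 2) * (\<Sum>l\<in>{l. inI r l}. z i l * z (opp l) j)"
    if ij: "inI r i" "inI r j" for i j
  proof -
    have N: "i < N" "j < N" using ij lt by auto
    have fin: "finite {l. inI r l}" by (rule finite_subset[of _ "{..<N}"]) (auto simp: inI_def)
    have J1: "(\<Sum>l\<in>{l. inI r l}. J $$ (i, l) * f l) = f (opp i)" for f
    proof -
      have "(\<Sum>l\<in>{l. inI r l}. J $$ (i, l) * f l) = (\<Sum>l\<in>{l. inI r l}. if l = opp i then f l else 0)"
        using N lt by (intro sum.cong) auto
      then show ?thesis using fin inI_opp[OF ij(1)] by simp
    qed
    have J2: "(\<Sum>l\<in>{l. inI r l}. f l * J $$ (opp l, j)) = f j" for f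
    proof -
      have "J $$ (opp l, j) = (if l = j then 1 else 0)" if "inI r l" for l
        using J_opp_left lt[OF that] N by blast
      then have "(\<Sum>l\<in>{l. inI r l}. f l * J $$ (opp l, j)) = (\<Sum>l\<in>{l. inI r l}. if l = j then f l else 0)"
        by (intro sum.cong) auto
      then show ?thesis using fin ij by simp
    qed
    have "(\<Sum>l\<in>{l. inI r l}. ?a i l * ?a (opp l) j)
        = (\<Sum>l\<in>{l. inI r l}. (z i l + \<delta> * J $$ (i, l)) * (z (opp l) j + \<delta> * J $$ (opp l, j)))"
      by (simp add: z_def)
    also have "\<dots> = (\<Sum>l\<in>{l. inI r l}. z i l * z (opp l) j) + \<delta> * (\<Sum>l\<in>{l. inI r l}. z i l * J $$ (opp l, j))
        + \<delta> * (\<Sum>l\<in>{l. inI r l}. J $$ (i, l) * z (opp l) j)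
        + \<delta> * \<delta> * (\<Sum>l\<in>{l. inI r l}. J $$ (i, l) * J $$ (opp l, j))"
      by (simp add: algebra_simps sum.distrib sum_distrib_left)
    also have "\<dots> = (\<Sum>l\<in>{l. inI r l}. z i l * z (opp l) j) + 2 * \<delta> * z i j + J $$ (i, j)"
      unfolding J1 J2 using N \<delta>(1) by simp
    finally have "(\<Sum>l\<in>{l. inI r l}. z i l * z (opp l) j) = - (2 * \<delta> * z i j)"
      using prodI[OF ij] N by (simp add: eq_neg_iff_add_eq_0)
    moreover have "- (\<delta> * inverse 2) * (- (2 * \<delta> * z i j)) = (\<delta> * \<delta>) * z i j"
      by (simp add: field_simps)
    ultimately show ?thesis using \<delta>(1) by simp
  qed
  obtain i1 j1 where ij1: "inI r i1" "inI r j1" "z i1 j1 \<noteq> 0"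
    using not_bad[OF \<delta>(1)] by (auto simp: z_def)
  then obtain i2 j2 where ij2: "inI r i2" "inI r j2" and z2: "z i2 j2 \<noteq> 0"
    and zdom: "\<And>i j. inI r i \<Longrightarrow> inI r j \<Longrightarrow> z i j / z i2 j2 \<in> R"
    using dominant_index[where f = z] by blast
  have "z i2 j2 / z i2 j2 = - (\<delta> * inverse 2) * (\<Sum>l\<in>{l. inI r l}. z i2 l * z (opp l) j2) / z i2 j2"
    using z_square[OF ij2] by simp
  also have "\<dots> = - (\<delta> * inverse 2) * (\<Sum>l\<in>{l. inI r l}. (z i2 l / z i2 j2) * z (opp l) j2)"
    by (simp add: sum_divide_distrib[symmetric])
  also have "\<dots> \<in> maxi"
    using ij2 zdom \<delta> R_half inI_opp
    by (intro maxi_mult(2) maxi_sum z_maxi R_minus R_mult) auto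
  finally show False using z2 by simp
qed


section \<open>Characteristic polynomials of involutions that are monomial outside the inner
  block\<close>

lemma prod_outer_inner:
  assumes "r \<le> n"
  shows "(\<Prod>i = 0..<N. if inI r i then a else b) = (a :: 'b :: comm_monoid_mult) ^ (N - 2 * r) * b ^ (2 * r)"
proof -
  have 1: "{0..<N} \<inter> {i. inI r i} = {r..<N - r}" "{0..<N} \<inter> - {i. inI r i} = {0..<r} \<union> {N - r..<N}"
    using assms by (auto simp: inI_def)
  have "card ({0..<r} \<union> {N - r..<N}) = r + r"
    using assms by (subst card_Un_disjoint) auto
  then show ?thesis
    unfolding prod.If_cases[OF finite_atLeastLessThan] 1 using assms
    by (simp add: mult_2)
qed

text \<open>The shape of \<open>A * J\<close> when \<open>A\<close> is diagonal outside the inner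
  block and equal to \<delta> J inside it; see \<open>outer_mult_J\<close>.\<close>

definition pmat :: "nat \<Rightarrow> (nat \<Rightarrow> 'a) \<Rightarrow> 'a \<Rightarrow> 'a mat" where
  "pmat r d \<delta> = mat N N (\<lambda>(i, j). if inI r i then (if j = i then \<delta> else 0) else (if j = opp i then d i else 0))"

text \<open>Conjugation by the diagonal matrix with entries 1 in the first half and -1 in the second
  replaces \<open>d\<close> by \<open>- d\<close>, and the product of the two characteristic matrices is diagonal.\<close>

lemma char_poly_square:
  assumes r: "r \<le> n" and d: "\<And>i. i < N \<Longrightarrow> \<not> inI r i \<Longrightarrow> d i * d (opp i) = 1"
  shows "char_poly (pmat r d \<delta>) * char_poly (pmat r d \<delta>)
    = ([:- \<delta>, 1:]\<^sup>2) ^ (N - 2 * r) * ([:0, 1:]\<^sup>2 - 1) ^ (2 * r)"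
proof -
  let ?y = "pmat r d \<delta>" and ?z = "pmat r (\<lambda>i. - d i) \<delta>"
  define D :: "'a mat" where "D = mat_diag N (\<lambda>i. if i < n then 1 else - 1)"
  have y: "?y \<in> carrier_mat N N" "?z \<in> carrier_mat N N" by (auto simp: pmat_def)
  have DD: "D * D = 1\<^sub>m N"
  proof -
    have "D * D = mat_diag N (\<lambda>i. 1)" unfolding D_def mat_diag_diag by (auto simp: mat_diag_def)
    then show ?thesis by simp
  qed
  have "?z = D * ?y * D"
  proof (rule eq_matI)
    fix i j assume "i < dim_row (D * ?y * D)" "j < dim_col (D * ?y * D)"
    then have ij: "i < N" "j < N" by (auto simp: D_def mat_diag_def)
    have "j = opp i \<Longrightarrow> i < n \<longleftrightarrow> \<not> j < n" using ij by presburger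
    then show "?z $$ (i, j) = (D * ?y * D) $$ (i, j)"
      using ij unfolding D_def mat_diag_mult_left[OF y(1)]
      by (subst mat_diag_mult_right[of _ N N]) (auto simp: pmat_def)
  qed (auto simp: D_def pmat_def mat_diag_def)
  then have "similar_mat_wit ?z ?y D D"
    using y DD by (intro similar_mat_witI[of _ _ N]) (auto simp: D_def)
  then have zy: "char_poly ?z = char_poly ?y"
    by (intro char_poly_similar) (auto simp: similar_mat_def)
  define P where "P = char_poly_matrix ?y"
  define Q where "Q = char_poly_matrix ?z"
  have PQ: "P \<in> carrier_mat N N" "Q \<in> carrier_mat N N" using y by (auto simp: P_def Q_def)
  have P: "P $$ (i, j) = (if inI r i then (if j = i then [:- \<delta>, 1:] else 0)
      else (if j = i then [:0, 1:] else 0) + (if j = opp i then [:- d i:] else 0))"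
    "Q $$ (i, j) = (if inI r i then (if j = i then [:- \<delta>, 1:] else 0)
      else (if j = i then [:0, 1:] else 0) + (if j = opp i then [:d i:] else 0))"
    if "i < N" "j < N" for i j
    using that y unfolding P_def Q_def char_poly_matrix_def by (auto simp: pmat_def)
  let ?f = "\<lambda>i. if inI r i then [:- \<delta>, 1:]\<^sup>2 else [:0, 1:]\<^sup>2 - 1"
  have "P * Q = mat_diag N ?f"
  proof (rule eq_matI)
    fix i j assume "i < dim_row (mat_diag N ?f)" "j < dim_col (mat_diag N ?f)"
    then have ij: "i < N" "j < N" by (auto simp: mat_diag_def)
    have oi: "opp i < N" "opp i \<noteq> i" "opp (opp i) = i" using ij by auto
    have "(P * Q) $$ (i, j) = (\<Sum>l = 0..<N. P $$ (i, l) * Q $$ (l, j))"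
      using PQ ij by (auto simp: scalar_prod_def)
    also have "\<dots> = mat_diag N ?f $$ (i, j)"
    proof (cases "inI r i")
      case True
      have "(\<Sum>l = 0..<N. P $$ (i, l) * Q $$ (l, j)) = (\<Sum>l = 0..<N. if l = i then [:- \<delta>, 1:] * Q $$ (i, j) else 0)"
        using ij True by (intro sum.cong) (auto simp: P)
      also have "\<dots> = [:- \<delta>, 1:] * Q $$ (i, j)" using ij by simp
      finally show ?thesis using ij True by (auto simp: P mat_diag_def power2_eq_square)
    next
      case False
      have "(\<Sum>l = 0..<N. P $$ (i, l) * Q $$ (l, j)) = (\<Sum>l = 0..<N. (if l = i then [:0, 1:] * Q $$ (i, j) else 0)
          + (if l = opp i then [:- d i:] * Q $$ (opp i, j) else 0))"
        using ij oi False by (intro sum.cong) (auto simp: P(1))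
      also have "\<dots> = [:0, 1:] * Q $$ (i, j) + [:- d i:] * Q $$ (opp i, j)"
        using ij oi by (simp add: sum.distrib)
      finally have eq: "(\<Sum>l = 0..<N. P $$ (i, l) * Q $$ (l, j))
        = [:0, 1:] * Q $$ (i, j) + [:- d i:] * Q $$ (opp i, j)" .
      have Fo: "\<not> inI r (opp i)" using False inI_opp_iff[OF ij(1)] by simp
      have Q1: "Q $$ (i, j) = (if j = i then [:0, 1:] else 0) + (if j = opp i then [:d i:] else 0)"
        using P(2)[OF ij] False by simp
      have Q2: "Q $$ (opp i, j) = (if j = opp i then [:0, 1:] else 0) + (if j = i then [:d (opp i):] else 0)"
        unfolding P(2)[OF oi(1) ij(2)] oi(3) using Fo by simp
      have M: "mat_diag N ?f $$ (i, j) = (if i = j then [:0, 1:]\<^sup>2 - 1 else 0)"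
        using ij False by (auto simp: mat_diag_def)
      have dd: "d i * d (opp i) = 1" using d ij False by blast
      consider "j = i" | "j = opp i" | "j \<noteq> i" "j \<noteq> opp i" by blast
      then show ?thesis
      proof cases
        case 1
        show ?thesis unfolding eq Q1 Q2 M using 1 oi dd
          by (simp add: power2_eq_square one_pCons mult.commute)
      next
        case 2
        show ?thesis unfolding eq Q1 Q2 M using 2 oi by simp
      next
        case 3
        then show ?thesis unfolding eq Q1 Q2 M by auto
      qed
    qed
    finally show "(P * Q) $$ (i, j) = mat_diag N ?f $$ (i, j)" .
  qed (use PQ in \<open>auto simp: mat_diag_def\<close>)
  then have "det P * det Q = (\<Prod>i = 0..<N. ?f i)"
    using det_mult[OF PQ] det_mat_diag[of N ?f] by simp
  then show ?thesis
    unfolding prod_outer_inner[OF r] using zy by (simp add: P_def Q_def char_poly_def)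
qed

lemma isX_outer_inverse:
  assumes "isX A" "outer_diag r A" "i < N" "\<not> inI r i"
  shows "A $$ (i, i) * A $$ (opp i, opp i) = 1"
proof -
  have "(\<Sum>l = 0..<N. A $$ (i, l) * A $$ (opp l, opp i)) = (\<Sum>l = 0..<N. if l = i then A $$ (i, i) * A $$ (opp i, opp i) else 0)"
    using assms(2-) by (intro sum.cong) (auto simp: outer_diag_def)
  then show ?thesis using isX_prod[OF assms(1,3), of "opp i"] assms(3) by simp
qed

lemma outer_mult_J:
  assumes A: "isX A" "outer_diag r A"
    and inner: "\<And>i j. inI r i \<Longrightarrow> inI r j \<Longrightarrow> A $$ (i, j) = \<delta> * J $$ (i, j)"
  shows "A * J = pmat r (\<lambda>i. A $$ (i, i)) \<delta>"
proof (rule eq_matI)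
  fix i j assume "i < dim_row (pmat r (\<lambda>i. A $$ (i, i)) \<delta>)" "j < dim_col (pmat r (\<lambda>i. A $$ (i, i)) \<delta>)"
  then have ij: "i < N" "j < N" by (auto simp: pmat_def)
  have A': "A \<in> carrier_mat N N" using A by (simp add: isX_def)
  have 1: "(A * J) $$ (i, j) = A $$ (i, opp j)" using mult_J_right[OF A' ij] .
  show "(A * J) $$ (i, j) = pmat r (\<lambda>i. A $$ (i, i)) \<delta> $$ (i, j)"
  proof (cases "inI r i")
    case True
    show ?thesis
    proof (cases "inI r (opp j)")
      case 2: True
      have "opp j = opp i \<longleftrightarrow> j = i" using ij by auto
      then have "J $$ (i, opp j) = (if j = i then 1 else 0)"
        using ij J_eq_0[of i "opp j"] J_eq_1[of i "opp j"] by (simp del: J_index)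
      then show ?thesis unfolding 1 using inner[OF True 2] True ij by (simp add: pmat_def)
    next
      case 2: False
      then have "j \<noteq> i" "i \<noteq> opp j" using True inI_opp by auto
      then show ?thesis unfolding 1 using A(2) 2 True ij by (simp add: pmat_def outer_diag_def)
    qed
  next
    case False
    have "i = opp j \<longleftrightarrow> j = opp i" using ij by auto
    then show ?thesis unfolding 1 using A(2) False ij by (auto simp: pmat_def outer_diag_def)
  qed
qed (use A in \<open>auto simp: pmat_def isX_def\<close>)

text \<open>Otherwise the eigenvalue \<delta> would have multiplicity 2 n - r instead of n.
  Evaluation at 2 turns this into a comparison of exponents of 3, since t^2 - 1 becomes 3 and t -
  \<delta> becomes 1 or 3; characteristic 0 transfers the equation to natural numbers.\<close>

lemma not_antidiagonal:
  assumes A: "isX A" "char_poly (A * J) = ([:0, 1:]\<^sup>2 - 1) ^ n" and r: "r < n" and outer: "outer_diag r A"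
    and \<delta>: "\<delta> * \<delta> = 1"
  shows "\<exists>i j. inI r i \<and> inI r j \<and> A $$ (i, j) \<noteq> \<delta> * J $$ (i, j)"
proof (rule ccontr)
  assume "\<not> ?thesis"
  then have inner: "A $$ (i, j) = \<delta> * J $$ (i, j)" if "inI r i" "inI r j" for i j
    using that by blast
  have y: "A * J = pmat r (\<lambda>i. A $$ (i, i)) \<delta>"
    by (rule outer_mult_J[OF A(1) outer]) (rule inner)
  have "char_poly (A * J) * char_poly (A * J) = ([:- \<delta>, 1:]\<^sup>2) ^ (N - 2 * r) * ([:0, 1:]\<^sup>2 - 1) ^ (2 * r)"
    unfolding y using r by (intro char_poly_square isX_outer_inverse[OF A(1) outer]) auto
  then have "poly (([:0, 1:]\<^sup>2 - 1) ^ n * ([:0, 1:]\<^sup>2 - 1) ^ n) 2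
    = poly (([:- \<delta>, 1:]\<^sup>2) ^ (N - 2 * r) * ([:0, 1:]\<^sup>2 - 1) ^ (2 * r)) 2"
    using A(2) by simp
  then have eq: "3 ^ n * 3 ^ n = ((2 - \<delta>)\<^sup>2) ^ (N - 2 * r) * (3::'a) ^ (2 * r)"
    by (simp add: power2_eq_square algebra_simps)
  have "(\<delta> - 1) * (\<delta> + 1) = 0" using \<delta> by (simp add: algebra_simps)
  then have "\<delta> = 1 \<or> \<delta> = - 1" by (auto simp: eq_neg_iff_add_eq_0)
  then have "((2 - \<delta>)\<^sup>2) ^ (N - 2 * r) = of_nat (1 ^ (N - 2 * r)) \<or> ((2 - \<delta>)\<^sup>2) ^ (N - 2 * r) = of_nat (9 ^ (N - 2 * r))"
    by (auto simp: power2_eq_square)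
  then obtain c where c: "c = 1 \<or> c = (9::nat)" "((2 - \<delta>)\<^sup>2) ^ (N - 2 * r) = of_nat (c ^ (N - 2 * r))" by blast
  have "(of_nat (3 ^ n * 3 ^ n) :: 'a) = of_nat (c ^ (N - 2 * r) * 3 ^ (2 * r))"
    using eq c(2) by simp
  then have nat_eq: "(3::nat) ^ n * 3 ^ n = c ^ (N - 2 * r) * 3 ^ (2 * r)"
    unfolding of_nat_eq_iff .
  have l: "(3::nat) ^ n * 3 ^ n = 3 ^ (2 * n)" by (simp add: power_add[symmetric])
  from c(1) show False
  proof
    assume "c = 1"
    then have "(3::nat) ^ (2 * n) = 3 ^ (2 * r)" using nat_eq l by simp
    then have "2 * n = 2 * r" by (rule power_inject_exp[THEN iffD1, rotated]) simp
    then show False using r by simp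
  next
    assume "c = 9"
    have "(9::nat) ^ (N - 2 * r) = 3 ^ (2 * (N - 2 * r))" by (simp add: power_mult)
    then have "(3::nat) ^ (2 * n) = 3 ^ (2 * (N - 2 * r) + 2 * r)"
      using nat_eq l \<open>c = 9\<close> by (simp add: power_add)
    then have "2 * n = 2 * (N - 2 * r) + 2 * r" by (rule power_inject_exp[THEN iffD1, rotated]) simp
    then show False using r by linarith
  qed
qed

text \<open>\<open>char_poly_square\<close> gives only the square of the characteristic polynomial;
  that both candidates are monic settles the sign. For r = n the inner block is empty, so the
  eigenvalue 1 passed to \<open>pmat\<close> is an arbitrary choice.\<close>

lemma char_poly_diag:
  assumes A: "isX A" "outer_diag n A"
  shows "char_poly (A * J) = ([:0, 1:]\<^sup>2 - 1) ^ n"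
proof -
  let ?p = "char_poly (A * J)" and ?q = "([:0, 1:]\<^sup>2 - 1) ^ n :: 'a poly"
  have "\<not> inI n i" for i by (auto simp: inI_def)
  then have y: "A * J = pmat n (\<lambda>i. A $$ (i, i)) 1"
    by (intro outer_mult_J[OF A]) auto
  have "?p * ?p = ([:- 1, 1:]\<^sup>2) ^ (N - 2 * n) * ([:0, 1:]\<^sup>2 - 1) ^ (2 * n)"
    unfolding y by (intro char_poly_square isX_outer_inverse[OF A]) auto
  then have "?p * ?p = ?q * ?q" by (simp add: power_add[symmetric] mult_2)
  then have "(?p - ?q) * (?p + ?q) = 0" by (simp add: algebra_simps)
  then have "?p = ?q \<or> ?p = - ?q" by (auto simp: eq_neg_iff_add_eq_0)
  moreover have "lead_coeff ?p = 1"
    using degree_monic_char_poly[of "A * J" N] A by (auto simp: isX_def)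
  moreover have "lead_coeff ?q = 1"
  proof -
    have "[:0, 1:]\<^sup>2 - 1 = ([:- 1, 0, 1:] :: 'a poly)" by (simp add: power2_eq_square one_pCons)
    then show ?thesis by (simp add: lead_coeff_power)
  qed
  ultimately show ?thesis by auto
qed


section \<open>Splitting off hyperbolic planes\<close>

definition inB :: "nat \<Rightarrow> nat \<Rightarrow> bool" where "inB t i \<longleftrightarrow> opp t \<le> i \<and> i \<le> t"

text \<open>The value chosen when \<open>r\<close> planes have been split off goes to position
  \<open>opp r\<close>, near the end, and the box of that position is exactly the inner block at
  that moment. The divisibilities in these nested boxes become the inequalities between the
  exponents.\<close>

definition box_dominant :: "nat \<Rightarrow> 'a mat \<Rightarrow> bool" where
  "box_dominant r A \<longleftrightarrow> (\<forall>t<N. N - r \<le> t \<longrightarrow>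
     A $$ (t, t) \<noteq> 0 \<and> (\<forall>i j. inB t i \<longrightarrow> inB t j \<longrightarrow> A $$ (i, j) / A $$ (t, t) \<in> R))"

lemma form_div_R:
  assumes "\<And>i j. P i \<Longrightarrow> P j \<Longrightarrow> A $$ (i, j) / c \<in> R"
    and "\<And>i. x i \<in> R" "\<And>i. y i \<in> R" "\<And>i. \<not> P i \<Longrightarrow> x i = 0" "\<And>i. \<not> P i \<Longrightarrow> y i = 0"
  shows "form A x y / c \<in> R"
proof -
  have "form A x y / c = (\<Sum>i = 0..<N. cj (x i) * (\<Sum>j = 0..<N. (A $$ (i, j) / c) * y j))"
    by (simp add: form_def sum_divide_distrib[symmetric])
  also have "\<dots> \<in> R"
  proof (intro R_sum)
    fix i assume "i \<in> {0..<N}"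
    show "cj (x i) * (\<Sum>j = 0..<N. (A $$ (i, j) / c) * y j) \<in> R"
    proof (cases "P i")
      case True
      have "(A $$ (i, j) / c) * y j \<in> R" for j
        using R_mult[OF assms(1)[OF True, of j] assms(3), of j] assms(5)[of j] by (cases "P j") auto
      then have "(\<Sum>j = 0..<N. (A $$ (i, j) / c) * y j) \<in> R" by (intro R_sum)
      then show ?thesis by (rule R_mult[OF R_cj[OF assms(2)]])
    qed (simp add: assms(4))
  qed
  finally show ?thesis .
qed

lemma H_admissible_R: "admissible r x \<Longrightarrow> admissible r y \<Longrightarrow> H x y \<in> R"
  unfolding H_alt by (intro R_sum R_mult R_cj) (auto simp: admissible_def)

text \<open>A monomial matrix and two transvections over \<open>R\<close> produce a frame with
  \<open>u\<close> at position \<open>opp r\<close> and \<open>f\<close> at position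
  \<open>r\<close>, leaving the columns outside the inner block alone. Pairing with \<open>u\<close>
  under \<open>A\<close> is pairing with \<open>f\<close> under \<open>H\<close> up to a scalar, and
  conversely; so whatever is \<open>H\<close>-orthogonal to both vectors is also
  \<open>A\<close>-orthogonal to both.\<close>

lemma reduction_step:
  assumes A: "isX A" "char_poly (A * J) = ([:0, 1:]\<^sup>2 - 1) ^ n" and r: "r < n"
    and outer: "outer_diag r A" and box: "box_dominant r A"
  shows "\<exists>h\<in>GR R. outer_diag (Suc r) (ct h * A * h) \<and> box_dominant (Suc r) (ct h * A * h)"
proof -
  have Ac: "A \<in> carrier_mat N N" "ct A = A" using A by (auto simp: isX_def)
  obtain u where u: "admissible r u" "H u u = 0" "form A u u \<noteq> 0"
    and dom: "\<And>i j. inI r i \<Longrightarrow> inI r j \<Longrightarrow> A $$ (i, j) / form A u u \<in> R"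
    using isotropic_dominant[OF A(1) r outer not_antidiagonal[OF A r outer]] by blast
  define a where "a = form A u u"
  have a: "a \<noteq> 0" using u by (simp add: a_def)
  have cja: "cj a = a" unfolding a_def by (rule form_herm[OF Ac])
  define t where "t = opp r"
  have t: "t < N" "opp t = r" "opp r = t" "r < N" "r \<noteq> t" "inI r t" "inI r r"
    using r by (auto simp: t_def inI_def)
  \<comment> \<open>This is J A u / a. On columns it is the involution \<open>J * A\<close> that
    gets conjugated when \<open>A\<close> is replaced by \<open>ct h * A * h\<close>. Division by
    \<open>a\<close> gives \<open>H u f = 1\<close> and keeps \<open>f\<close> integral, as
    \<open>a\<close> divides all entries of the inner block.\<close>
  define f where "f = (\<lambda>i. if i < N then inverse a * (\<Sum>j = 0..<N. A $$ (opp i, j) * u j) else 0)"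
  have form_u: "form A z u = a * H z f" for z
  proof -
    have "H z f = (\<Sum>i = 0..<N. cj (z i) * (inverse a * (\<Sum>j = 0..<N. A $$ (i, j) * u j)))"
      unfolding H_alt by (intro sum.cong refl) (simp add: f_def)
    also have "\<dots> = inverse a * form A z u"
      by (simp add: form_def sum_distrib_left algebra_simps)
    finally show ?thesis using a by simp
  qed
  have Af: "(\<Sum>j = 0..<N. A $$ (i, j) * f j) = inverse a * u (opp i)" if i: "i < N" for i
  proof -
    have "(\<Sum>j = 0..<N. A $$ (i, j) * f j)
        = (\<Sum>j = 0..<N. \<Sum>l = 0..<N. inverse a * (A $$ (i, j) * A $$ (opp j, l) * u l))"
      by (intro sum.cong refl) (simp add: f_def sum_distrib_left algebra_simps)
    also have "\<dots> = (\<Sum>l = 0..<N. inverse a * ((\<Sum>j = 0..<N. A $$ (i, j) * A $$ (opp j, l)) * u l))"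
      by (subst sum.swap) (simp add: sum_distrib_left sum_distrib_right algebra_simps)
    also have "\<dots> = (\<Sum>l = 0..<N. (inverse a * u l) * (if l + i + 1 = N then 1 else 0))"
      using isX_prod[OF A(1) i] by (intro sum.cong refl) (auto simp: add.commute)
    also have "\<dots> = inverse a * u (opp i)" by (rule sum_opp_right[OF i])
    finally show ?thesis .
  qed
  have form_f: "form A z f = inverse a * H z u" for z
  proof -
    have "form A z f = (\<Sum>i = 0..<N. cj (z i) * (inverse a * u (opp i)))"
      unfolding form_def by (intro sum.cong refl) (simp add: Af)
    then show ?thesis unfolding H_alt by (simp add: sum_distrib_left algebra_simps)
  qed
  have uf: "H u f = 1" using form_u[of u] a by (simp add: a_def)
  have fu: "H f u = 1" using H_herm[of u f] uf by simp
  have ff: "H f f = 0"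
  proof -
    have "a * H f f = cj (form A u f)" unfolding form_u[symmetric] by (rule form_herm[OF Ac, symmetric])
    then show ?thesis using form_f[of u] u(2) a by simp
  qed
  have f: "admissible r f"
    unfolding admissible_def
  proof (intro conjI allI impI)
    fix i
    have 1: "f i = (\<Sum>j = 0..<N. (A $$ (opp i, j) / a) * u j)" if "i < N"
      using that by (simp add: f_def sum_distrib_left field_simps)
    show 0: "f i = 0" if "\<not> inI r i"
    proof (cases "i < N")
      case True
      have "A $$ (opp i, j) * u j = 0" if "j < N" for j
      proof (cases "inI r j")
        case 2: True
        have "\<not> inI r (opp i)" using inI_opp_iff[OF True, of r] \<open>\<not> inI r i\<close> by blast
        then have "A $$ (opp i, j) = 0"
          using 2 that True outer unfolding outer_diag_def by (metis opp_lt)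
        then show ?thesis by simp
      qed (use u(1) in \<open>simp add: admissible_def\<close>)
      then have "(\<Sum>j = 0..<N. A $$ (opp i, j) * u j) = 0" by (intro sum.neutral) auto
      then show ?thesis using True by (simp add: f_def)
    qed (simp add: f_def)
    show "f i \<in> R"
    proof (cases "inI r i")
      case True
      have "(A $$ (opp i, j) / a) * u j \<in> R" for j
        using R_mult[OF dom[OF inI_opp[OF True], of j], of "u j"] u(1)
        by (cases "inI r j") (auto simp: admissible_def a_def)
      then show ?thesis unfolding 1[OF inI_lt[OF True]] by (intro R_sum)
    qed (simp add: 0)
  qed
  \<comment> \<open>\<open>H f u = 1\<close> with integral \<open>f\<close> is impossible if all
    coordinates of \<open>u\<close> lie in the maximal ideal.\<close>
  obtain i0 where i0: "inI r i0" "u i0 \<noteq> 0" "inverse (u i0) \<in> R"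
  proof (rule ccontr)
    assume "\<not> thesis"
    then have "u i \<in> maxi" for i
      using that u(1) not_maxi[of "u i"] by (cases "inI r i") (auto simp: admissible_def)
    then have "H f u \<in> maxi"
      unfolding H_alt using f by (intro maxi_sum maxi_mult(2) R_cj) (auto simp: admissible_def)
    then show False using fu by simp
  qed
  define i1 where "i1 = opp i0"
  have i1: "i1 < N" "i0 < N" "opp i1 = i0" "opp i0 = i1" "i0 \<noteq> i1" "inI r i1"
    using inI_lt[OF i0(1)] inI_opp[OF i0(1)] by (auto simp: i1_def)
  have opp_inj: "opp i = opp j \<longleftrightarrow> i = j" if "i < N" "j < N" for i j using that by auto
  \<comment> \<open>\<sigma> brings the unit coordinate of \<open>u\<close> to position
    \<open>t\<close>; the scalars \<gamma> then make \<open>H u (b1 r) = 1\<close>, as the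
    transvection requires.\<close>
  define \<sigma> where "\<sigma> j = (if j = t then i0 else if j = r then i1 else if j = i0 then t
    else if j = i1 then r else j)" for j
  define \<gamma> where "\<gamma> j = (if j = t then u i0 else if j = r then inverse (cj (u i0)) else 1)" for j
  define b1 where "b1 j = single (\<sigma> j) (\<gamma> j)" for j
  have opp_iff: "opp j = r \<longleftrightarrow> j = t" "opp j = t \<longleftrightarrow> j = r" "opp j = i0 \<longleftrightarrow> j = i1" "opp j = i1 \<longleftrightarrow> j = i0"
    if "j < N" for j
    using opp_inj[OF that, of t] opp_inj[OF that, of r] opp_inj[OF that, of i1] opp_inj[OF that, of i0] t i1
    by metis+
  have \<sigma>_lt: "\<sigma> j < N" if "j < N" for j using that t i1 by (simp add: \<sigma>_def)
  have \<sigma>\<sigma>: "\<sigma> (\<sigma> j) = j" for j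
    unfolding \<sigma>_def by (rule pair_swap(1)[of opp t r i0 i1, OF t(2,3) i1(4,3) t(5) i1(5)])
  have \<sigma>_opp: "\<sigma> (opp j) = opp (\<sigma> j)" if "j < N" for j
    unfolding \<sigma>_def
    by (rule pair_swap(2)[of opp t r i0 i1, OF t(2,3) i1(4,3) t(5) i1(5) opp_iff[OF that]])
  have \<sigma>_I: "inI r (\<sigma> j)" if "inI r j" for j using that t i1 i0 by (simp add: \<sigma>_def)
  have b1: "frame b1"
    unfolding b1_def
  proof (rule frame_single)
    show "inj_on \<sigma> {..<N}" by (rule inj_on_inverseI[of _ \<sigma>]) (rule \<sigma>\<sigma>)
    show "cj (\<gamma> j) * \<gamma> (opp j) = 1" if "j < N" for j
      unfolding \<gamma>_def opp_iff[OF that] using t(5) i0(2) by auto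
  qed (use \<sigma>_lt \<sigma>_opp in auto)
  have b1_adm: "admissible r (b1 j)" if "inI r j" for j
    unfolding b1_def
  proof (rule admissible_single[OF \<sigma>_I[OF that]])
    show "\<gamma> j \<in> R" using u(1) R_cj[OF i0(3)] by (auto simp: \<gamma>_def admissible_def)
  qed
  have ub1: "H u (b1 (opp t)) = 1"
  proof -
    have "\<sigma> r = i1" "\<gamma> r = inverse (cj (u i0))" using t(5) by (auto simp: \<sigma>_def \<gamma>_def)
    then show ?thesis unfolding t(2) b1_def using H_single_right[OF i1(1)] i0(2) i1(3) by simp
  qed
  \<comment> \<open>The first transvection puts \<open>u\<close> at position \<open>t\<close> and
    keeps \<open>b1 r\<close>; the second puts \<open>f\<close> at position \<open>r\<close> and
    keeps \<open>u\<close>, its requirement being \<open>H f u = 1\<close>.\<close>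
  define b2 where "b2 j = (if j = t then u else if j = opp t then b1 (opp t)
    else axpy (b1 j) (- H u (b1 j)) (b1 (opp t)))" for j
  have b2: "frame b2"
    unfolding b2_def by (rule frame_transvection[OF b1 t(1) u(2) ub1])
  have b2t: "b2 t = u" by (simp add: b2_def)
  have b2_adm: "admissible r (b2 j)" if "inI r j" for j
    unfolding b2_def t(2) using u(1) b1_adm[OF that] b1_adm[OF t(7)]
    by (auto intro!: admissible_axpy R_minus H_admissible_R)
  have fb2: "H f (b2 (opp r)) = 1" unfolding t(3) b2t by (rule fu)
  define b where "b j = (if j = r then f else if j = opp r then b2 (opp r)
    else axpy (b2 j) (- H f (b2 j)) (b2 (opp r)))" for j
  have b: "frame b"
    unfolding b_def by (rule frame_transvection[OF b2 t(4) ff fb2])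
  have br: "b r = f" and bt: "b t = u" using t by (auto simp: b_def b2t)
  have b_inner: "admissible r (b j)" if "inI r j" for j
    unfolding b_def t(3) b2t using u(1) f b2_adm[OF that]
    by (auto intro!: admissible_axpy R_minus H_admissible_R)
  have b_outer: "b j = single j 1" if j: "j < N" "\<not> inI r j" for j
  proof -
    have ne: "j \<noteq> t" "j \<noteq> r" "j \<noteq> i0" "j \<noteq> i1" using j t i0 i1 by auto
    have oj: "\<not> inI r (opp j)" using inI_opp_iff[OF j(1)] j(2) by blast
    have b1j: "b1 j = single j 1" using ne by (simp add: b1_def \<sigma>_def \<gamma>_def)
    have "H u (b1 j) = 0" "H f (single j 1) = 0"
      unfolding b1j H_single_right[OF j(1)] using u(1) f oj by (auto simp: admissible_def)
    then have "b2 j = single j 1" "H f (single j 1) = 0"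
      unfolding b2_def t(2) using ne b1j by (auto simp: axpy_def)
    then show ?thesis unfolding b_def t(3) using ne by (auto simp: axpy_def)
  qed
  have b_R: "b j i \<in> R" if "j < N" for i j
    using b_inner[of j] b_outer[of j] that by (cases "inI r j") (auto simp: admissible_def single_def)
  define h where "h = gmat b"
  have h: "h \<in> GR R" unfolding h_def using b_R by (intro gmat_GR[OF b])
  define D where "D = ct h * A * h"
  have D: "D $$ (i, j) = form A (b i) (b j)" if "i < N" "j < N" for i j
    unfolding D_def h_def by (rule gmat_gram[OF Ac(1) that])
  have zero: "form A (b i) (b j) = 0" if ij: "i < N" "j < N" "i \<noteq> j" "\<not> inI (Suc r) i" for i j
  proof -
    have "\<not> inI r i \<or> i = t \<or> i = r"
      using ij(4) r unfolding inI_def t_def by arith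
    then consider "\<not> inI r i" | "i = t" | "i = r" by blast
    then show ?thesis
    proof cases
      case 1
      have "b j i = 0"
        using 1 ij(3) b_inner[of j] b_outer[OF ij(2)] by (cases "inI r j") (auto simp: admissible_def single_def)
      moreover have "A $$ (i, l) = 0" if "l < N" "l \<noteq> i" for l
        using outer 1 ij(1) that by (auto simp: outer_diag_def)
      ultimately have "A $$ (i, l) * b j l = 0" if "l < N" for l
        using that by (cases "l = i") auto
      then have "(\<Sum>l = 0..<N. A $$ (i, l) * b j l) = 0" by (intro sum.neutral) auto
      then show ?thesis unfolding b_outer[OF ij(1) 1] form_single_left[OF ij(1)] by simp
    next
      case 2
      have "j + r + 1 \<noteq> N" using ij(3) 2 unfolding t_def by arith
      then have "H (b j) (b r) = 0" using frameD[OF b ij(2) t(4)] by simp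
      then have "form A (b j) (b i) = 0" unfolding 2 bt form_u br by simp
      then show ?thesis using form_herm[OF Ac, of "b j" "b i"] by simp
    next
      case 3
      have "j + t + 1 \<noteq> N" using ij(3) 3 r unfolding t_def by arith
      then have "H (b j) (b t) = 0" using frameD[OF b ij(2) t(1)] by simp
      then have "form A (b j) (b i) = 0" unfolding 3 br form_f bt by simp
      then show ?thesis using form_herm[OF Ac, of "b j" "b i"] by simp
    qed
  qed
  have "outer_diag (Suc r) D"
    unfolding outer_diag_def
  proof (intro allI impI)
    fix i j assume ij: "i < N" "j < N" "i \<noteq> j" "\<not> (inI (Suc r) i \<and> inI (Suc r) j)"
    then have "form A (b i) (b j) = 0 \<or> form A (b j) (b i) = 0" using zero by metis
    then have "form A (b i) (b j) = 0" using form_herm[OF Ac, of "b i" "b j"] form_herm[OF Ac, of "b j" "b i"]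
      by (metis cj_eq_0)
    then show "D $$ (i, j) = 0" using D ij by simp
  qed
  moreover have "box_dominant (Suc r) D"
    unfolding box_dominant_def
  proof (intro allI impI)
    fix q assume q: "q < N" "N - Suc r \<le> q"
    \<comment> \<open>The new vectors with index in a box are supported in that box, so the entries
      of \<open>D\<close> there are combinations over \<open>R\<close> of the entries of
      \<open>A\<close> there. Hence the divisibilities of earlier steps survive.\<close>
    have bsupp: "b i l = 0" if "inB q i" "\<not> inB q l" for i l
    proof (cases "inI r i")
      case True
      have "inI r l \<Longrightarrow> inB q l" using q r unfolding inI_def inB_def by arith
      then show ?thesis using b_inner[OF True] that(2) by (auto simp: admissible_def)
    next
      case False
      have "i < N" using that(1) q by (auto simp: inB_def)
      then show ?thesis using b_outer[OF _ False] that by (auto simp: single_def)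
    qed
    have key: "D $$ (i, j) / c \<in> R"
      if "inB q i" "inB q j" and c: "\<And>i j. inB q i \<Longrightarrow> inB q j \<Longrightarrow> A $$ (i, j) / c \<in> R" for i j c
    proof -
      have ij: "i < N" "j < N" using that q by (auto simp: inB_def)
      have "form A (b i) (b j) / c \<in> R"
        by (rule form_div_R[where P = "inB q"]) (use c b_R ij bsupp that in auto)
      then show ?thesis using D ij by simp
    qed
    show "D $$ (q, q) \<noteq> 0 \<and> (\<forall>i j. inB q i \<longrightarrow> inB q j \<longrightarrow> D $$ (i, j) / D $$ (q, q) \<in> R)"
    proof (cases "q = t")
      case True
      have "inB q i \<Longrightarrow> inI r i" for i unfolding True t_def inB_def inI_def using r by arith
      moreover have "D $$ (q, q) = a" using D[OF q(1) q(1)] by (simp add: True bt a_def)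
      ultimately show ?thesis using key[of _ _ a] dom a by (auto simp: a_def)
    next
      case False
      then have q': "N - r \<le> q" "\<not> inI r q" using q r unfolding t_def inI_def by arith+
      have "D $$ (q, q) = A $$ (q, q)"
        using D[OF q(1) q(1)] b_outer[OF q(1) q'(2)] form_single[OF q(1) q(1)] by simp
      then show ?thesis using box q(1) q'(1) key[of _ _ "A $$ (q, q)"] by (auto simp: box_dominant_def)
    qed
  qed
  ultimately show ?thesis using h unfolding D_def by blast
qed

lemma diagonal_reduction:
  assumes x: "isX x" "char_poly (x * J) = ([:0, 1:]\<^sup>2 - 1) ^ n"
  obtains g where "g \<in> GR R" "outer_diag n (ct g * x * g)" "box_dominant n (ct g * x * g)"
proof -
  have "r \<le> n \<Longrightarrow> \<exists>g\<in>GR R. outer_diag r (ct g * x * g) \<and> box_dominant r (ct g * x * g)" for r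
  proof (induction r)
    case 0
    have "outer_diag 0 y" "box_dominant 0 y" for y
      by (auto simp: outer_diag_def box_dominant_def inI_def)
    then show ?case using GR_one by blast
  next
    case (Suc r)
    then obtain g where g: "g \<in> GR R" "outer_diag r (ct g * x * g)" "box_dominant r (ct g * x * g)"
      by auto
    let ?y = "ct g * x * g"
    have xc: "x \<in> carrier_mat N N" using x by (simp add: isX_def)
    have y: "?y \<in> orb x" unfolding orb_ct using g by blast
    have "isX ?y" using isX_orb[OF x(1) y] .
    moreover have "char_poly (?y * J) = ([:0, 1:]\<^sup>2 - 1) ^ n" using char_poly_orb[OF xc y] x(2) by simp
    ultimately obtain h where h: "h \<in> GR R" "outer_diag (Suc r) (ct h * ?y * h)" "box_dominant (Suc r) (ct h * ?y * h)"
      using reduction_step[OF _ _ _ g(2,3)] Suc.prems by auto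
    note c = GR_carrier[OF g(1)] GR_carrier[OF h(1)]
    have "ct h * ?y * h = ct (g * h) * x * (g * h)"
      unfolding ct_mult[OF c] using c xc by (simp add: mat_assoc)
    then show ?case using h GR_mult[OF g(1) h(1)] by auto
  qed
  then show thesis using that by blast
qed

end

section \<open>Diagonal matrices with powers of the prime\<close>

context unitary_setting
begin

definition ex :: "int list \<Rightarrow> nat \<Rightarrow> int" where
  "ex l i = (if i < n then l ! i else - (l ! opp i))"

text \<open>The matrix x_lambda for arbitrary integer exponents: the moves inside a
  \<open>G\<close>-orbit lead outside \<open>Lambda_plus\<close>.\<close>

definition dg :: "int list \<Rightarrow> 'a mat" where
  "dg l = mat_diag N (\<lambda>i. p powi (ex l i))"

lemma ex_opp: "i < N \<Longrightarrow> ex l (opp i) = - ex l i"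
proof -
  assume i: "i < N"
  then have "opp i < n \<longleftrightarrow> \<not> i < n" by presburger
  then show ?thesis using i by (auto simp: ex_def)
qed

lemma x_diag_eq: assumes "length l = n" shows "x_diag p l = dg l"
proof (rule eq_matI)
  fix i j assume "i < dim_row (dg l)" "j < dim_col (dg l)"
  then have ij: "i < N" "j < N" by (auto simp: dg_def mat_diag_def)
  have "(map (\<lambda>i. p powi i) l @ rev (map (\<lambda>i. p powi (- i)) l)) ! j = p powi (ex l j)"
  proof (cases "j < n")
    case False
    have "n - Suc (j - n) = opp j" using ij False by simp
    moreover have "j - n < n" "opp j < n" using ij False by simp_all
    ultimately show ?thesis using assms False by (simp add: nth_append ex_def rev_nth)
  qed (use assms in \<open>simp add: nth_append ex_def\<close>)
  then show "x_diag p l $$ (i, j) = dg l $$ (i, j)"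
    using ij assms by (auto simp: x_diag_def Diag_def dg_def mat_diag_def)
qed (use assms in \<open>auto simp: x_diag_def Diag_def dg_def mat_diag_def\<close>)

lemma dg_carrier [simp]: "dg l \<in> carrier_mat N N"
  by (auto simp: dg_def)

lemma dg_index: "i < N \<Longrightarrow> j < N \<Longrightarrow> dg l $$ (i, j) = (if i = j then p powi (ex l i) else 0)"
  by (auto simp: dg_def mat_diag_def)

lemma isX_dg: "isX (dg l)"
proof -
  have "dg l * J * dg l = J"
  proof (rule eq_matI)
    fix i j assume "i < dim_row J" "j < dim_col J"
    then have ij: "i < N" "j < N" by auto
    have e: "ex l i + ex l j = 0" if "i + j + 1 = N"
    proof -
      have "j = opp i" using that by simp
      then show ?thesis using ex_opp[OF ij(1)] by simp
    qed
    show "(dg l * J * dg l) $$ (i, j) = J $$ (i, j)"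
      using ij e unfolding dg_def mat_diag_mult_left[OF J_carrier]
      by (subst mat_diag_mult_right[of _ N N]) (auto simp: p_powi_add)
  qed (auto simp: dg_def mat_diag_def)
  moreover have "ct (dg l) = dg l"
    by (rule eq_matI) (auto simp: dg_index dg_carrier[THEN carrier_matD(1)] dg_carrier[THEN carrier_matD(2)])
  ultimately show ?thesis by (simp add: isX_def)
qed

lemma x1_eq: "n \<ge> 1 \<Longrightarrow> Diag (p # replicate (2 * n - 2) 1 @ [inverse p]) = dg (1 # replicate (n - 1) 0)"
proof (rule eq_matI)
  assume n: "n \<ge> 1"
  fix i j assume "i < dim_row (dg (1 # replicate (n - 1) 0))" "j < dim_col (dg (1 # replicate (n - 1) 0))"
  then have ij: "i < N" "j < N" by (auto simp: dg_def mat_diag_def)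
  have "(p # replicate (2 * n - 2) 1 @ [inverse p]) ! j = p powi (ex (1 # replicate (n - 1) 0) j)"
  proof -
    consider "j = 0" | "j = N - 1" "j \<noteq> 0" | "0 < j" "j < N - 1" using ij by linarith
    then show ?thesis
    proof cases
      case 1
      then show ?thesis using n by (simp add: ex_def)
    next
      case 2
      then have "j - 1 = 2 * n - 2" "\<not> j < n" "opp j = 0" using n by linarith+
      then show ?thesis using 2 by (simp add: ex_def nth_append nth_Cons' power_int_minus)
    next
      case 3
      then have "ex (1 # replicate (n - 1) 0) j = 0" unfolding ex_def by (auto simp: nth_Cons')
      then show ?thesis using 3 by (simp add: nth_append nth_Cons')
    qed
  qed
  then show "Diag (p # replicate (2 * n - 2) 1 @ [inverse p]) $$ (i, j) = dg (1 # replicate (n - 1) 0) $$ (i, j)"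
    using ij n by (auto simp: Diag_def dg_def mat_diag_def)
qed (auto simp: Diag_def dg_def mat_diag_def)

lemma x0_eq: "1\<^sub>m N = dg (replicate n 0)"
proof (rule eq_matI)
  fix i j assume "i < dim_row (dg (replicate n 0))" "j < dim_col (dg (replicate n 0))"
  then have ij: "i < N" "j < N" by (auto simp: dg_def mat_diag_def)
  moreover have "ex (replicate n 0) i = 0" using ij by (auto simp: ex_def)
  ultimately show "1\<^sub>m N $$ (i, j) = dg (replicate n 0) $$ (i, j)" by (auto simp: dg_index)
qed (auto simp: dg_def mat_diag_def)

text \<open>The defining equation makes \<open>J * ct g * J\<close> a left inverse of
  \<open>g\<close>, hence an inverse.\<close>

lemma unitary_grp_eq: "unitary_grp k s n = GR UNIV"
proof -
  have "invertible_mat g" if "g \<in> carrier_mat N N" "ct g * J * g = J" for g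
  proof -
    have "(J * ct g * J) * g = J * (ct g * J * g)" using that(1) by (simp add: mat_assoc)
    then have 1: "(J * ct g * J) * g = 1\<^sub>m N" using that by simp
    then have "g * (J * ct g * J) = 1\<^sub>m N"
      using that(1) mat_mult_left_right_inverse[of "J * ct g * J" N g] by (simp add: mat_assoc)
    then show ?thesis unfolding invertible_mat_def inverts_mat_def using 1 that(1) by auto
  qed
  then show ?thesis unfolding unitary_grp_def GR_def by auto
qed

lemma integral_unitary_grp_eq: "integral_unitary_grp k w s n = GR {x. vge 0 x}"
proof -
  have "elements_mat g \<subseteq> integer_ring UNIV w \<longleftrightarrow> (\<forall>i<N. \<forall>j<N. vge 0 (g $$ (i, j)))"
    if "g \<in> carrier_mat N N" for g
  proof -
    have "elements_mat g = {g $$ (i, j) |i j. i < N \<and> j < N}"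
      using that unfolding elements_mat_def by force
    then show ?thesis by (auto simp: integer_ring_def val_ideal_def vge_def)
  qed
  then show ?thesis
    unfolding integral_unitary_grp_def unitary_grp_eq by (auto simp: GR_def)
qed

lemma herm_space_eq: "herm_space k s n = {x. isX x \<and> char_poly (x * J) = ([:0, 1:]\<^sup>2 - 1) ^ n}"
  unfolding herm_space_def unitary_grp_eq by (auto simp: GR_def isX_def)

lemma UNIV_ring: "conj_valuation_ring k v w p s UNIV"
  by unfold_locales auto

lemma integer_ring_ring:
  assumes "w 2 = 0" shows "conj_valuation_ring k v w p s {x. vge 0 x}"
proof unfold_locales
  fix x show "x \<in> {x. vge 0 x} \<or> inverse x \<in> {x. vge 0 x}"
    by (cases "x = 0") (auto simp: vge_def w_inverse)
qed (use assms in \<open>auto simp: vge_add vge_mult0 vge_cj vge_def[of _ "1 / 2"] vge_def[of _ s] vge_def[of _ "inverse s"]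
    w_inverse w_divide\<close>)

end

context conj_valuation_ring
begin

lemma isX_diag_entries:
  assumes D: "isX D" "outer_diag n D" and i: "i < N"
  shows "D $$ (i, i) \<in> k" "D $$ (i, i) \<noteq> 0" "D $$ (opp i, opp i) = inverse (D $$ (i, i))"
proof -
  show "D $$ (i, i) \<in> k" using isX_sym[OF D(1) i i] cj_fixed_iff by blast
  have "D $$ (i, i) * D $$ (opp i, opp i) = 1"
    by (rule isX_outer_inverse[OF D i]) (auto simp: inI_def)
  then show "D $$ (i, i) \<noteq> 0" "D $$ (opp i, opp i) = inverse (D $$ (i, i))"
    by (auto simp: inverse_unique)
qed

text \<open>A diagonal entry lies in \<open>k\<close>, so it differs from a power of
  \<open>p\<close> by a unit of \<open>k\<close>, which is a norm of some \<open>c\<close>. Scaling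
  the opposite vector by the inverse of \<open>cj c\<close> keeps the pair hyperbolic. All scalars
  have valuation 0, so they belong to \<open>R\<close>.\<close>

lemma diag_to_powers:
  assumes D: "isX D" "outer_diag n D" and R: "\<And>c. c \<noteq> 0 \<Longrightarrow> w c = 0 \<Longrightarrow> c \<in> R"
  shows "dg (map (\<lambda>i. w (D $$ (i, i))) [0..<n]) \<in> orb D"
proof -
  let ?l = "map (\<lambda>i. w (D $$ (i, i))) [0..<n]"
  have ex: "ex ?l i = w (D $$ (i, i))" if "i < N" for i
  proof (cases "i < n")
    case False
    then have "opp i < n" using that by simp
    then show ?thesis
      using False isX_diag_entries[OF D that] by (simp add: ex_def w_inverse)
  qed (simp add: ex_def)
  have "\<exists>c. c \<noteq> 0 \<and> w c = 0 \<and> c * cj c * D $$ (i, i) = p powi w (D $$ (i, i))" if "i < N" for i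
    using scale_to_power[OF isX_diag_entries(1,2)[OF D that]] by metis
  then obtain c where c: "c i \<noteq> 0" "w (c i) = 0" "c i * cj (c i) * D $$ (i, i) = p powi w (D $$ (i, i))"
    if "i < N" for i by metis
  define \<gamma> where "\<gamma> i = (if i < n then c i else inverse (cj (c (opp i))))" for i
  have half: "opp i < n \<longleftrightarrow> \<not> i < n" if "i < N" for i using that by presburger
  have \<gamma>: "cj (\<gamma> i) * \<gamma> (opp i) = 1" if "i < N" for i
    using c(1)[OF that] c(1)[OF opp_lt[OF that]] half[OF that] that by (auto simp: \<gamma>_def)
  have norm: "cj (\<gamma> i) * D $$ (i, i) * \<gamma> i = p powi w (D $$ (i, i))" if i: "i < N" for i
  proof (cases "i < n")
    case True
    then show ?thesis using c(3)[OF i] by (simp add: \<gamma>_def ac_simps)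
  next
    case False
    define j where "j = opp i"
    have j: "j < N" "opp j = i" using i by (auto simp: j_def)
    have "\<gamma> i = inverse (cj (c j))" using False by (simp add: \<gamma>_def j_def)
    moreover have "D $$ (i, i) = inverse (D $$ (j, j))"
      using isX_diag_entries(3)[OF D j(1)] unfolding j(2) .
    ultimately have "cj (\<gamma> i) * D $$ (i, i) * \<gamma> i = inverse (c j * cj (c j) * D $$ (j, j))"
      by (simp add: ac_simps)
    also have "\<dots> = p powi (w (D $$ (i, i)))"
      unfolding c(3)[OF j(1)] using isX_diag_entries[OF D j(1)] by (simp add: j(2) w_inverse power_int_minus)
    finally show ?thesis .
  qed
  define b where "b i = single i (\<gamma> i)" for i
  have "frame b" unfolding b_def using \<gamma> by (intro frame_single[where \<sigma> = "\<lambda>i. i"]) auto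
  moreover have "\<gamma> i \<in> R" if "i < N" for i
    using c(1,2)[OF that] c(1,2)[OF opp_lt[OF that]] by (intro R) (auto simp: \<gamma>_def w_inverse)
  ultimately have g: "gmat b \<in> GR R" by (intro gmat_GR) (auto simp: b_def single_def)
  have Dc: "D \<in> carrier_mat N N" using D by (simp add: isX_def)
  have "dg ?l = ct (gmat b) * D * gmat b"
  proof (rule eq_matI)
    fix i j assume "i < dim_row (ct (gmat b) * D * gmat b)" "j < dim_col (ct (gmat b) * D * gmat b)"
    then have ij: "i < N" "j < N" by auto
    have "D $$ (i, j) = 0" if "i \<noteq> j" using D(2) ij that by (auto simp: outer_diag_def inI_def)
    then show "dg ?l $$ (i, j) = (ct (gmat b) * D * gmat b) $$ (i, j)"
      unfolding gmat_gram[OF Dc ij] b_def form_single[OF ij] dg_index[OF ij]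
      using norm[OF ij(1)] ex[OF ij(1)] by (cases "i = j") simp_all
  qed (auto simp: dg_carrier[THEN carrier_matD(1)] dg_carrier[THEN carrier_matD(2)])
  then show ?thesis unfolding orb_ct using g by blast
qed

lemma herm_to_powers:
  assumes x: "isX x" "char_poly (x * J) = ([:0, 1:]\<^sup>2 - 1) ^ n" and R: "\<And>c. c \<noteq> 0 \<Longrightarrow> w c = 0 \<Longrightarrow> c \<in> R"
  obtains l where "length l = n" "dg l \<in> orb x"
    "R = {x. vge 0 x} \<Longrightarrow> l \<in> Lambda_plus n"
proof -
  obtain g where g: "g \<in> GR R" "outer_diag n (ct g * x * g)" "box_dominant n (ct g * x * g)"
    by (rule diagonal_reduction[OF x])
  define D where "D = ct g * x * g"
  have Dx: "D \<in> orb x" unfolding orb_ct D_def using g by blast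
  then have D: "isX D" using isX_orb x(1) by blast
  have Do: "outer_diag n D" using g by (simp add: D_def)
  let ?l = "map (\<lambda>i. w (D $$ (i, i))) [0..<n]"
  have "dg ?l \<in> orb x"
    using orb_trans[OF _ Dx diag_to_powers[OF D Do R]] x(1) by (simp add: isX_def)
  moreover have "?l \<in> Lambda_plus n" if RO: "R = {x. vge 0 x}"
  proof -
    \<comment> \<open>Box dominance for position \<open>opp j\<close>. The entries at
      \<open>j\<close> and \<open>opp j\<close> are inverse to each other, so applying this to
      \<open>opp i\<close> turns it into the decrease of the exponents, and applying it to
      \<open>j\<close> itself shows that they are nonnegative.\<close>
    have dom: "w (D $$ (opp j, opp j)) \<le> w (D $$ (i, i))" if "j < n" "j \<le> i" "i \<le> opp j" for i j
    proof -
      have *: "opp j < N" "N - n \<le> opp j" "inB (opp j) i" "i < N" using that by (auto simp: inB_def)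
      then have "D $$ (i, i) / D $$ (opp j, opp j) \<in> R"
        using g(3) unfolding box_dominant_def D_def by blast
      then show ?thesis
        using isX_diag_entries(2)[OF D Do *(1)] isX_diag_entries(2)[OF D Do *(4)]
        unfolding RO by (simp add: vge_def w_divide)
    qed
    have neg: "w (D $$ (opp j, opp j)) = - w (D $$ (j, j))" if "j < n" for j
    proof -
      have "j < N" using that by simp
      then show ?thesis using isX_diag_entries(2,3)[OF D Do \<open>j < N\<close>] by (simp add: w_inverse)
    qed
    have "w (D $$ (i, i)) \<le> w (D $$ (j, j))" if "j \<le> i" "i < n" for i j
    proof -
      have "j < n" "j \<le> opp i" "opp i \<le> opp j" using that by auto
      then have "w (D $$ (opp j, opp j)) \<le> w (D $$ (opp i, opp i))" by (rule dom)
      then show ?thesis using neg[of j] neg[of i] that by simp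
    qed
    moreover have "0 \<le> w (D $$ (j, j))" if "j < n" for j
    proof -
      have "w (D $$ (opp j, opp j)) \<le> w (D $$ (j, j))" using that by (intro dom) auto
      then show ?thesis using neg[OF that] by simp
    qed
    ultimately show ?thesis
      unfolding Lambda_plus_def sorted_wrt_iff_nth_less by auto
  qed
  ultimately show thesis by (intro that[of ?l]) auto
qed

lemma char_poly_dg: "char_poly (dg l * J) = ([:0, 1:]\<^sup>2 - 1) ^ n"
  by (rule char_poly_diag[OF isX_dg]) (auto simp: outer_diag_def dg_index)

end

section \<open>Parity of the exponent sum and moves between diagonal matrices\<close>

context unitary_setting
begin

lemma frame_equivalence:
  assumes "A \<in> carrier_mat N N" "frame b"
    and "\<And>i j. i < N \<Longrightarrow> j < N \<Longrightarrow> form A (b i) (b j) = (if i = j then p powi (ex m i) else 0)"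
  shows "\<exists>g\<in>GR UNIV. ct g * A * g = dg m"
proof (intro bexI[of _ "gmat b"])
  show "ct (gmat b) * A * gmat b = dg m"
  proof (rule eq_matI)
    fix i j assume "i < dim_row (dg m)" "j < dim_col (dg m)"
    then have ij: "i < N" "j < N" by (auto simp: dg_def mat_diag_def)
    show "(ct (gmat b) * A * gmat b) $$ (i, j) = dg m $$ (i, j)"
      unfolding gmat_gram[OF assms(1) ij] dg_index[OF ij] by (rule assms(3)[OF ij])
  qed (auto simp: dg_def mat_diag_def)
  show "gmat b \<in> GR UNIV" by (rule gmat_GR[OF assms(2)]) simp
qed

text \<open>Multiplication by \<open>g * J\<close> from the left, together with
  \<open>g * J * ct g = J\<close>, gives \<open>g * J * dg m = J * dg l * g\<close>, in which
  \<open>g\<close> occurs linearly. Both the parity of the exponent sum and the separation of the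
  integral orbits start from here.\<close>

lemma dg_equivalence_entry:
  assumes g: "g \<in> GR R" "ct g * dg l * g = dg m" and ij: "i < N" "j < N"
  shows "p powi (ex l i) * g $$ (i, j) = p powi (ex m j) * g $$ (opp i, opp j)"
proof -
  have c: "g \<in> carrier_mat N N" using g by (simp add: GR_def)
  have "g * J * dg m = (g * J * ct g) * dg l * g"
    unfolding g(2)[symmetric] using c by (simp add: mat_assoc)
  then have eq: "(g * J) * dg m = J * (dg l * g)"
    unfolding GR_J[OF g(1)] using c by (simp add: mat_assoc)
  have "((g * J) * dg m) $$ (opp i, j) = g $$ (opp i, opp j) * p powi (ex m j)"
  proof -
    have gJ: "g * J \<in> carrier_mat N N" using c by simp
    show ?thesis unfolding dg_def mat_diag_mult_right[OF gJ]
      using ij mult_J_right[OF c, of "opp i" j] by (simp del: index_mult_mat(1))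
  qed
  moreover have "(J * (dg l * g)) $$ (opp i, j) = p powi (ex l i) * g $$ (i, j)"
  proof -
    have dc: "dg l * g \<in> carrier_mat N N" using c by (rule mult_carrier_mat[OF dg_carrier])
    have "(J * (dg l * g)) $$ (opp i, j) = (dg l * g) $$ (i, j)"
      using mult_J_left[OF dc opp_lt[OF ij(1)] ij(2)] ij by (simp del: index_mult_mat(1))
    then show ?thesis unfolding dg_def mat_diag_mult_left[OF c] using ij by simp
  qed
  ultimately show ?thesis using eq by (simp add: mult.commute)
qed

lemma cj_hom: "comm_ring_hom cj"
  by unfold_locales auto

lemma det_ct: "C \<in> carrier_mat m m \<Longrightarrow> det (ct C) = cj (det C)"
  unfolding conj_transpose_def
  by (simp add: comm_ring_hom.hom_det[OF cj_hom] det_transpose[of _ m])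

text \<open>The vectors fixed by the involution \<open>dg l * J\<close> form a hermitian space with discriminant
  \<open>2 ^ n\<close> times the product of the first \<open>n\<close> diagonal entries, so the valuation of this product
  is determined modulo 2 by the orbit.\<close>

lemma orbit_parity:
  assumes g: "g \<in> GR R" "ct g * dg l * g = dg m" and len: "length l = n" "length m = n"
  shows "even (sum_list l) \<longleftrightarrow> even (sum_list m)"
proof -
  define d where "d i = p powi (ex l i)" for i
  define e where "e i = p powi (ex m i)" for i
  have c: "g \<in> carrier_mat N N" "ct g * J * g = J" using g by (auto simp: GR_def)
  have de: "cj (d i) = d i" "cj (e i) = e i" "d i \<noteq> 0" "e i \<noteq> 0" for i
    using p(2) by (simp_all add: d_def e_def)
  have opp_de: "d i * d (opp i) = 1" "e i * e (opp i) = 1" if "i < N" for i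
    using ex_opp[OF that] by (simp_all add: d_def e_def p_powi_add)
  have rel: "d i * g $$ (i, j) = e j * g $$ (opp i, opp j)" if "i < N" "j < N" for i j
    unfolding d_def e_def by (rule dg_equivalence_entry[OF g that])
  have H: "H (\<lambda>i. g $$ (i, j)) (\<lambda>i. g $$ (i, l)) = (if j + l + 1 = N then 1 else 0)" if "j < N" "l < N" for j l
    using ct_mult_mult_index[OF c(1) J_carrier c(1) that] c(2) that by simp
  \<comment> \<open>Column \<open>j\<close> plus its image under the involution
    \<open>J * dg l\<close>, hence a fixed vector; by \<open>rel\<close> this image is
    \<open>e j\<close> times the opposite column.\<close>
  define x where "x j = axpy (\<lambda>i. g $$ (i, j)) (e j) (\<lambda>i. g $$ (i, opp j))" for j
  have fixed: "x j (opp i) = d i * x j i" if ij: "i < N" "j < N" for i j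
  proof -
    have "d i * x j i = d i * g $$ (i, j) + e j * (d i * g $$ (i, opp j))"
      by (simp add: x_def axpy_def algebra_simps)
    also have "\<dots> = e j * g $$ (opp i, opp j) + e j * (e (opp j) * g $$ (opp i, opp (opp j)))"
      using rel[OF ij] rel[OF ij(1) opp_lt[OF ij(2)]] by simp
    also have "\<dots> = e j * g $$ (opp i, opp j) + (e j * e (opp j)) * g $$ (opp i, j)"
      using ij by simp
    also have "\<dots> = x j (opp i)" unfolding opp_de(2)[OF ij(2)] by (simp add: x_def axpy_def)
    finally show ?thesis by simp
  qed
  have Hx: "H (x i) (x j) = (if i = j then 2 * e i else 0)" if ij: "i < n" "j < n" for i j
  proof -
    have N: "i < N" "j < N" "opp i < N" "opp j < N" using ij by auto
    have ne: "i + j + 1 \<noteq> N" "opp i + opp j + 1 \<noteq> N" "i + opp j + 1 = N \<longleftrightarrow> i = j" "opp i + j + 1 = N \<longleftrightarrow> i = j"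
      using ij by auto
    show ?thesis
      unfolding x_def form_axpy H[OF N(1,2)] H[OF N(1,4)] H[OF N(3,2)] H[OF N(3,4)] ne de
      using ne(1,2) by simp
  qed
  \<comment> \<open>For fixed vectors the second half of the sum defining \<open>H\<close> repeats
    the first. The first \<open>n\<close> coordinates therefore suffice, and the Gram matrix takes
    the form \<open>ct C * (mat_diag n d * C)\<close>, whose determinant differs from the product of
    the \<open>d i\<close> by a norm.\<close>
  have halves: "(\<Sum>i = 0..<n. cj (x a i) * (d i * x b i)) = (if a = b then e a else 0)"
    if ab: "a < n" "b < n" for a b
  proof -
    have N: "a < N" "b < N" using ab by auto
    have "H (x a) (x b) = (\<Sum>i = 0..<N. cj (x a i) * (d i * x b i))"
      unfolding H_alt using fixed N by (intro sum.cong) auto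
    also have "\<dots> = (\<Sum>i = 0..<n. cj (x a i) * (d i * x b i)) + (\<Sum>i = n..<N. cj (x a i) * (d i * x b i))"
      by (subst sum.atLeastLessThan_concat) auto
    also have "(\<Sum>i = n..<N. cj (x a i) * (d i * x b i)) = (\<Sum>i = 0..<n. cj (x a i) * (d i * x b i))"
    proof (rule sum.reindex_bij_witness[of _ opp opp])
      fix i assume "i \<in> {n..<N}"
      then have i: "i < N" by auto
      have oi: "opp i < N" using i by simp
      have f: "x a i = d (opp i) * x a (opp i)" "x b i = d (opp i) * x b (opp i)"
        using fixed[OF oi N(1)] fixed[OF oi N(2)] i by simp_all
      have "cj (x a i) * (d i * x b i) = (d i * d (opp i)) * (cj (x a (opp i)) * (d (opp i) * x b (opp i)))"
        unfolding f by (simp add: de)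
      then show "cj (x a (opp i)) * (d (opp i) * x b (opp i)) = cj (x a i) * (d i * x b i)"
        unfolding opp_de(1)[OF i] by simp
    qed auto
    finally have "2 * (\<Sum>i = 0..<n. cj (x a i) * (d i * x b i)) = (if a = b then 2 * e a else 0)"
      using Hx[OF ab] by simp
    then show ?thesis by (auto split: if_splits)
  qed
  define C where "C = mat n n (\<lambda>(i, j). x j i)"
  have C: "C \<in> carrier_mat n n" by (simp add: C_def)
  have prod: "ct C * (mat_diag n d * C) = mat_diag n e"
  proof (rule eq_matI)
    fix i j assume "i < dim_row (mat_diag n e)" "j < dim_col (mat_diag n e)"
    then have ij: "i < n" "j < n" by (auto simp: mat_diag_def)
    have "(ct C * (mat_diag n d * C)) $$ (i, j) = (\<Sum>q = 0..<n. cj (x i q) * (d q * x j q))"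
      unfolding mat_diag_mult_left[OF C] using ij C by (auto simp: scalar_prod_def C_def intro!: sum.cong)
    then show "(ct C * (mat_diag n d * C)) $$ (i, j) = mat_diag n e $$ (i, j)"
      using halves[OF ij] ij by (simp add: mat_diag_def)
  qed (auto simp: C_def mat_diag_def)
  have dm: "mat_diag n d * C \<in> carrier_mat n n" using C by (intro mult_carrier_mat) auto
  have "cj (det C) * ((\<Prod>i = 0..<n. d i) * det C) = (\<Prod>i = 0..<n. e i)"
    using arg_cong[OF prod, of det] det_mult[OF ct_carrier[OF C] dm] det_mult[OF mat_diag_dim C, of d]
    by (simp add: det_ct[OF C] det_mat_diag)
  moreover have "det C \<noteq> 0"
    using calculation de(4) by auto
  moreover have "(\<Prod>i = 0..<n. d i) \<noteq> 0" "(\<Prod>i = 0..<n. e i) \<noteq> 0" using de by auto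
  ultimately have "w (det C) + (w (\<Prod>i = 0..<n. d i) + w (det C)) = w (\<Prod>i = 0..<n. e i)"
    using w_mult by (metis cj_eq_0 mult_eq_0_iff w_cj)
  moreover have "w (\<Prod>i = 0..<n. d i) = sum_list l" "w (\<Prod>i = 0..<n. e i) = sum_list m"
  proof -
    have "w (\<Prod>i = 0..<n. d i) = (\<Sum>i = 0..<n. w (d i))" "w (\<Prod>i = 0..<n. e i) = (\<Sum>i = 0..<n. w (e i))"
      using de by (auto intro!: w_prod)
    then show "w (\<Prod>i = 0..<n. d i) = sum_list l" "w (\<Prod>i = 0..<n. e i) = sum_list m"
      using len by (simp_all add: d_def e_def ex_def sum_list_sum_nth)
  qed
  ultimately have "sum_list m = sum_list l + 2 * w (det C)" by simp
  then show ?thesis by simp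
qed

text \<open>The monomial matrix multiplies the vectors of the pair of \<open>i\<close> by p^c and
  p^(-c).\<close>

lemma scale_exponent:
  assumes l: "length l = n" "i < n"
  shows "\<exists>g\<in>GR UNIV. ct g * dg l * g = dg (l[i := l ! i + 2 * c])"
proof (rule frame_equivalence[OF dg_carrier])
  define \<gamma> where "\<gamma> j = (if j = i then p powi c else if j = opp i then p powi (- c) else 1)" for j
  have i: "i < N" "opp i \<noteq> i" "\<not> opp i < n" using l by auto
  have "frame (\<lambda>j. single j (\<gamma> j))"
  proof (rule frame_single[where \<sigma> = "\<lambda>j. j"])
    fix j assume j: "j < N"
    have "opp j = opp i \<longleftrightarrow> j = i" "opp j = i \<longleftrightarrow> j = opp i" using i j by auto
    then show "cj (\<gamma> j) * \<gamma> (opp j) = 1"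
      unfolding \<gamma>_def using i(2) by (auto simp: p_powi_add)
  qed auto
  then show "frame (\<lambda>j. single j (\<gamma> j))" .
  fix a b assume ab: "a < N" "b < N"
  have e: "ex (l[i := l ! i + 2 * c]) a = ex l a + (if a = i then 2 * c else if a = opp i then - 2 * c else 0)"
  proof -
    have "opp a = i \<longleftrightarrow> a = opp i" using i ab by auto
    then show ?thesis using l i ab unfolding ex_def by (auto simp: nth_list_update)
  qed
  have "cj (\<gamma> a) * p powi (ex l a) * \<gamma> a = p powi (ex (l[i := l ! i + 2 * c]) a)"
    unfolding e \<gamma>_def by (auto simp: p_powi_add add.commute)
  then show "form (dg l) (single a (\<gamma> a)) (single b (\<gamma> b)) = (if a = b then p powi ex (l[i := l ! i + 2 * c]) a else 0)"
    unfolding form_single[OF ab] dg_index[OF ab] by (cases "a = b") simp_all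
qed


text \<open>In the plane with values A and B, the vector (\<alpha>, \<beta>) has value 1, and (- cj
  \<beta> B, cj \<alpha> A) is orthogonal to it with value A B. The 2 by 2 matrix with these columns
  has determinant 1. On the opposite coordinates its inverse conjugate transpose is applied, which
  makes the whole transformation unitary.\<close>

lemma merge_exponents:
  assumes l: "length l = n" "i < n" "j < n" "i \<noteq> j"
  shows "\<exists>g\<in>GR UNIV. ct g * dg l * g = dg (l[i := 0, j := l ! i + l ! j])"
proof -
  define A B where "A = p powi (l ! i)" and "B = p powi (l ! j)"
  obtain \<alpha> \<beta> where "\<alpha> * cj \<alpha> * p powi (l ! i) + \<beta> * cj \<beta> * p powi (l ! j) = 1"
    by (rule merge_solvable)
  then have norm: "\<alpha> * cj \<alpha> * A + \<beta> * cj \<beta> * B = 1" by (simp add: A_def B_def)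
  have norm2: "A * (A * (B * (\<alpha> * cj \<alpha>))) + A * (B * (B * (\<beta> * cj \<beta>))) = A * B"
  proof -
    have "A * (A * (B * (\<alpha> * cj \<alpha>))) + A * (B * (B * (\<beta> * cj \<beta>)))
        = A * B * (\<alpha> * cj \<alpha> * A + \<beta> * cj \<beta> * B)"
      by (simp only: algebra_simps)
    then show ?thesis unfolding norm by simp
  qed
  have AB: "A \<noteq> 0" "B \<noteq> 0" "cj A = A" "cj B = B" using p(2) by (simp_all add: A_def B_def)
  define i' j' where "i' = opp i" and "j' = opp j"
  have N: "i < N" "j < N" "i' < N" "j' < N" using l by (auto simp: i'_def j'_def)
  have ne: "i \<noteq> j" "i \<noteq> i'" "i \<noteq> j'" "j \<noteq> i'" "j \<noteq> j'" "i' \<noteq> j'"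
    using l unfolding i'_def j'_def by arith+
  note ne = ne ne[symmetric]
  have opp: "opp i = i'" "opp j = j'" "opp i' = i" "opp j' = j"
    using l by (auto simp: i'_def j'_def)
  \<comment> \<open>The vector with index \<open>q\<close> has coefficient \<open>P q\<close> at
    \<open>f q\<close>, which is \<open>i\<close> or \<open>i'\<close>, and \<open>Q q\<close> at
    \<open>h q\<close>, which is \<open>j\<close> or \<open>j'\<close>. For all other indices the
    standard vector is kept.\<close>
  define P where "P = (\<lambda>q. if q = i then \<alpha> else if q = j then - cj \<beta> * B else if q = i' then \<alpha> * A
    else if q = j' then - cj \<beta> else 1)"
  define Q where "Q = (\<lambda>q. if q = i then \<beta> else if q = j then cj \<alpha> * A else if q = i' then \<beta> * B
    else if q = j' then cj \<alpha> else 0)"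
  define f where "f = (\<lambda>q. if q = i \<or> q = j then i else if q = i' \<or> q = j' then i' else q)"
  define h where "h = (\<lambda>q. if q = i \<or> q = j then j else if q = i' \<or> q = j' then j' else q)"
  define b where "b q = axpy (single (f q) (P q)) (Q q) (single (h q) 1)" for q
  have lt: "f q < N" "h q < N" if "q < N" for q using that N by (auto simp: f_def h_def)
  have gram: "form M (b a) (b c) = cj (P a) * M $$ (f a, f c) * P c + Q c * (cj (P a) * M $$ (f a, h c))
      + cj (Q a) * (M $$ (h a, f c) * P c) + cj (Q a) * Q c * M $$ (h a, h c)" if "a < N" "c < N" for M a c
    unfolding b_def form_axpy using lt[OF that(1)] lt[OF that(2)] by (simp add: form_single algebra_simps)
  have vals: "f i = i" "f j = i" "f i' = i'" "f j' = i'" "h i = j" "h j = j" "h i' = j'" "h j' = j'"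
    "P i = \<alpha>" "P j = - cj \<beta> * B" "P i' = \<alpha> * A" "P j' = - cj \<beta>"
    "Q i = \<beta>" "Q j = cj \<alpha> * A" "Q i' = \<beta> * B" "Q j' = cj \<alpha>"
    using ne by (simp_all add: f_def h_def P_def Q_def)
  have other: "f q = q" "h q = q" "P q = 1" "Q q = 0" if "q \<notin> {i, j, i', j'}" for q
    using that by (simp_all add: f_def h_def P_def Q_def)
  have Jij: "J $$ (a, c) = (if c = opp a then 1 else 0)" if "a < N" "c < N" for a c
    using that J_eq_0[OF that] J_eq_1[OF that] by (simp del: J_index)
  have four: "a = i \<or> a = j \<or> a = i' \<or> a = j' \<or> a \<notin> {i, j, i', j'}" for a by blast
  have opp_other: "opp a \<notin> {i, j, i', j'}" if "a < N" "a \<notin> {i, j, i', j'}" for a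
  proof -
    have "a = opp (opp a)" using that by simp
    then show ?thesis using that opp by (metis insertE insertI1 insertI2 singletonD)
  qed
  note simps = cj_mult cj_minus cj_cj AB(3,4)
  have spec: "form J (b a) (b c) = (if c = opp a then 1 else 0)"
    if "a \<in> {i, j, i', j'}" "c \<in> {i, j, i', j'}" for a c
  proof -
    have ac: "a < N" "c < N" using that N by auto
    show ?thesis
      using that unfolding gram[OF ac]
      by (elim insertE emptyE; simp only: vals opp Jij N ne if_True if_False refl simps)
         (use norm in \<open>simp_all add: algebra_simps\<close>)
  qed
  have frame: "frame b"
    unfolding frame_def
  proof (intro allI impI)
    fix a c assume ac: "a < N" "c < N"
    have iff: "a + c + 1 = N \<longleftrightarrow> c = opp a" using ac by auto
    show "form J (b a) (b c) = (if a + c + 1 = N then 1 else 0)"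
      unfolding iff
    proof (cases "a \<in> {i, j, i', j'}")
      case a: True
      show "form J (b a) (b c) = (if c = opp a then 1 else 0)"
      proof (cases "c \<in> {i, j, i', j'}")
        case True
        then show ?thesis using spec a by blast
      next
        case False
        have "opp a \<in> {i, j, i', j'}" using a opp by (elim insertE emptyE) simp_all
        moreover have "f a \<in> {i, i'}" "h a \<in> {j, j'}" using a vals by auto
        then have "opp (f a) \<in> {i, i'}" "opp (h a) \<in> {j, j'}" using opp by (elim insertE emptyE; simp)+
        ultimately have "c \<noteq> opp a" "c \<noteq> opp (f a)" "c \<noteq> opp (h a)" using False by blast+
        then show ?thesis
          unfolding gram[OF ac] other[OF False] using Jij[OF lt(1)[OF ac(1)] ac(2)] Jij[OF lt(2)[OF ac(1)] ac(2)]
          by (simp del: J_index)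
      qed
    next
      case a: False
      show "form J (b a) (b c) = (if c = opp a then 1 else 0)"
      proof (cases "c \<in> {i, j, i', j'}")
        case True
        then have "f c \<in> {i, j, i', j'}" "h c \<in> {i, j, i', j'}" by (auto simp: f_def h_def)
        then have "f c \<noteq> opp a" "h c \<noteq> opp a" "c \<noteq> opp a" using opp_other[OF ac(1) a] True by metis+
        then show ?thesis
          unfolding gram[OF ac] other[OF a] Jij[OF ac(1) lt(1)[OF ac(2)]] Jij[OF ac(1) lt(2)[OF ac(2)]]
          by simp
      next
        case False
        show ?thesis unfolding gram[OF ac] other[OF a] other[OF False] Jij[OF ac] by simp
      qed
    qed
  qed
  let ?m = "l[i := 0, j := l ! i + l ! j]"
  have exl: "p powi (ex l i) = A" "p powi (ex l j) = B" "p powi (ex l i') = inverse A" "p powi (ex l j') = inverse B"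
    using l ex_opp[OF N(1), of l] ex_opp[OF N(2), of l]
    by (simp_all add: A_def B_def i'_def[symmetric] j'_def[symmetric] power_int_minus) (simp_all add: ex_def)
  have "?m ! i = 0" "?m ! j = l ! i + l ! j" using l ne by simp_all
  then have exm1: "ex ?m i = 0" "ex ?m j = l ! i + l ! j" using l by (simp_all add: ex_def)
  have exm2: "ex ?m i' = - 0" "ex ?m j' = - (l ! i + l ! j)"
    unfolding i'_def j'_def ex_opp[OF N(1)] ex_opp[OF N(2)] exm1 by (rule refl)+
  have exm: "p powi (ex ?m i) = 1" "p powi (ex ?m j) = A * B" "p powi (ex ?m i') = 1"
    "p powi (ex ?m j') = inverse (A * B)"
    unfolding exm1 exm2 power_int_minus A_def B_def p_powi_add by simp_all
  have exo: "ex ?m a = ex l a" if a: "a < N" "a \<notin> {i, j, i', j'}" for a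
    using a opp_other[OF a] l by (auto simp: ex_def nth_list_update)
  show ?thesis
  proof (rule frame_equivalence[OF dg_carrier frame])
    fix a c assume ac: "a < N" "c < N"
    show "form (dg l) (b a) (b c) = (if a = c then p powi ex ?m a else 0)"
    proof (cases "a \<in> {i, j, i', j'}")
      case a: True
      show ?thesis
      proof (cases "c \<in> {i, j, i', j'}")
        case True
        show ?thesis
          using a True unfolding gram[OF ac]
          by (elim insertE emptyE; simp only: vals dg_index N ne if_True if_False refl simps exl exm)
             (use norm AB(1,2) in \<open>simp_all add: field_simps norm2\<close>)
      next
        case False
        have "f a \<in> {i, i'}" "h a \<in> {j, j'}" using a vals by auto
        then have "c \<noteq> f a" "c \<noteq> h a" "c \<noteq> a" using False a by auto
        then show ?thesis
          unfolding gram[OF ac] other[OF False] using dg_index[OF lt(1)[OF ac(1)] ac(2)] dg_index[OF lt(2)[OF ac(1)] ac(2)]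
          by simp
      qed
    next
      case a: False
      show ?thesis
      proof (cases "c \<in> {i, j, i', j'}")
        case True
        then have "f c \<in> {i, j, i', j'}" "h c \<in> {i, j, i', j'}" by (auto simp: f_def h_def)
        then have "a \<noteq> f c" "a \<noteq> h c" "a \<noteq> c" using a True by metis+
        then show ?thesis
          unfolding gram[OF ac] other[OF a] dg_index[OF ac(1) lt(1)[OF ac(2)]] dg_index[OF ac(1) lt(2)[OF ac(2)]]
          by simp
      next
        case False
        show ?thesis
          unfolding gram[OF ac] other[OF a] other[OF False] dg_index[OF ac] exo[OF ac(1) a] by simp
      qed
    qed
  qed
qed


section \<open>The block matrices with parameters lambda and mu\<close>

lemma x_block_index:
  assumes len: "length l + length mu = n" and ij: "i < N" "j < N"
  defines "r \<equiv> length l"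
  defines "L \<equiv> l @ rev mu"
  shows "x_block p s l mu $$ (i, j) =
    (if i = j then (if r \<le> i \<and> i < n then p powi (- ex L i) * (1 - s\<^sup>2)
       else if n \<le> i \<and> i < N - r then p powi (- ex L i) else p powi (ex L i))
     else if j = opp i \<and> r \<le> i \<and> i < N - r then (if i < n then - s else s) else 0)"
proof -
  let ?m = "length mu"
  let ?A = "Diag (map (\<lambda>i. p powi i) l)" and ?B = "E_mat p s mu" and ?C = "Diag (rev (map (\<lambda>i. p powi (- i)) l))"
  have dims: "dim_row ?A = r" "dim_col ?A = r" "dim_row ?B = 2 * ?m" "dim_col ?B = 2 * ?m" "dim_row ?C = r" "dim_col ?C = r"
    by (simp_all add: Diag_def mat_diag_def E_mat_def Let_def r_def)
  have n: "n = r + ?m" using len by (simp add: r_def)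
  have L1: "L ! q = l ! q" if "q < r" for q using that by (simp add: L_def r_def nth_append)
  \<comment> \<open>\<open>E_mat\<close> lists \<open>mu\<close> outwards from the centre, so the
    upper half read downwards is \<open>rev mu\<close>. Its diagonal there carries the exponents of
    \<open>mu\<close> negated, hence the minus sign before \<open>ex L\<close> in the middle block;
    \<open>x_block_equivalence\<close> reverses it.\<close>
  have L2: "L ! q = mu ! (?m - Suc (q - r))" if "r \<le> q" "q < n" for q
    using that len by (simp add: L_def r_def nth_append rev_nth)
  have block: "x_block p s l mu $$ (i, j) = (if i < r then (if j < r then ?A $$ (i, j) else 0)
      else if i < r + 2 * ?m then (if r \<le> j \<and> j < r + 2 * ?m then ?B $$ (i - r, j - r) else 0)
      else (if r + 2 * ?m \<le> j then ?C $$ (i - r - 2 * ?m, j - r - 2 * ?m) else 0))"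
    using ij n unfolding x_block_def by (auto simp: Let_def dims)
  have E: "?B $$ (a, b) = (if a = b then (if a < ?m then p powi (- (mu ! (?m - Suc a))) * (1 - s\<^sup>2) else p powi (mu ! (a - ?m)))
      else if a + b + 1 = 2 * ?m then (if a < ?m then - s else s) else 0)" if "a < 2 * ?m" "b < 2 * ?m" for a b
    using that by (simp add: E_mat_def Let_def)
  have middle: "x_block p s l mu $$ (i, j) = (if i = j then
        (if i < n then p powi (- (mu ! (?m - Suc (i - r)))) * (1 - s\<^sup>2) else p powi (mu ! (i - r - ?m)))
      else if j = opp i then (if i < n then - s else s) else 0)" if i: "r \<le> i" "i < N - r"
  proof -
    have reg: "\<not> i < r" "i < r + 2 * ?m" using i n by linarith+
    have lt: "i - r < 2 * ?m" "i - r < ?m \<longleftrightarrow> i < n" using i n by linarith+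
    consider "j = i" | "j = opp i" "j \<noteq> i" | "j \<noteq> i" "j \<noteq> opp i" by blast
    then show ?thesis
    proof cases
      case 1
      show ?thesis using reg lt unfolding block unfolding 1 unfolding E[OF lt(1) lt(1)] by simp
    next
      case 2
      have o: "r \<le> j" "j < r + 2 * ?m" "i - r + (j - r) + 1 = 2 * ?m" "i - r \<noteq> j - r" "j - r < 2 * ?m"
        using i n 2 by linarith+
      show ?thesis using reg lt o 2 unfolding block E[OF lt(1) o(5)] by simp
    next
      case 3
      show ?thesis
      proof (cases "r \<le> j \<and> j < r + 2 * ?m")
        case True
        then have o: "i - r + (j - r) + 1 \<noteq> 2 * ?m" "i - r \<noteq> j - r" "j - r < 2 * ?m"
          using i n 3 by linarith+
        show ?thesis using reg lt o 3 True unfolding block E[OF lt(1) o(3)] by simp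
      next
        case False
        then show ?thesis using reg 3 unfolding block by auto
      qed
    qed
  qed
  consider "i < r" | "r \<le> i" "i < n" | "n \<le> i" "i < N - r" | "N - r \<le> i" by linarith
  then show ?thesis
  proof cases
    case 1
    have "i < n" using 1 n by linarith
    then have e: "ex L i = l ! i" using 1 by (simp add: ex_def L1)
    show ?thesis unfolding block e using 1 n ij
      by (auto simp: Diag_def mat_diag_def r_def)
  next
    case 2
    have e: "ex L i = mu ! (?m - Suc (i - r))"
      using 2 by (simp add: ex_def L2)
    have "r \<le> i" "i < N - r" using 2 n by linarith+
    then show ?thesis unfolding middle[OF \<open>r \<le> i\<close> \<open>i < N - r\<close>] e using 2 by simp
  next
    case 3
    have "opp i < n" "\<not> i < n" "r \<le> opp i" "opp i - r < ?m" using 3 n by linarith+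
    moreover have "?m - Suc (opp i - r) = i - r - ?m" using 3 n by linarith
    ultimately have e: "ex L i = - (mu ! (i - r - ?m))"
      by (simp add: ex_def L2)
    have "r \<le> i" using 3 n by linarith
    then show ?thesis unfolding middle[OF \<open>r \<le> i\<close> 3(2)] e using 3 by simp
  next
    case 4
    have "opp i < r" "\<not> i < n" using 4 n ij by auto
    then have e: "ex L i = - (l ! opp i)"
      by (simp add: ex_def L1)
    have "r - Suc (i - r - 2 * ?m) = opp i" "i - r - 2 * ?m < r" using 4 n ij by auto
    then have "rev (map (\<lambda>i. p powi (- i)) l) ! (i - r - 2 * ?m) = p powi (ex L i)"
      unfolding e by (simp add: rev_nth r_def)
    moreover have reg: "\<not> i < r" "\<not> i < r + 2 * ?m" using 4 n by auto
    moreover have "i - r - 2 * ?m < r" using 4 n ij by auto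
    moreover have "i = j \<longleftrightarrow> r + 2 * ?m \<le> j \<and> i - r - 2 * ?m = j - r - 2 * ?m" using 4 n ij by auto
    ultimately show ?thesis using 4 n ij unfolding block
      by (auto simp: Diag_def mat_diag_def r_def)
  qed
qed

lemma x_block_carrier: "length l + length mu = n \<Longrightarrow> x_block p s l mu \<in> carrier_mat N N"
proof (rule carrier_matI)
  assume len: "length l + length mu = n"
  have "dim_row (x_block p s l mu) = length l + (2 * length mu + length l)"
    "dim_col (x_block p s l mu) = length l + (2 * length mu + length l)"
    by (simp_all add: x_block_def Let_def Diag_def mat_diag_def E_mat_def)
  then show "dim_row (x_block p s l mu) = N" "dim_col (x_block p s l mu) = N" using len by linarith+
qed

text \<open>In the basis \<open>(p ^ mu * e - s * e', p ^ (- mu) * e')\<close> of a hyperbolic plane the block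
  \<open>E_mat\<close> becomes \<open>diag (p ^ mu, p ^ (- mu))\<close>.\<close>

lemma x_block_equivalence:
  assumes len: "length l + length mu = n"
  shows "\<exists>g\<in>GR UNIV. ct g * x_block p s l mu * g = dg (l @ rev mu)"
proof -
  let ?L = "l @ rev mu" and ?r = "length l"
  let ?X = "x_block p s l mu"
  define P where "P q = (if ?r \<le> q \<and> q < N - ?r then p powi (ex ?L q) else 1)" for q
  have cP: "cj (P q) = P q" for q by (simp add: P_def)
  define T where "T q = (if ?r \<le> q \<and> q < n then - s else 0)" for q
  define b where "b q = axpy (single q (P q)) (T q) (single (opp q) 1)" for q
  have gram: "form M (b i) (b j) = P i * M $$ (i, j) * P j + T j * (P i * M $$ (i, opp j))
      + cj (T i) * (M $$ (opp i, j) * P j) + cj (T i) * T j * M $$ (opp i, opp j)" if "i < N" "j < N" for M i j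
    unfolding b_def form_axpy form_single[OF that] form_single[OF that(1) opp_lt[OF that(2)]]
      form_single[OF opp_lt[OF that(1)] that(2)] form_single[OF opp_lt[OF that(1)] opp_lt[OF that(2)]] cP
    by (simp add: algebra_simps)
  have Jij: "J $$ (i, j) = (if j = opp i then 1 else 0)" if "i < N" "j < N" for i j
    using that J_eq_0[OF that] J_eq_1[OF that] by (simp del: J_index)
  have ranges: "?r \<le> opp i \<and> opp i < N - ?r \<longleftrightarrow> ?r \<le> i \<and> i < N - ?r" if "i < N" for i
    using that len by auto
  have PP: "P i * P (opp i) = 1" if "i < N" for i
    unfolding P_def ranges[OF that] ex_opp[OF that] by (simp add: p_powi_add)
  have TT: "T i * T (opp i) = 0" "T (opp i) * T i = 0" if "i < N" for i
    using that by (auto simp: T_def)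
  have cT: "cj (T i) = - T i" for i by (simp add: T_def)
  show ?thesis
  proof (rule frame_equivalence[OF x_block_carrier[OF len]])
    show "frame b"
      unfolding frame_def
    proof (intro allI impI)
      fix i j assume ij: "i < N" "j < N"
      have iff: "i + j + 1 = N \<longleftrightarrow> j = opp i" using ij by auto
      define i' where "i' = opp i"
      have i': "i' < N" "opp i' = i" "i' \<noteq> i" using ij by (auto simp: i'_def)
      have PP': "P i * P i' = 1" "T i * T i' = 0" using PP[OF ij(1)] TT[OF ij(1)] by (simp_all add: i'_def)
      consider "j = i" | "j = i'" | "j \<noteq> i" "j \<noteq> i'" by blast
      then show "form J (b i) (b j) = (if i + j + 1 = N then 1 else 0)"
        unfolding iff i'_def[symmetric]
      proof cases
        case 1
        show "form J (b i) (b j) = (if j = i' then 1 else 0)"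
          unfolding 1 gram[OF ij(1) ij(1)] i'_def[symmetric] Jij[OF ij(1) ij(1)] Jij[OF ij(1) i'(1)]
            Jij[OF i'(1) ij(1)] Jij[OF i'(1) i'(1)] i'(2) cT using i'(3) by (simp add: i'_def[symmetric])
      next
        case 2
        show "form J (b i) (b j) = (if j = i' then 1 else 0)"
          unfolding 2 gram[OF ij(1) i'(1)] i'(2) i'_def[symmetric] Jij[OF ij(1) ij(1)] Jij[OF ij(1) i'(1)]
            Jij[OF i'(1) ij(1)] Jij[OF i'(1) i'(1)] cT using i'(3) PP' by (simp add: i'_def[symmetric])
      next
        case 3
        have "opp j \<noteq> i" "opp j \<noteq> i'" using 3 ij by (auto simp: i'_def)
        then show "form J (b i) (b j) = (if j = i' then 1 else 0)"
          unfolding gram[OF ij] i'_def[symmetric] Jij[OF ij(1) ij(2)] Jij[OF ij(1) opp_lt[OF ij(2)]]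
            Jij[OF i'(1) ij(2)] Jij[OF i'(1) opp_lt[OF ij(2)]] i'(2) using 3 by (simp add: i'_def[symmetric])
      qed
    qed
    fix i j assume ij: "i < N" "j < N"
    define i' where "i' = opp i"
    have i': "i' < N" "opp i' = i" "i' \<noteq> i" using ij by (auto simp: i'_def)
    have e': "ex ?L i' = - ex ?L i" unfolding i'_def by (rule ex_opp[OF ij(1)])
    have X0: "?X $$ (a, c) = 0" if "a < N" "c < N" "c \<noteq> a" "c \<noteq> opp a" for a c
      using x_block_index[OF len that(1,2)] that by simp
    have inv: "p powi (- a) * p powi a = 1" "p powi a * p powi (- a) = 1" for a
      by (simp_all add: p_powi_add)
    consider "j \<noteq> i" "j \<noteq> i'" | "i < ?r \<or> N - ?r \<le> i" "j = i \<or> j = i'" | "?r \<le> i" "i < n" "j = i \<or> j = i'"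
      | "n \<le> i" "i < N - ?r" "j = i \<or> j = i'" using linorder_not_le by blast
    then show "form ?X (b i) (b j) = (if i = j then p powi (ex ?L i) else 0)"
    proof cases
      case 1
      have "opp j \<noteq> i" "opp j \<noteq> i'" "i \<noteq> j" using 1 ij by (auto simp: i'_def)
      then have "?X $$ (i, j) = 0" "?X $$ (i, opp j) = 0" "?X $$ (i', j) = 0" "?X $$ (i', opp j) = 0"
        using 1 i' ij by (auto intro!: X0 simp: i'_def[symmetric])
      then show ?thesis using \<open>i \<noteq> j\<close> unfolding gram[OF ij] i'_def[symmetric] by simp
    next
      case 2
      have r': "i' < ?r \<or> N - ?r \<le> i'" using 2 ij len by (auto simp: i'_def)
      have "P i = 1" "P i' = 1" "T i = 0" "T i' = 0" using 2(1) r' len by (auto simp: P_def T_def)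
      moreover have "?X $$ (i, i) = p powi (ex ?L i)" "?X $$ (i, i') = 0"
        using x_block_index[OF len ij(1) ij(1)] x_block_index[OF len ij(1) i'(1)] 2(1) i'(3) len by auto
      ultimately show ?thesis using 2(2) i' unfolding gram[OF ij] by auto
    next
      case 3
      have r': "n \<le> i'" "i' < N - ?r" using 3 ij len by (auto simp: i'_def)
      have PT: "P i = p powi (ex ?L i)" "P i' = p powi (- ex ?L i)" "T i = - s" "T i' = 0"
        using 3 r' len by (auto simp: P_def T_def e')
      have X: "?X $$ (i, i) = p powi (- ex ?L i) * (1 - s\<^sup>2)" "?X $$ (i, i') = - s" "?X $$ (i', i) = s"
        "?X $$ (i', i') = p powi (ex ?L i)"
        using x_block_index[OF len ij(1) ij(1)] x_block_index[OF len ij(1) i'(1)]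
          x_block_index[OF len i'(1) ij(1)] x_block_index[OF len i'(1) i'(1)] 3 r' i' len
        by (auto simp: e' i'_def[symmetric])
      from 3(3) show ?thesis
      proof
        assume j: "j = i"
        have "form ?X (b i) (b i) = p powi (ex ?L i) * (p powi (- ex ?L i) * p powi (ex ?L i)) * (1 - s\<^sup>2)
            + s * s * p powi (ex ?L i)"
          unfolding gram[OF ij(1) ij(1)] i'_def[symmetric] X PT by (simp add: algebra_simps)
        also have "\<dots> = p powi (ex ?L i)" unfolding inv by (simp add: algebra_simps power2_eq_square)
        finally show ?thesis using j by simp
      next
        assume j: "j = i'"
        have "form ?X (b i) (b i') = - s * (p powi (ex ?L i) * p powi (- ex ?L i))
            + s * (p powi (ex ?L i) * p powi (- ex ?L i))"
          unfolding gram[OF ij(1) i'(1)] i'(2) i'_def[symmetric] X PT by (simp add: algebra_simps)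
        then show ?thesis using j i' by simp
      qed
    next
      case 4
      have r': "?r \<le> i'" "i' < n" using 4 ij len by (auto simp: i'_def)
      have PT: "P i = p powi (ex ?L i)" "P i' = p powi (- ex ?L i)" "T i = 0" "T i' = - s"
        using 4 r' len by (auto simp: P_def T_def e')
      have X: "?X $$ (i, i) = p powi (- ex ?L i)" "?X $$ (i, i') = s"
        using x_block_index[OF len ij(1) ij(1)] x_block_index[OF len ij(1) i'(1)] 4 i' len
        by (auto simp: i'_def[symmetric])
      from 4(3) show ?thesis
      proof
        assume j: "j = i"
        have "form ?X (b i) (b i) = p powi (ex ?L i) * (p powi (- ex ?L i) * p powi (ex ?L i))"
          unfolding gram[OF ij(1) ij(1)] i'_def[symmetric] X PT by (simp add: algebra_simps)
        then show ?thesis using j unfolding inv by simp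
      next
        assume j: "j = i'"
        have "form ?X (b i) (b i') = s * (p powi (ex ?L i) * p powi (- ex ?L i))
            - s * (p powi (ex ?L i) * p powi (- ex ?L i))"
          unfolding gram[OF ij(1) i'(1)] i'(2) i'_def[symmetric] X PT by (simp add: algebra_simps)
        then show ?thesis using j i' by simp
      qed
    qed
  qed
qed


section \<open>Separation of the integral orbits\<close>

lemma vge_sum: "(\<And>i. i \<in> A \<Longrightarrow> vge m (f i)) \<Longrightarrow> vge m (sum f A)"
  by (induction A rule: infinite_finite_induct) (auto intro: vge_add)

lemma vge_prod: "(\<And>i. i \<in> A \<Longrightarrow> vge 0 (f i)) \<Longrightarrow> vge 0 (prod f A)"
  by (induction A rule: infinite_finite_induct) (auto intro: vge_mult0)

text \<open>The block has N - r rows and r + 1 columns, together more than N, so every permutation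
  meets it, as in the easy direction of the Frobenius-Koenig theorem. Each term of the Leibniz
  formula thus has a factor in the maximal ideal.\<close>

lemma det_nonunit_block:
  assumes g: "g \<in> carrier_mat N N" "\<And>i j. i < N \<Longrightarrow> j < N \<Longrightarrow> vge 0 (g $$ (i, j))"
    and r: "r < N" and block: "\<And>i j. r \<le> i \<Longrightarrow> i < N \<Longrightarrow> j \<le> r \<Longrightarrow> vge 1 (g $$ (i, j))"
  shows "vge 1 (det g)"
  unfolding det_def'[OF g(1)]
proof (rule vge_sum)
  fix \<pi> assume "\<pi> \<in> {\<pi>. \<pi> permutes {0..<N}}"
  then have \<pi>: "\<pi> permutes {0..<N}" by simp
  have \<pi>_lt: "\<pi> i < N" if "i < N" for i using permutes_in_image[OF \<pi>, of i] that by simp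
  have "\<exists>i. r \<le> i \<and> i < N \<and> \<pi> i \<le> r"
  proof (rule ccontr)
    assume "\<not> ?thesis"
    then have "\<pi> ` {r..<N} \<subseteq> {Suc r..<N}" using \<pi>_lt by (auto simp: Suc_le_eq not_le)
    moreover have "inj_on \<pi> {r..<N}" using permutes_inj[OF \<pi>] by (rule inj_on_subset) simp
    ultimately have "card {r..<N} \<le> card {Suc r..<N}" by (intro card_inj_on_le) auto
    then show False using r by simp
  qed
  then obtain i where i: "r \<le> i" "i < N" "\<pi> i \<le> r" by blast
  have "(\<Prod>j = 0..<N. g $$ (j, \<pi> j)) = g $$ (i, \<pi> i) * (\<Prod>j \<in> {0..<N} - {i}. g $$ (j, \<pi> j))"
    using i by (intro prod.remove) auto
  moreover have "vge 1 (g $$ (i, \<pi> i) * (\<Prod>j \<in> {0..<N} - {i}. g $$ (j, \<pi> j)))"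
    using g(2) \<pi>_lt by (intro vge_mult0(1) block i vge_prod) auto
  moreover have "signof \<pi> = (1 :: 'a) \<or> signof \<pi> = (- 1 :: 'a)" by (simp add: sign_def)
  then have "vge 0 (signof \<pi> :: 'a)" by (metis vge_0_1 vge_minus_iff)
  ultimately show "vge 1 (signof \<pi> * (\<Prod>j = 0..<N. g $$ (j, \<pi> j)))"
    by (intro vge_mult0(2)) simp_all
qed

text \<open>If \<open>l ! r < m ! r\<close>, then \<open>ex l i < ex m j\<close> whenever
  \<open>r \<le> i\<close> and \<open>j \<le> r\<close>. By \<open>dg_equivalence_entry\<close> the
  entries of \<open>g\<close> in this block are then non-units, and so is \<open>det g\<close>,
  although its norm is 1.\<close>

lemma exponents_le:
  assumes g: "g \<in> GR {x. vge 0 x}" "ct g * dg l * g = dg m"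
    and l: "l \<in> Lambda_plus n" and m: "m \<in> Lambda_plus n" and r: "r < n"
  shows "m ! r \<le> l ! r"
proof (rule ccontr)
  assume "\<not> m ! r \<le> l ! r"
  then have lt: "l ! r < m ! r" by simp
  have c: "g \<in> carrier_mat N N" "ct g * J * g = J" and gO: "\<And>i j. i < N \<Longrightarrow> j < N \<Longrightarrow> vge 0 (g $$ (i, j))"
    using g(1) by (auto simp: GR_def)
  have L: "length l = n" "sorted_wrt (\<ge>) l" "\<And>i. i < n \<Longrightarrow> 0 \<le> l ! i"
    and M: "length m = n" "sorted_wrt (\<ge>) m"
    using l m by (auto simp: Lambda_plus_def)
  have "vge 1 (det g)"
  proof (rule det_nonunit_block[OF c(1) gO])
    show "r < N" using r by simp
    fix i j assume ij: "r \<le> i" "i < N" "j \<le> r"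
    have "ex l i \<le> l ! r"
    proof (cases "i < n")
      case True
      then show ?thesis
        using sorted_wrt_nth_less[OF L(2), of r i] ij L(1) by (cases "r = i") (auto simp: ex_def)
    next
      case False
      then have "opp i < n" using ij by linarith
      then show ?thesis using L(3)[of "opp i"] L(3)[OF r] False by (simp add: ex_def)
    qed
    moreover have "m ! r \<le> ex m j"
      using sorted_wrt_nth_less[OF M(2), of j r] ij r M(1) by (cases "r = j") (auto simp: ex_def)
    ultimately have e: "1 \<le> ex m j - ex l i" using lt by linarith
    have j: "j < N" using ij r by simp
    have "g $$ (i, j) = p powi (- ex l i) * (p powi (ex l i) * g $$ (i, j))"
      by (simp add: mult.assoc[symmetric] p_powi_add)
    also have "\<dots> = p powi (ex m j - ex l i) * g $$ (opp i, opp j)"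
      unfolding dg_equivalence_entry[OF g ij(2) j] by (simp add: mult.assoc[symmetric] p_powi_add)
    finally have "g $$ (i, j) = p powi (ex m j - ex l i) * g $$ (opp i, opp j)" .
    moreover have "vge 1 (p powi (ex m j - ex l i))" using e by (simp add: vge_def)
    ultimately show "vge 1 (g $$ (i, j))"
      using vge_mult0(1)[OF _ gO[OF opp_lt[OF ij(2)] opp_lt[OF j]]] by simp
  qed
  moreover have "cj (det g) * det g = 1"
  proof -
    have "det J * det J = 1" using arg_cong[OF J_J, of det] det_mult[OF J_carrier J_carrier] by simp
    then have dJ: "det J \<noteq> 0" by auto
    have cJ: "ct g * J \<in> carrier_mat N N" using c(1) by (intro mult_carrier_mat[of _ N N]) simp_all
    have "det J = det (ct g * J * g)" unfolding c(2) ..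
    also have "\<dots> = cj (det g) * det J * det g"
      unfolding det_mult[OF cJ c(1)] det_mult[OF ct_carrier[OF c(1)] J_carrier] det_ct[OF c(1)] ..
    finally have "cj (det g) * det J * det g = det J" ..
    moreover have "cj (det g) * det J * det g = det J * (cj (det g) * det g)" by (simp add: ac_simps)
    ultimately show ?thesis using dJ by (metis mult_cancel_left1)
  qed
  ultimately have "vge 1 1"
    using vge_mult0(2)[of "cj (det g)" 1 "det g"] vge_cj vge_mono[of 1 "det g" 0] by simp
  then show False by simp
qed

section \<open>The two orbits over the field\<close>

abbreviation orbU :: "'a mat \<Rightarrow> 'a mat set" where "orbU \<equiv> herm_orbit k s (GR UNIV)"

text \<open>Successive merging collects all exponents in position 0; a final shift by an even number
  leaves their sum modulo 2.\<close>

lemma dg_collect: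
  assumes n: "n \<ge> 1" and l: "length l = n"
  shows "dg (sum_list l mod 2 # replicate (n - 1) 0) \<in> orbU (dg l)"
proof -
  interpret U: conj_valuation_ring k v w p s n UNIV by (rule UNIV_ring)
  have "\<exists>m. length m = n \<and> dg m \<in> orbU (dg l) \<and> sum_list m = sum_list l \<and> (\<forall>i. 1 \<le> i \<longrightarrow> i < q \<longrightarrow> m ! i = 0)"
    if "q \<le> n" for q
    using that
  proof (induction q)
    case 0
    show ?case using l U.orb_refl[of "dg l"] by (intro exI[of _ l]) simp
  next
    case (Suc q)
    then obtain m where m: "length m = n" "dg m \<in> orbU (dg l)" "sum_list m = sum_list l"
      "\<forall>i. 1 \<le> i \<longrightarrow> i < q \<longrightarrow> m ! i = 0" by auto
    show ?case
    proof (cases "q = 0")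
      case True
      then show ?thesis using m by (intro exI[of _ m]) auto
    next
      case False
      let ?m = "m[q := 0, 0 := m ! q + m ! 0]"
      have q: "q < n" "0 < n" "q \<noteq> 0" using Suc.prems False n by auto
      have "dg ?m \<in> orbU (dg m)"
        unfolding U.mem_orb_iff by (rule merge_exponents[OF m(1) q])
      then have "dg ?m \<in> orbU (dg l)" by (rule U.orb_trans[OF dg_carrier m(2)])
      moreover have "sum_list ?m = sum_list l"
        using m(1,3) q by (simp add: sum_list_update_int)
      moreover have "\<forall>i. 1 \<le> i \<longrightarrow> i < Suc q \<longrightarrow> ?m ! i = 0"
        using m(1,4) q by (auto simp: nth_list_update less_Suc_eq)
      ultimately show ?thesis using m(1) by (intro exI[of _ ?m]) simp
    qed
  qed
  from this[OF order_refl] obtain m where m: "length m = n" "dg m \<in> orbU (dg l)" "sum_list m = sum_list l"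
    "\<forall>i. 1 \<le> i \<longrightarrow> i < n \<longrightarrow> m ! i = 0" by blast
  have m_eq: "m = m ! 0 # replicate (n - 1) 0"
    using m(1,4) n by (intro nth_equalityI) (auto simp: nth_Cons')
  have sum: "m ! 0 = sum_list l"
    using m(3) arg_cong[OF m_eq, of sum_list] by (simp add: sum_list_replicate)
  let ?c = "- (sum_list l div 2)"
  have e: "m ! 0 + 2 * ?c = sum_list l mod 2" unfolding sum by (simp add: minus_mult_div_eq_mod)
  have "m[0 := x] = x # replicate (n - 1) 0" for x
    by (subst m_eq) simp
  then have "m[0 := m ! 0 + 2 * ?c] = sum_list l mod 2 # replicate (n - 1) 0" unfolding e .
  moreover have "dg (m[0 := m ! 0 + 2 * ?c]) \<in> orbU (dg m)"
    unfolding U.mem_orb_iff using n by (intro scale_exponent[OF m(1)]) simp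
  ultimately show ?thesis using U.orb_trans[OF dg_carrier m(2)] by simp
qed

lemma dg_classification:
  assumes n: "n \<ge> 1" and l: "length l = n"
  shows "dg l \<in> orbU (dg (replicate n 0)) \<longleftrightarrow> even (sum_list l)"
    and "dg l \<in> orbU (dg (1 # replicate (n - 1) 0)) \<longleftrightarrow> odd (sum_list l)"
proof -
  interpret U: conj_valuation_ring k v w p s n UNIV by (rule UNIV_ring)
  have parity: "even (sum_list a) \<longleftrightarrow> even (sum_list b)"
    if ab: "dg b \<in> orbU (dg a)" "length a = n" "length b = n" for a b
  proof -
    obtain g where "g \<in> GR UNIV" "ct g * dg a * g = dg b" using ab(1) unfolding U.mem_orb_iff by blast
    then show ?thesis by (rule orbit_parity[OF _ _ ab(2,3)])
  qed
  have rep: "replicate n 0 = (0::int) # replicate (n - 1) 0" using n by (cases n) auto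
  have normal: "dg l \<in> orbU (dg (sum_list l mod 2 # replicate (n - 1) 0))"
    by (rule U.orb_sym[OF dg_carrier dg_collect[OF n l]])
  show "dg l \<in> orbU (dg (replicate n 0)) \<longleftrightarrow> even (sum_list l)"
  proof
    assume "dg l \<in> orbU (dg (replicate n 0))"
    from parity[OF this] show "even (sum_list l)" using l by (simp add: sum_list_replicate)
  next
    assume "even (sum_list l)"
    then have "sum_list l mod 2 = 0" by presburger
    then show "dg l \<in> orbU (dg (replicate n 0))" using normal rep by simp
  qed
  show "dg l \<in> orbU (dg (1 # replicate (n - 1) 0)) \<longleftrightarrow> odd (sum_list l)"
  proof
    assume "dg l \<in> orbU (dg (1 # replicate (n - 1) 0))"
    from parity[OF this] show "odd (sum_list l)" using l n by (simp add: sum_list_replicate)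
  next
    assume "odd (sum_list l)"
    then have "sum_list l mod 2 = 1" by presburger
    then show "dg l \<in> orbU (dg (1 # replicate (n - 1) 0))" using normal by simp
  qed
qed

lemma two_orbits:
  assumes n: "n \<ge> 1"
  defines "a \<equiv> dg (replicate n 0)" and "b \<equiv> dg (1 # replicate (n - 1) 0)"
  shows "herm_space k s n = orbU a \<union> orbU b" "orbU a \<inter> orbU b = {}" "card (orbU ` herm_space k s n) = 2"
proof -
  interpret U: conj_valuation_ring k v w p s n UNIV by (rule UNIV_ring)
  have c: "a \<in> carrier_mat N N" "b \<in> carrier_mat N N" by (simp_all add: a_def b_def)
  show eq: "herm_space k s n = orbU a \<union> orbU b"
  proof
    show "herm_space k s n \<subseteq> orbU a \<union> orbU b"
    proof
      fix x assume "x \<in> herm_space k s n"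
      then have x: "isX x" "char_poly (x * J) = ([:0, 1:]\<^sup>2 - 1) ^ n" by (auto simp: herm_space_eq)
      then have xc: "x \<in> carrier_mat N N" by (simp add: isX_def)
      obtain l where l: "length l = n" "dg l \<in> orbU x" by (rule U.herm_to_powers[OF x]) auto
      have xl: "x \<in> orbU (dg l)" by (rule U.orb_sym[OF xc l(2)])
      have "dg l \<in> orbU a \<or> dg l \<in> orbU b"
        unfolding a_def b_def dg_classification[OF n l(1)] by blast
      then show "x \<in> orbU a \<union> orbU b" using U.orb_trans[OF c(1) _ xl] U.orb_trans[OF c(2) _ xl] by blast
    qed
    show "orbU a \<union> orbU b \<subseteq> herm_space k s n"
    proof
      fix z assume "z \<in> orbU a \<union> orbU b"
      then obtain e where e: "z \<in> orbU (dg e)" unfolding a_def b_def by blast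
      show "z \<in> herm_space k s n"
        using U.isX_orb[OF isX_dg e] U.char_poly_orb[OF dg_carrier e] U.char_poly_dg[of e]
        unfolding herm_space_eq by simp
    qed
  qed
  show disj: "orbU a \<inter> orbU b = {}"
  proof (rule ccontr)
    assume "orbU a \<inter> orbU b \<noteq> {}"
    then obtain z where "z \<in> orbU a" "z \<in> orbU b" by blast
    then have "b \<in> orbU a" using U.orb_eq[OF c(1)] U.orb_eq[OF c(2)] U.orb_refl[OF c(2)] by metis
    moreover have "length ((1::int) # replicate (n - 1) 0) = n" using n by simp
    ultimately show False
      unfolding a_def b_def using dg_classification(1)[OF n, of "1 # replicate (n - 1) 0"] by (simp add: sum_list_replicate)
  qed
  have "orbU ` orbU a \<subseteq> {orbU a}" "orbU ` orbU b \<subseteq> {orbU b}"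
    by (intro image_subsetI, drule U.orb_eq[OF c(1)], erule ssubst, rule singletonI,
      intro image_subsetI, drule U.orb_eq[OF c(2)], erule ssubst, rule singletonI)
  moreover have "orbU a \<in> orbU ` orbU a" "orbU b \<in> orbU ` orbU b"
    by (rule imageI[OF U.orb_refl[OF c(1)]], rule imageI[OF U.orb_refl[OF c(2)]])
  ultimately have "orbU ` (orbU a \<union> orbU b) = {orbU a, orbU b}" unfolding image_Un by blast
  moreover have "orbU a \<noteq> orbU b" using disj U.orb_refl[OF c(1)] by blast
  ultimately show "card (orbU ` herm_space k s n) = 2" unfolding eq by simp
qed

lemma integral_orbits:
  assumes n: "n \<ge> 1" and two: "w 2 = 0"
  defines "orbO \<equiv> herm_orbit k s (GR {x. vge 0 x})"
  shows "x \<in> herm_space k s n \<Longrightarrow> \<exists>l\<in>Lambda_plus n. x \<in> orbO (dg l)"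
    and "l \<in> Lambda_plus n \<Longrightarrow> m \<in> Lambda_plus n \<Longrightarrow> orbO (dg l) \<inter> orbO (dg m) \<noteq> {} \<Longrightarrow> l = m"
    and "orbO y \<subseteq> orbU y"
proof -
  interpret V: conj_valuation_ring k v w p s n "{x. vge 0 x}" by (rule integer_ring_ring[OF two])
  show "\<exists>l\<in>Lambda_plus n. x \<in> orbO (dg l)" if "x \<in> herm_space k s n"
  proof -
    have x: "isX x" "char_poly (x * J) = ([:0, 1:]\<^sup>2 - 1) ^ n" using that by (auto simp: herm_space_eq)
    obtain l where l: "l \<in> Lambda_plus n" "dg l \<in> orbO x"
      unfolding orbO_def by (rule V.herm_to_powers[OF x]) (auto simp: vge_def)
    have "x \<in> orbO (dg l)"
      using V.orb_sym l(2) x(1) unfolding orbO_def isX_def by blast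
    then show ?thesis using l(1) by blast
  qed
  show "orbO y \<subseteq> orbU y" unfolding orbO_def herm_orbit_def using GR_mono[of _ "{x. vge 0 x}" UNIV] by blast
  assume lm: "l \<in> Lambda_plus n" "m \<in> Lambda_plus n" "orbO (dg l) \<inter> orbO (dg m) \<noteq> {}"
  then obtain z where "z \<in> orbO (dg l)" "z \<in> orbO (dg m)" by blast
  then have "orbO (dg l) = orbO (dg m)"
    unfolding orbO_def using V.orb_eq[OF dg_carrier] by metis
  then have "dg m \<in> orbO (dg l)" "dg l \<in> orbO (dg m)"
    unfolding orbO_def using V.orb_refl[OF dg_carrier] by metis+
  then obtain g h where "g \<in> GR {x. vge 0 x}" "ct g * dg l * g = dg m" "h \<in> GR {x. vge 0 x}" "ct h * dg m * h = dg l"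
    unfolding orbO_def V.mem_orb_iff by blast
  \<comment> \<open>A common point gives integral transition matrices in both directions, hence both
    inequalities.\<close>
  then have "m ! r \<le> l ! r \<and> l ! r \<le> m ! r" if "r < n" for r
    using exponents_le[OF _ _ lm(1,2) that] exponents_le[OF _ _ lm(2,1) that] by blast
  then show "l = m"
    using lm by (intro nth_equalityI) (auto simp: Lambda_plus_def intro: antisym)
qed

end

theorem theorem1p9:
  fixes k :: "'a::field_char_0 set" and v w :: "'a \<Rightarrow> int" and p s :: 'a and n :: nat
  defines "G \<equiv> unitary_grp k s n"
    and "X \<equiv> herm_space k s n"
    and "K \<equiv> integral_unitary_grp k w s n"
    and "orb \<equiv> herm_orbit k s"
    and "x0 \<equiv> 1\<^sub>m (2 * n)"
    and "x1 \<equiv> Diag (p # replicate (2 * n - 2) 1 @ [inverse p])"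
    and "q \<equiv> card (residue_field k v)"
  assumes "nonarch_local_field k v"
    and "unramified_quadratic_extension k v w s"
    and "p \<in> k" "p \<noteq> 0" "v p = 1"
    and "s\<^sup>2 \<in> units_in (integer_ring k v)"
    and "s\<^sup>2 - 1 \<in> (\<lambda>u. 4 * u) ` units_in (integer_ring k v)"
    and "n \<ge> 1"
  shows "(card (orb G ` X) = 2 \<and> X = orb G x0 \<union> orb G x1 \<and> orb G x0 \<inter> orb G x1 = {}) \<and>
    (odd q \<longrightarrow>
       orb G x0 = (\<Union>l\<in>{l \<in> Lambda_plus n. even (sum_list l)}. orb K (x_diag p l)) \<and>
       disjoint_family_on (\<lambda>l. orb K (x_diag p l)) {l \<in> Lambda_plus n. even (sum_list l)} \<and>
       orb G x1 = (\<Union>l\<in>{l \<in> Lambda_plus n. odd (sum_list l)}. orb K (x_diag p l)) \<and>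
       disjoint_family_on (\<lambda>l. orb K (x_diag p l)) {l \<in> Lambda_plus n. odd (sum_list l)}) \<and>
    (even q \<longrightarrow>
       (\<forall>r\<le>n. \<forall>l\<in>Lambda_plus r. \<forall>mu\<in>Lambda2 v (n - r).
          x_block p s l mu \<in> orb G x0 \<longleftrightarrow> even (sum_list l + sum_list mu)))"
proof -
  interpret unitary_setting k v w p s n by unfold_locales (fact assms)+
  interpret U: conj_valuation_ring k v w p s n UNIV by (rule UNIV_ring)
  let ?a = "dg (replicate n 0)" and ?b = "dg (1 # replicate (n - 1) 0)"
  have n: "n \<ge> 1" by fact
  have x: "x0 = ?a" "x1 = ?b" unfolding x0_def x1_def by (rule x0_eq, rule x1_eq[OF n])
  have orbG: "orb G y = orbU y" for y unfolding orb_def G_def unitary_grp_eq ..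
  have orbK: "orb K y = herm_orbit k s (GR {x. vge 0 x}) y" for y
    unfolding orb_def K_def integral_unitary_grp_eq ..
  note two = two_orbits[OF n]
  have part1: "card (orb G ` X) = 2 \<and> X = orb G x0 \<union> orb G x1 \<and> orb G x0 \<inter> orb G x1 = {}"
  proof -
    have "orb G = orbU" using orbG by blast
    then show ?thesis unfolding x X_def using two by simp
  qed
  \<comment> \<open>\<open>P\<close> stands for either parity, so that one argument serves both
    orbits: each integral orbit lies in a single \<open>G\<close>-orbit, which the exponent sum of
    its representative decides.\<close>
  have part2: "orb G y = (\<Union>l\<in>{l \<in> Lambda_plus n. P (sum_list l)}. orb K (x_diag p l)) \<and>
       disjoint_family_on (\<lambda>l. orb K (x_diag p l)) {l \<in> Lambda_plus n. P (sum_list l)}"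
    if q: "odd q" and y: "y = ?a \<or> y = ?b"
      and P: "\<And>l. length l = n \<Longrightarrow> dg l \<in> orbU y \<longleftrightarrow> P (sum_list l)" for y and P :: "int \<Rightarrow> bool"
  proof -
    have w2: "w 2 = 0" using odd_residue_unit_2 q by (simp add: q_def)
    note int = integral_orbits[OF n w2]
    have len: "length l = n" if "l \<in> Lambda_plus n" for l using that by (simp add: Lambda_plus_def)
    have xd: "orb K (x_diag p l) = herm_orbit k s (GR {x. vge 0 x}) (dg l)" if "l \<in> Lambda_plus n" for l
      unfolding orbK x_diag_eq[OF len[OF that]] ..
    have yc: "y \<in> carrier_mat N N" using y by auto
    have "orb G y = (\<Union>l\<in>{l \<in> Lambda_plus n. P (sum_list l)}. orb K (x_diag p l))"
    proof (intro equalityI subsetI)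
      fix z assume z: "z \<in> orb G y"
      then have zy: "z \<in> orbU y" unfolding orbG .
      then have "z \<in> herm_space k s n" using two(1) y by blast
      then obtain l where l: "l \<in> Lambda_plus n" "z \<in> herm_orbit k s (GR {x. vge 0 x}) (dg l)"
        using int(1) by blast
      then have "z \<in> orbU (dg l)" using int(3) by blast
      then have "dg l \<in> orbU y"
        using U.orb_eq[OF dg_carrier] U.orb_eq[OF yc zy] U.orb_refl[OF dg_carrier] by metis
      then have "P (sum_list l)" using P[OF len[OF l(1)]] by blast
      then show "z \<in> (\<Union>l\<in>{l \<in> Lambda_plus n. P (sum_list l)}. orb K (x_diag p l))"
        using l xd by blast
    next
      fix z assume "z \<in> (\<Union>l\<in>{l \<in> Lambda_plus n. P (sum_list l)}. orb K (x_diag p l))"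
      then obtain l where l: "l \<in> Lambda_plus n" "P (sum_list l)" "z \<in> herm_orbit k s (GR {x. vge 0 x}) (dg l)"
        using xd by blast
      have "dg l \<in> orbU y" using P[OF len[OF l(1)]] l(2) by blast
      moreover have "z \<in> orbU (dg l)" using int(3) l(3) by blast
      ultimately show "z \<in> orb G y" unfolding orbG by (rule U.orb_trans[OF yc])
    qed
    moreover have "disjoint_family_on (\<lambda>l. orb K (x_diag p l)) {l \<in> Lambda_plus n. P (sum_list l)}"
      unfolding disjoint_family_on_def using xd int(2) by blast
    ultimately show ?thesis by blast
  qed
  have part3: "x_block p s l mu \<in> orb G x0 \<longleftrightarrow> even (sum_list l + sum_list mu)"
    if "r \<le> n" "l \<in> Lambda_plus r" "mu \<in> Lambda2 v (n - r)" for r l mu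
  proof -
    have len: "length l + length mu = n" using that by (simp add: Lambda_plus_def Lambda2_def)
    let ?X = "x_block p s l mu" and ?L = "l @ rev mu"
    have Xc: "?X \<in> carrier_mat N N" by (rule x_block_carrier[OF len])
    have LX: "dg ?L \<in> orbU ?X" unfolding U.mem_orb_iff by (rule x_block_equivalence[OF len])
    have "?X \<in> orbU ?a \<longleftrightarrow> dg ?L \<in> orbU ?a"
      using U.orb_trans[OF dg_carrier _ LX] U.orb_trans[OF dg_carrier _ U.orb_sym[OF Xc LX]] by blast
    also have "\<dots> \<longleftrightarrow> even (sum_list ?L)" by (rule dg_classification(1)[OF n]) (simp add: len)
    finally show ?thesis unfolding x orbG by simp
  qed
  have x0_part: "orb G x0 = (\<Union>l\<in>{l \<in> Lambda_plus n. even (sum_list l)}. orb K (x_diag p l)) \<and>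
       disjoint_family_on (\<lambda>l. orb K (x_diag p l)) {l \<in> Lambda_plus n. even (sum_list l)}" if "odd q"
  proof (rule part2[OF that])
    show "x0 = ?a \<or> x0 = ?b" using x by simp
    show "dg l \<in> orbU x0 \<longleftrightarrow> even (sum_list l)" if "length l = n" for l
      unfolding x(1) by (rule dg_classification(1)[OF n that])
  qed
  have x1_part: "orb G x1 = (\<Union>l\<in>{l \<in> Lambda_plus n. odd (sum_list l)}. orb K (x_diag p l)) \<and>
       disjoint_family_on (\<lambda>l. orb K (x_diag p l)) {l \<in> Lambda_plus n. odd (sum_list l)}" if "odd q"
  proof (rule part2[OF that])
    show "x1 = ?a \<or> x1 = ?b" using x by simp
    show "dg l \<in> orbU x1 \<longleftrightarrow> odd (sum_list l)" if "length l = n" for l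
      unfolding x(2) by (rule dg_classification(2)[OF n that])
  qed
  show ?thesis
  proof (intro conjI[OF part1] conjI impI allI ballI)
    assume q: "odd q"
    show "orb G x0 = (\<Union>l\<in>{l \<in> Lambda_plus n. even (sum_list l)}. orb K (x_diag p l))"
      by (rule x0_part[OF q, THEN conjunct1])
    show "disjoint_family_on (\<lambda>l. orb K (x_diag p l)) {l \<in> Lambda_plus n. even (sum_list l)}"
      by (rule x0_part[OF q, THEN conjunct2])
    show "orb G x1 = (\<Union>l\<in>{l \<in> Lambda_plus n. odd (sum_list l)}. orb K (x_diag p l))"
      by (rule x1_part[OF q, THEN conjunct1])
    show "disjoint_family_on (\<lambda>l. orb K (x_diag p l)) {l \<in> Lambda_plus n. odd (sum_list l)}"
      by (rule x1_part[OF q, THEN conjunct2])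
  qed (rule part3)
qed

end
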